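(* Let $\mathfrak{Cg}$ be a special twisted current algebra, $\lambda\in P^+$, and let $\boldsymbol\xi=(\xi^\alpha)_{\alpha\in R^+}$ be a $\lambda$-compatible $|R^+|$-tuple of partitions. Assume that for every $\alpha\in R^+$ the partition $\xi^\alpha$ is either rectangular or special. Then $V(\boldsymbol\xi)$ is isomorphic to the quotient of $W_{\mathrm{loc}}(\lambda)$ by the submodule generated by the elements $$\{x_{-\alpha+d_\alpha s_\alpha\delta}\,w_\lambda:\alpha\in R^+\}\ \cup\ \{(x_{-\alpha+d_\alpha(s_\alpha-1)\delta})^{\xi^\alpha_{s_\alpha}+1}w_\lambda:\alpha\in R^+,\ \xi^\alpha\text{ special}\}.$$
   Context: Everything is over $\mathbb C$; $\mathbb N=\{1,2,\dots\}$, $\mathbb Z_+=\{0,1,2,\dots\}$. Setting. $\widehat{\mathfrak g}$ is a twisted affine Kac–Moody algebra of type $A_{2n-1}^{(2)}$ ($n\ge3$), $D_{n+1}^{(2)}$ ($n\ge4$), $E_6^{(2)}$ or $D_4^{(3)}$, with simple roots $\alpha_0,\dots,\alpha_n$ labelled as in Kac's book (Table Aff 2); $m=3$ for $D_4^{(3)}$, $m=2$ otherwise. $\mathfrak g$ is the finite-dimensional simple subalgebra with simple roots $\alpha_1,\dots,\alpha_n$, $\mathfrak h$ its Cartan subalgebra, $\mathfrak n^\pm$ the sums of its positive/negative root spaces, $R=R^+\sqcup R^-$ its roots, $R_s,R_\ell$ its short and long roots, $\alpha^\vee$ the coroot of $\alpha$, $P^+$ its dominant integral weights; $d_\alpha=m$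 if $\alpha$ is long, $d_\alpha=1$ if $\alpha$ is short. $\delta$ is the non-divisible positive imaginary root. The positive real roots of $\widehat{\mathfrak g}$ are $R^+\cup(R_s+\mathbb N\delta)\cup(R_\ell+m\mathbb N\delta)$; $x_\gamma$ is a generator of the root space $\widehat{\mathfrak g}_\gamma$ for a real root $\gamma$. $\widehat{\mathfrak n}^+$ is the sum of all positive root spaces. The special twisted current algebra is $\mathfrak{Cg}=\mathfrak h\oplus\widehat{\mathfrak n}^+\oplus\mathfrak n^-$. (Equivalently, $\mathfrak{Cg}$ is the fixed point subalgebra of $\overline{\mathfrak g}\otimes\mathbb C[t]$, $\overline{\mathfrak g}$ simple of type $A_{2n-1},D_{n+1},E_6,D_4$ respectively, under $x\otimes t^i\mapsto\zeta^{-i}\sigma(x)\otimes t^i$ with $\sigma$ a diagram automorphism of order $m$ and $\zeta$ a primitive $m$-th root of unity.) Put $\mathfrak{Ch}_+=\bigoplus_{k>0}\widehat{\mathfrak g}_{k\delta}$ and let $\mathfrak{Cn}^+$ be the sum of the $\widehat{\mathfrak g}_\gamma$ with $\gamma\in R^+\cup(R_s^++\mathbb N\delta)\cup(R_\ell^++m\mathbb N\delta)$. Local Weyl module. $W_{\mathrm{loc}}(\lambda)$ is the $\mathfrak{Cg}$-module generated by $w_\lambda$ with defining relations $\mathfrak{Cn}^+w_\lambda=0$, $\mathfrak{Ch}_+w_\lambda=0$, $hw_\lambda=\lambda(h)w_\lambda$ ($h\in\mathfrak h$), $x_{-\alpha}^{\lambda(\alpha^\vee)+1}w_\lambda=0$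 ($\alpha\in R^+$). Partitions. $\boldsymbol\xi=(\xi^\alpha)_{\alpha\in R^+}$ is $\lambda$-compatible if each $\xi^\alpha=(\xi^\alpha_1\ge\xi^\alpha_2\ge\cdots\ge0)$ is a partition with $|\xi^\alpha|=\sum_{j\ge1}\xi_j^\alpha=\lambda(\alpha^\vee)$; $s_\alpha$ is its number of non-zero parts ($0$ if empty). A partition is rectangular if it is empty or of the form $(k^c)$ ($k$ repeated $c$ times, $k,c\in\mathbb N$), and special (a special fat hook) if it is of the form $(k_1^{c_1},k_2)$ with $k_1>k_2\ge1$, $c_1\ge1$. $V(\boldsymbol\xi)$ is the quotient of $W_{\mathrm{loc}}(\lambda)$ by the submodule generated by the elements $(x_{\alpha+d_\alpha\delta})^s(x_{-\alpha})^{s+r}w_\lambda$ for $\alpha\in R^+$, $s,r\in\mathbb N$ with $s+r\ge1+rk+\sum_{j\ge k+1}\xi^\alpha_j$ for some $k\in\mathbb N$. *)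

theory Defs
  imports Complex_Main "HOL-Library.Poly_Mapping" "HOL-Algebra.Module" "HOL-Algebra.QuotRing"
begin

section \<open>Complex Lie algebras with Chevalley generators\<close>

text \<open>The Lie algebra is the whole type \<open>'a\<close>; the remaining fields are the Cartan subalgebra, the
  Chevalley generators, the simple roots (linear functionals, only their values on the Cartan
  subalgebra matter) and the simple coroots.\<close>

record 'a km_data =
  scale :: "complex \<Rightarrow> 'a \<Rightarrow> 'a"
  lie :: "'a \<Rightarrow> 'a \<Rightarrow> 'a"
  cartan :: "'a set"
  chev_e :: "nat \<Rightarrow> 'a"
  chev_f :: "nat \<Rightarrow> 'a"
  sroot :: "nat \<Rightarrow> 'a \<Rightarrow> complex"
  scoroot :: "nat \<Rightarrow> 'a"

locale complex_lie_algebra = vector_space sc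
  for sc :: "complex \<Rightarrow> 'a::ab_group_add \<Rightarrow> 'a" +
  fixes br :: "'a \<Rightarrow> 'a \<Rightarrow> 'a"
  assumes br_add_left: "br (x + y) z = br x z + br y z"
    and br_add_right: "br x (y + z) = br x y + br x z"
    and br_scale_left: "br (sc c x) y = sc c (br x y)"
    and br_scale_right: "br x (sc c y) = sc c (br x y)"
    and br_self: "br x x = 0"
    and jacobi: "br x (br y z) + br y (br z x) + br z (br x y) = 0"

abbreviation vspan :: "('a::ab_group_add) km_data \<Rightarrow> 'a set \<Rightarrow> 'a set" where
  "vspan K \<equiv> Modules.module.span (scale K)"

definition lie_subalgebra :: "('a::ab_group_add) km_data \<Rightarrow> 'a set \<Rightarrow> bool" where
  "lie_subalgebra K S \<longleftrightarrow>
     Modules.module.subspace (scale K) S \<and> (\<forall>x\<in>S. \<forall>y\<in>S. lie K x y \<in> S)"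

definition lie_generated :: "('a::ab_group_add) km_data \<Rightarrow> 'a set \<Rightarrow> 'a set" where
  "lie_generated K X = \<Inter>{S. lie_subalgebra K S \<and> X \<subseteq> S}"

definition lie_ideal :: "('a::ab_group_add) km_data \<Rightarrow> 'a set \<Rightarrow> bool" where
  "lie_ideal K J \<longleftrightarrow> Modules.module.subspace (scale K) J \<and> (\<forall>x. \<forall>y\<in>J. lie K x y \<in> J)"

section \<open>Twisted affine Kac--Moody algebras\<close>

text \<open>\<open>Aff_A n\<close>, \<open>Aff_D n\<close>, \<open>Aff_E\<close>, \<open>Aff_D4\<close> stand for
  $A_{2n-1}^{(2)}$, $D_{n+1}^{(2)}$, $E_6^{(2)}$, $D_4^{(3)}$.\<close>

datatype twisted_type = Aff_A nat | Aff_D nat | Aff_E | Aff_D4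

fun valid_type :: "twisted_type \<Rightarrow> bool" where
  "valid_type (Aff_A n) \<longleftrightarrow> 3 \<le> n"
| "valid_type (Aff_D n) \<longleftrightarrow> 4 \<le> n"
| "valid_type Aff_E \<longleftrightarrow> True"
| "valid_type Aff_D4 \<longleftrightarrow> True"

fun rk :: "twisted_type \<Rightarrow> nat" where
  "rk (Aff_A n) = n"
| "rk (Aff_D n) = n"
| "rk Aff_E = 4"
| "rk Aff_D4 = 2"

fun twist :: "twisted_type \<Rightarrow> nat" where
  "twist Aff_D4 = 3"
| "twist _ = 2"

text \<open>The generalized Cartan matrices $a_{ij} = \langle\alpha_i^\vee,\alpha_j\rangle$, $0 \le i,j \le n$,
  in the labelling of Kac, Table Aff 2. An entry $a_{ij}$ with $a_{ij} < -1$ belongs to an arrow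
  pointing towards \<open>i\<close>, i.e. $\alpha_i$ is the shorter root:
  \<^item> \<open>Aff_A n\<close>: nodes 0 and 1 are both joined to 2, then a chain $2 - \dots - (n-1) \Leftarrow n$;
  \<^item> \<open>Aff_D n\<close>: $0 \Leftarrow 1 - \dots - (n-1) \Rightarrow n$;
  \<^item> \<open>Aff_E\<close>: $0 - 1 - 2 \Leftarrow 3 - 4$;
  \<^item> \<open>Aff_D4\<close>: $0 - 1 \Lleftarrow 2$.\<close>

fun gcm :: "twisted_type \<Rightarrow> nat \<Rightarrow> nat \<Rightarrow> int" where
  "gcm (Aff_A n) i j =
     (if i = j then 2
      else if (i, j) = (n - 1, n) then -2
      else if (i, j) = (0, 2) \<or> (i, j) = (2, 0) then -1
      else if 1 \<le> i \<and> 1 \<le> j \<and> (j = Suc i \<or> i = Suc j) then -1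
      else 0)"
| "gcm (Aff_D n) i j =
     (if i = j then 2
      else if (i, j) = (0, 1) \<or> (i, j) = (n, n - 1) then -2
      else if j = Suc i \<or> i = Suc j then -1
      else 0)"
| "gcm Aff_E i j =
     (if i = j then 2
      else if (i, j) = (2, 3) then -2
      else if j = Suc i \<or> i = Suc j then -1
      else 0)"
| "gcm Aff_D4 i j =
     (if i = j then 2
      else if (i, j) = (1, 2) then -3
      else if j = Suc i \<or> i = Suc j then -1
      else 0)"

text \<open>Elements of the root lattice are given by their coefficients with respect to
  $\alpha_0,\dots,\alpha_n$; \<open>root_fun K T \<gamma>\<close> is the corresponding functional on the Cartan subalgebra.\<close>

type_synonym root = "nat \<Rightarrow> int"

definition root_lattice :: "twisted_type \<Rightarrow> root set" where
  "root_lattice T = {\<gamma>. \<forall>i > rk T. \<gamma> i = 0}"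

definition root_fun :: "('a::ab_group_add) km_data \<Rightarrow> twisted_type \<Rightarrow> root \<Rightarrow> 'a \<Rightarrow> complex" where
  "root_fun K T \<gamma> h = (\<Sum>i\<le>rk T. of_int (\<gamma> i) * sroot K i h)"

text \<open>\<open>K\<close> is the Kac--Moody algebra of type \<open>T\<close>: the Cartan subalgebra with the simple roots and
  coroots is a realization of the matrix (of size $n+1$ and corank 1, so of dimension $n+2$), the
  Chevalley relations hold, the Cartan subalgebra and the \<open>e\<^sub>i\<close>, \<open>f\<^sub>i\<close> generate, and no nonzero ideal
  meets the Cartan subalgebra trivially.\<close>

definition twisted_affine :: "twisted_type \<Rightarrow> ('a::ab_group_add) km_data \<Rightarrow> bool" where
  "twisted_affine T K \<longleftrightarrow>
     valid_type T \<and>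
     complex_lie_algebra (scale K) (lie K) \<and>
     Modules.module.subspace (scale K) (cartan K) \<and>
     vector_space.dim (scale K) (cartan K) = rk T + 2 \<and>
     (\<forall>i\<le>rk T. scoroot K i \<in> cartan K) \<and>
     inj_on (scoroot K) {..rk T} \<and>
     \<not> Modules.module.dependent (scale K) (scoroot K ` {..rk T}) \<and>
     (\<forall>i\<le>rk T. \<forall>h\<in>cartan K. \<forall>h'\<in>cartan K. sroot K i (h + h') = sroot K i h + sroot K i h') \<and>
     (\<forall>i\<le>rk T. \<forall>h\<in>cartan K. \<forall>c. sroot K i (scale K c h) = c * sroot K i h) \<and>
     (\<forall>c. (\<forall>h\<in>cartan K. (\<Sum>i\<le>rk T. c i * sroot K i h) = 0) \<longrightarrow> (\<forall>i\<le>rk T. c i = 0)) \<and>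
     (\<forall>i\<le>rk T. \<forall>j\<le>rk T. sroot K j (scoroot K i) = of_int (gcm T i j)) \<and>
     (\<forall>h\<in>cartan K. \<forall>h'\<in>cartan K. lie K h h' = 0) \<and>
     (\<forall>i\<le>rk T. \<forall>h\<in>cartan K. lie K h (chev_e K i) = scale K (sroot K i h) (chev_e K i)) \<and>
     (\<forall>i\<le>rk T. \<forall>h\<in>cartan K. lie K h (chev_f K i) = scale K (- sroot K i h) (chev_f K i)) \<and>
     (\<forall>i\<le>rk T. \<forall>j\<le>rk T.
        lie K (chev_e K i) (chev_f K j) = (if i = j then scoroot K i else 0)) \<and>
     lie_generated K (cartan K \<union> chev_e K ` {..rk T} \<union> chev_f K ` {..rk T}) = UNIV \<and>
     (\<forall>J. lie_ideal K J \<and> J \<inter> cartan K = {0} \<longrightarrow> J = {0})"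

section \<open>Roots and root vectors\<close>

definition root_space :: "('a::ab_group_add) km_data \<Rightarrow> twisted_type \<Rightarrow> root \<Rightarrow> 'a set" where
  "root_space K T \<gamma> = {x. \<forall>h\<in>cartan K. lie K h x = scale K (root_fun K T \<gamma> h) x}"

definition roots :: "('a::ab_group_add) km_data \<Rightarrow> twisted_type \<Rightarrow> root set" where
  "roots K T = {\<gamma> \<in> root_lattice T. \<gamma> \<noteq> (\<lambda>_. 0) \<and> root_space K T \<gamma> \<noteq> {0}}"

definition pos_roots :: "('a::ab_group_add) km_data \<Rightarrow> twisted_type \<Rightarrow> root set" where
  "pos_roots K T = {\<gamma> \<in> roots K T. \<forall>i. 0 \<le> \<gamma> i}"

text \<open>The simple reflection $s_i(\gamma) = \gamma - \langle\gamma,\alpha_i^\vee\rangle\alpha_i$.\<close>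

definition reflect :: "twisted_type \<Rightarrow> nat \<Rightarrow> root \<Rightarrow> root" where
  "reflect T i \<gamma> = \<gamma>(i := \<gamma> i - (\<Sum>j\<le>rk T. gcm T i j * \<gamma> j))"

text \<open>Real roots are the Weyl group conjugates of the simple roots; the other roots are imaginary.\<close>

inductive real_root :: "twisted_type \<Rightarrow> root \<Rightarrow> bool" for T where
  simple: "i \<le> rk T \<Longrightarrow> real_root T (\<lambda>j. if j = i then 1 else 0)"
| reflection: "real_root T \<gamma> \<Longrightarrow> i \<le> rk T \<Longrightarrow> real_root T (reflect T i \<gamma>)"

definition imag_root :: "('a::ab_group_add) km_data \<Rightarrow> twisted_type \<Rightarrow> root \<Rightarrow> bool" where
  "imag_root K T \<gamma> \<longleftrightarrow> \<gamma> \<in> roots K T \<and> \<not> real_root T \<gamma>"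

text \<open>\<open>is_delta K T \<delta>\<close>: \<open>\<delta>\<close> is the non-divisible positive imaginary root.\<close>

definition is_delta :: "('a::ab_group_add) km_data \<Rightarrow> twisted_type \<Rightarrow> root \<Rightarrow> bool" where
  "is_delta K T \<delta> \<longleftrightarrow> \<delta> \<in> pos_roots K T \<and> imag_root K T \<delta> \<and>
     (\<forall>\<beta>\<in>root_lattice T. \<forall>k. \<delta> = (\<lambda>i. int k * \<beta> i) \<longrightarrow> k = 1)"

definition root_shift :: "root \<Rightarrow> nat \<Rightarrow> root \<Rightarrow> root" where
  "root_shift \<alpha> k \<delta> = (\<lambda>i. \<alpha> i + int k * \<delta> i)"

definition real_root_vectors ::
    "('a::ab_group_add) km_data \<Rightarrow> twisted_type \<Rightarrow> (root \<Rightarrow> 'a) \<Rightarrow> bool" where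
  "real_root_vectors K T x \<longleftrightarrow>
     (\<forall>\<gamma>. real_root T \<gamma> \<longrightarrow> root_space K T \<gamma> = vspan K {x \<gamma>})"

section \<open>The finite-dimensional subalgebra\<close>

definition fin_alg :: "('a::ab_group_add) km_data \<Rightarrow> twisted_type \<Rightarrow> 'a set" where
  "fin_alg K T = lie_generated K (chev_e K ` {1..rk T} \<union> chev_f K ` {1..rk T})"

definition fin_cartan :: "('a::ab_group_add) km_data \<Rightarrow> twisted_type \<Rightarrow> 'a set" where
  "fin_cartan K T = vspan K (scoroot K ` {1..rk T})"

definition fin_root_space :: "('a::ab_group_add) km_data \<Rightarrow> twisted_type \<Rightarrow> root \<Rightarrow> 'a set" where
  "fin_root_space K T \<alpha> = root_space K T \<alpha> \<inter> fin_alg K T"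

definition fin_roots :: "('a::ab_group_add) km_data \<Rightarrow> twisted_type \<Rightarrow> root set" where
  "fin_roots K T =
     {\<alpha> \<in> root_lattice T. \<alpha> 0 = 0 \<and> \<alpha> \<noteq> (\<lambda>_. 0) \<and> fin_root_space K T \<alpha> \<noteq> {0}}"

definition fin_pos_roots :: "('a::ab_group_add) km_data \<Rightarrow> twisted_type \<Rightarrow> root set" where
  "fin_pos_roots K T = {\<alpha> \<in> fin_roots K T. \<forall>i. 0 \<le> \<alpha> i}"

definition fin_neg_roots :: "('a::ab_group_add) km_data \<Rightarrow> twisted_type \<Rightarrow> root set" where
  "fin_neg_roots K T = {\<alpha> \<in> fin_roots K T. \<forall>i. \<alpha> i \<le> 0}"

text \<open>Lengths are measured by the invariant form $(\alpha_i,\alpha_j) = c_i a_{ij}$ for a positive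
  symmetrizer \<open>c\<close>. The matrix is indecomposable, so \<open>c\<close> is unique up to a positive factor, on which
  the comparison of lengths does not depend.\<close>

definition symmetrizer :: "twisted_type \<Rightarrow> (nat \<Rightarrow> real) \<Rightarrow> bool" where
  "symmetrizer T c \<longleftrightarrow> (\<forall>i\<le>rk T. 0 < c i) \<and>
     (\<forall>i\<le>rk T. \<forall>j\<le>rk T. c i * of_int (gcm T i j) = c j * of_int (gcm T j i))"

definition sq_length :: "twisted_type \<Rightarrow> (nat \<Rightarrow> real) \<Rightarrow> root \<Rightarrow> real" where
  "sq_length T c \<gamma> =
     (\<Sum>i\<le>rk T. \<Sum>j\<le>rk T. c i * of_int (gcm T i j) * of_int (\<gamma> i) * of_int (\<gamma> j))"

definition long_root :: "('a::ab_group_add) km_data \<Rightarrow> twisted_type \<Rightarrow> root \<Rightarrow> bool" where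
  "long_root K T \<alpha> \<longleftrightarrow> \<alpha> \<in> fin_roots K T \<and>
     (\<forall>c. symmetrizer T c \<longrightarrow> (\<forall>\<beta>\<in>fin_roots K T. sq_length T c \<beta> \<le> sq_length T c \<alpha>))"

definition short_root :: "('a::ab_group_add) km_data \<Rightarrow> twisted_type \<Rightarrow> root \<Rightarrow> bool" where
  "short_root K T \<alpha> \<longleftrightarrow> \<alpha> \<in> fin_roots K T \<and>
     (\<forall>c. symmetrizer T c \<longrightarrow> (\<forall>\<beta>\<in>fin_roots K T. sq_length T c \<alpha> \<le> sq_length T c \<beta>))"

definition dd :: "('a::ab_group_add) km_data \<Rightarrow> twisted_type \<Rightarrow> root \<Rightarrow> nat" where
  "dd K T \<alpha> = (if long_root K T \<alpha> then twist T else 1)"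

definition coroot :: "('a::ab_group_add) km_data \<Rightarrow> twisted_type \<Rightarrow> root \<Rightarrow> 'a" where
  "coroot K T \<alpha> =
     (THE h. (\<exists>y\<in>fin_root_space K T \<alpha>. \<exists>z\<in>fin_root_space K T (- \<alpha>). h = lie K y z) \<and>
             root_fun K T \<alpha> h = 2)"

text \<open>Weights are functionals on the Cartan subalgebra of the finite-dimensional subalgebra; values
  elsewhere are irrelevant.\<close>

definition dominant_integral ::
    "('a::ab_group_add) km_data \<Rightarrow> twisted_type \<Rightarrow> ('a \<Rightarrow> complex) \<Rightarrow> bool" where
  "dominant_integral K T \<Lambda> \<longleftrightarrow>
     (\<forall>h\<in>fin_cartan K T. \<forall>h'\<in>fin_cartan K T. \<Lambda> (h + h') = \<Lambda> h + \<Lambda> h') \<and>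
     (\<forall>h\<in>fin_cartan K T. \<forall>c. \<Lambda> (scale K c h) = c * \<Lambda> h) \<and>
     (\<forall>i\<in>{1..rk T}. \<Lambda> (scoroot K i) \<in> \<nat>)"

section \<open>The special twisted current algebra\<close>

definition current_algebra :: "('a::ab_group_add) km_data \<Rightarrow> twisted_type \<Rightarrow> 'a set" where
  "current_algebra K T = vspan K
     (fin_cartan K T \<union> (\<Union>\<gamma>\<in>pos_roots K T. root_space K T \<gamma>)
        \<union> (\<Union>\<alpha>\<in>fin_neg_roots K T. fin_root_space K T \<alpha>))"

definition current_n_plus :: "('a::ab_group_add) km_data \<Rightarrow> twisted_type \<Rightarrow> root \<Rightarrow> 'a set" where
  "current_n_plus K T \<delta> = vspan K (\<Union>\<gamma> \<in> fin_pos_roots K T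
        \<union> {root_shift \<alpha> k \<delta> | \<alpha> k. \<alpha> \<in> fin_pos_roots K T \<and> short_root K T \<alpha> \<and> 1 \<le> k}
        \<union> {root_shift \<alpha> (twist T * k) \<delta> | \<alpha> k.
             \<alpha> \<in> fin_pos_roots K T \<and> long_root K T \<alpha> \<and> 1 \<le> k}.
      root_space K T \<gamma>)"

definition current_h_plus :: "('a::ab_group_add) km_data \<Rightarrow> twisted_type \<Rightarrow> root \<Rightarrow> 'a set" where
  "current_h_plus K T \<delta> = vspan K (\<Union>k\<in>{1..}. root_space K T (\<lambda>i. int k * \<delta> i))"

section \<open>The universal enveloping algebra\<close>

text \<open>The free associative algebra on a set \<open>L\<close> consists of the finitely supported complex functions
  on the free monoid of words in \<open>L\<close>; its multiplication is that of \<^typ>\<open>'k \<Rightarrow>\<^sub>0 'c\<close>.\<close>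

datatype 'a free_word = Word (letters: "'a list")

instantiation free_word :: (type) monoid_add
begin

definition zero_free_word :: "'a free_word" where "zero_free_word = Word []"

definition plus_free_word :: "'a free_word \<Rightarrow> 'a free_word \<Rightarrow> 'a free_word" where
  "plus_free_word v w = Word (letters v @ letters w)"

instance
  by standard (simp_all add: zero_free_word_def plus_free_word_def)

end

type_synonym 'a free_alg = "'a free_word \<Rightarrow>\<^sub>0 complex"

definition free_algebra :: "'a set \<Rightarrow> 'a free_alg ring" where
  "free_algebra L =
     \<lparr>carrier = {p. \<forall>w\<in>Poly_Mapping.keys p. set (letters w) \<subseteq> L},
      monoid.mult = (*), one = 1, zero = 0, add = (+)\<rparr>"

definition letter :: "'a \<Rightarrow> 'a free_alg" where
  "letter y = Poly_Mapping.single (Word [y]) 1"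

definition const :: "complex \<Rightarrow> 'a free_alg" where
  "const c = Poly_Mapping.single 0 c"

definition env_ideal :: "('a::ab_group_add) km_data \<Rightarrow> 'a set \<Rightarrow> 'a free_alg set" where
  "env_ideal K L = genideal (free_algebra L)
     ({letter (y + z) - letter y - letter z | y z. y \<in> L \<and> z \<in> L}
      \<union> {letter (scale K c y) - const c * letter y | c y. y \<in> L}
      \<union> {letter y * letter z - letter z * letter y - letter (lie K y z) | y z. y \<in> L \<and> z \<in> L})"

definition env :: "('a::ab_group_add) km_data \<Rightarrow> 'a set \<Rightarrow> 'a free_alg set ring" where
  "env K L = free_algebra L Quot env_ideal K L"

definition env_of :: "('a::ab_group_add) km_data \<Rightarrow> 'a set \<Rightarrow> 'a free_alg \<Rightarrow> 'a free_alg set" where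
  "env_of K L p = env_ideal K L +>\<^bsub>free_algebra L\<^esub> p"

section \<open>Left modules\<close>

text \<open>A module over a Lie algebra is a left module over its enveloping algebra. Left modules over a
  not necessarily commutative ring are records of type \<^typ>\<open>('u, 'm) module\<close>, whose \<open>mult\<close> and \<open>one\<close>
  fields play no role (in \<open>quot_module\<close> they are dummies).\<close>

definition regular_module :: "'u ring \<Rightarrow> ('u, 'u) module" where
  "regular_module R =
     \<lparr>carrier = carrier R, monoid.mult = monoid.mult R, one = one R,
      zero = zero R, add = add R, smult = monoid.mult R\<rparr>"

definition submodule_gen :: "'u ring \<Rightarrow> ('u, 'm) module \<Rightarrow> 'm set \<Rightarrow> 'm set" where
  "submodule_gen R M S = \<Inter>{N. submodule N R M \<and> S \<subseteq> N}"

definition quot_module :: "('u, 'm) module \<Rightarrow> 'm set \<Rightarrow> ('u, 'm set) module" where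
  "quot_module M N =
     \<lparr>carrier = a_rcosets\<^bsub>M\<^esub> N, monoid.mult = (\<lambda>_ _. N), one = N,
      zero = N, add = set_add M,
      smult = (\<lambda>u X. \<Union>y\<in>X. N +>\<^bsub>M\<^esub> (u \<odot>\<^bsub>M\<^esub> y))\<rparr>"

definition module_isomorphic :: "'u ring \<Rightarrow> ('u, 'm) module \<Rightarrow> ('u, 'k) module \<Rightarrow> bool" where
  "module_isomorphic R M N \<longleftrightarrow>
     (\<exists>\<phi>. bij_betw \<phi> (carrier M) (carrier N) \<and>
        (\<forall>y\<in>carrier M. \<forall>z\<in>carrier M. \<phi> (y \<oplus>\<^bsub>M\<^esub> z) = \<phi> y \<oplus>\<^bsub>N\<^esub> \<phi> z) \<and>
        (\<forall>u\<in>carrier R. \<forall>y\<in>carrier M. \<phi> (u \<odot>\<^bsub>M\<^esub> y) = u \<odot>\<^bsub>N\<^esub> \<phi> y))"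

text \<open>The module with one generator and defining relations \<open>u\<close> times generator \<open>= 0\<close> for \<open>u \<in> S\<close>.\<close>

definition cyclic_module :: "'u ring \<Rightarrow> 'u set \<Rightarrow> ('u, 'u set) module" where
  "cyclic_module R S = quot_module (regular_module R) (submodule_gen R (regular_module R) S)"

definition cyclic_generator :: "'u ring \<Rightarrow> 'u set \<Rightarrow> 'u set" where
  "cyclic_generator R S =
     submodule_gen R (regular_module R) S +>\<^bsub>regular_module R\<^esub> \<one>\<^bsub>R\<^esub>"

section \<open>Local Weyl modules\<close>

abbreviation env_Cg :: "('a::ab_group_add) km_data \<Rightarrow> twisted_type \<Rightarrow> 'a free_alg set ring" where
  "env_Cg K T \<equiv> env K (current_algebra K T)"

definition elt_Cg :: "('a::ab_group_add) km_data \<Rightarrow> twisted_type \<Rightarrow> 'a \<Rightarrow> 'a free_alg set" where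
  "elt_Cg K T y = env_of K (current_algebra K T) (letter y)"

definition local_weyl_relations ::
    "('a::ab_group_add) km_data \<Rightarrow> twisted_type \<Rightarrow> root \<Rightarrow> (root \<Rightarrow> 'a) \<Rightarrow> ('a \<Rightarrow> complex)
       \<Rightarrow> 'a free_alg set set" where
  "local_weyl_relations K T \<delta> x \<Lambda> =
     elt_Cg K T ` current_n_plus K T \<delta>
     \<union> elt_Cg K T ` current_h_plus K T \<delta>
     \<union> {env_of K (current_algebra K T) (letter h - const (\<Lambda> h)) | h. h \<in> fin_cartan K T}
     \<union> {elt_Cg K T (x (- \<alpha>)) [^]\<^bsub>env_Cg K T\<^esub> (N + 1) | \<alpha> (N::nat).
          \<alpha> \<in> fin_pos_roots K T \<and> of_nat N = \<Lambda> (coroot K T \<alpha>)}"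

definition W_loc ::
    "('a::ab_group_add) km_data \<Rightarrow> twisted_type \<Rightarrow> root \<Rightarrow> (root \<Rightarrow> 'a) \<Rightarrow> ('a \<Rightarrow> complex)
       \<Rightarrow> ('a free_alg set, 'a free_alg set set) module" where
  "W_loc K T \<delta> x \<Lambda> = cyclic_module (env_Cg K T) (local_weyl_relations K T \<delta> x \<Lambda>)"

definition w_gen ::
    "('a::ab_group_add) km_data \<Rightarrow> twisted_type \<Rightarrow> root \<Rightarrow> (root \<Rightarrow> 'a) \<Rightarrow> ('a \<Rightarrow> complex)
       \<Rightarrow> 'a free_alg set set" where
  "w_gen K T \<delta> x \<Lambda> = cyclic_generator (env_Cg K T) (local_weyl_relations K T \<delta> x \<Lambda>)"

text \<open>The quotient of the local Weyl module by the submodule generated by \<open>S\<close>.\<close>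

definition W_loc_quotient ::
    "('a::ab_group_add) km_data \<Rightarrow> twisted_type \<Rightarrow> root \<Rightarrow> (root \<Rightarrow> 'a) \<Rightarrow> ('a \<Rightarrow> complex)
       \<Rightarrow> 'a free_alg set set set \<Rightarrow> ('a free_alg set, 'a free_alg set set set) module" where
  "W_loc_quotient K T \<delta> x \<Lambda> S =
     quot_module (W_loc K T \<delta> x \<Lambda>) (submodule_gen (env_Cg K T) (W_loc K T \<delta> x \<Lambda>) S)"

section \<open>Partitions and the modules attached to them\<close>

text \<open>A partition is the weakly decreasing list of its non-zero parts, so the number of non-zero
  parts is the length and the \<open>j\<close>-th part is entry \<open>j - 1\<close> (zero beyond the length).\<close>

definition partition :: "nat list \<Rightarrow> bool" where
  "partition p \<longleftrightarrow> sorted_wrt (\<ge>) p \<and> 0 \<notin> set p"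

definition rectangular :: "nat list \<Rightarrow> bool" where
  "rectangular p \<longleftrightarrow> p = [] \<or> (\<exists>k\<ge>1. \<exists>c\<ge>1. p = replicate c k)"

definition special :: "nat list \<Rightarrow> bool" where
  "special p \<longleftrightarrow> (\<exists>k1 k2 c1. k1 > k2 \<and> k2 \<ge> 1 \<and> c1 \<ge> 1 \<and> p = replicate c1 k1 @ [k2])"

definition compatible ::
    "('a::ab_group_add) km_data \<Rightarrow> twisted_type \<Rightarrow> ('a \<Rightarrow> complex) \<Rightarrow> (root \<Rightarrow> nat list) \<Rightarrow> bool" where
  "compatible K T \<Lambda> \<xi> \<longleftrightarrow>
     (\<forall>\<alpha>\<in>fin_pos_roots K T. partition (\<xi> \<alpha>) \<and> of_nat (sum_list (\<xi> \<alpha>)) = \<Lambda> (coroot K T \<alpha>))"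

definition V_relations ::
    "('a::ab_group_add) km_data \<Rightarrow> twisted_type \<Rightarrow> root \<Rightarrow> (root \<Rightarrow> 'a) \<Rightarrow> ('a \<Rightarrow> complex)
       \<Rightarrow> (root \<Rightarrow> nat list) \<Rightarrow> 'a free_alg set set set" where
  "V_relations K T \<delta> x \<Lambda> \<xi> =
     {(elt_Cg K T (x (root_shift \<alpha> (dd K T \<alpha>) \<delta>)) [^]\<^bsub>env_Cg K T\<^esub> s
         \<otimes>\<^bsub>env_Cg K T\<^esub> elt_Cg K T (x (- \<alpha>)) [^]\<^bsub>env_Cg K T\<^esub> (s + r))
        \<odot>\<^bsub>W_loc K T \<delta> x \<Lambda>\<^esub> w_gen K T \<delta> x \<Lambda> | \<alpha> (s::nat) (r::nat).
        \<alpha> \<in> fin_pos_roots K T \<and> 1 \<le> s \<and> 1 \<le> r \<and>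
        (\<exists>k\<ge>1. s + r \<ge> 1 + r * k + sum_list (drop k (\<xi> \<alpha>)))}"

definition V_module ::
    "('a::ab_group_add) km_data \<Rightarrow> twisted_type \<Rightarrow> root \<Rightarrow> (root \<Rightarrow> 'a) \<Rightarrow> ('a \<Rightarrow> complex)
       \<Rightarrow> (root \<Rightarrow> nat list) \<Rightarrow> ('a free_alg set, 'a free_alg set set set) module" where
  "V_module K T \<delta> x \<Lambda> \<xi> = W_loc_quotient K T \<delta> x \<Lambda> (V_relations K T \<delta> x \<Lambda> \<xi>)"

end

theory Submission
  imports Defs "HOL-Library.Function_Algebras"
begin

text \<open>
  Both modules are quotients of the same local Weyl module, so it suffices that a submodule contains
  one set of relations iff it contains the other; this can be checked for each positive root
  \<open>\<alpha>\<close> separately. The root vectors $x_{\pm\alpha + k d_\alpha \delta}$ span a copy of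
  $\mathfrak{sl}_2[t]$. With $e \otimes t$ and all $h \otimes t^j$, $j > 0$, killing the
  generator $w$, the vector $(e \otimes t)^s (f \otimes 1)^{s+r} w$ equals, up to the sign
  $(-1)^s$, a combination with nonnegative coefficients of the monomials
  $f t^{j_1} \cdots f t^{j_r} w$ with $\sum j_i = s$. For a partition that is rectangular or a special
  fat hook, counting how often the largest exponent has to occur in such a monomial gives both
  inclusions; the absence of signs guarantees that no coefficient needed cancels.

  The copies of $\mathfrak{sl}_2[t]$ are obtained from the axioms of the Kac--Moody algebra: the
  automorphisms $\exp(\mathrm{ad}\,e_i)\exp(-\mathrm{ad}\,f_i)\exp(\mathrm{ad}\,e_i)$ carry the
  triple $(e_i, f_i, \alpha_i^\vee)$ to every real root, and the roots that are not real
  are the multiples of \<open>\<delta>\<close>.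
\<close>

section \<open>Garland's formula\<close>

text \<open>The axioms offer no loop realization, so the currents over a finite root \<alpha> are
  rebuilt from two real root triples, those of \<alpha> + d\<delta> (d =
  \<open>dd K T \<alpha>\<close>) and \<alpha>: a bracket of weight d\<delta> between them produces
  all the others. That the resulting f_j commute is a parity fact: 2\<alpha> + k\<delta> is never a
  root. No basis theorem for the enveloping algebra enters. A submodule of the local Weyl module is
  pulled back to the left ideal of those noncommutative polynomials that send the generator into it,
  and all computations take place in the free algebra modulo the enveloping relations. Root vectors
  are prescribed only up to nonzero scalars, which such a left ideal does not see. The partition
  enters through sum_j min(r, \<xi>_j), the minimum over k \<ge> 0 of r k + sum_{j>k} \<xi>_j. For a
  rectangle or a special fat hook, each range of r is governed by one relation: the power bound of
  the local Weyl module, the vanishing of f_s for s the number of parts, or the bounded power of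
  f_{s-1}.\<close>

fun bump :: "nat \<Rightarrow> nat list \<Rightarrow> nat list list" where
  "bump c [] = []"
| "bump c (b # L) = ((b + c) # L) # map ((#) b) (bump c L)"

text \<open>Bookkeeping for moving e to the right through a monomial: e turns some f_a into h_a, and
  h_a acting on a later f_b yields f_{a+b+1}, hence \<open>Suc a\<close>. Repetitions are kept, so
  coefficients are multiplicities.\<close>

fun merges :: "nat list \<Rightarrow> nat list list" where
  "merges [] = []"
| "merges (a # L) = map ((#) a) (merges L) @ bump (Suc a) L"

fun merge_steps :: "nat \<Rightarrow> nat list \<Rightarrow> nat list list" where
  "merge_steps 0 L = [L]"
| "merge_steps (Suc s) L = concat (map merges (merge_steps s L))"

lemma bump_shape: "M \<in> set (bump c L) \<Longrightarrow> length M = length L \<and> sum_list M = sum_list L + c"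
  by (induction L arbitrary: M) auto

lemma merges_shape:
  "M \<in> set (merges L) \<Longrightarrow> Suc (length M) = length L \<and> sum_list M = Suc (sum_list L)"
  by (induction L arbitrary: M) (auto dest: bump_shape)

text \<open>Each merge loses one entry and adds one to the total, so s + r zeros end as r exponents
  of sum s.\<close>

lemma merge_steps_shape:
  "M \<in> set (merge_steps s L) \<Longrightarrow> length M + s = length L \<and> sum_list M = sum_list L + s"
  by (induction s arbitrary: M) (fastforce dest: merges_shape)+

lemma merge_steps_Suc_left:
  "set (merge_steps (Suc s) L) = (\<Union>M\<in>set (merges L). set (merge_steps s M))"
  by (induction s) auto

lemma merge_steps_trans:
  "M \<in> set (merge_steps s L) \<Longrightarrow> N \<in> set (merge_steps t M) \<Longrightarrow> N \<in> set (merge_steps (s + t) L)"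
  by (induction t arbitrary: N) auto

lemma merge_steps_Cons: "M \<in> set (merge_steps s L) \<Longrightarrow> a # M \<in> set (merge_steps s (a # L))"
proof (induction s arbitrary: M)
  case (Suc s)
  then obtain N where "N \<in> set (merge_steps s L)" "M \<in> set (merges N)" by auto
  then show ?case using Suc.IH[of N] by force
qed simp

text \<open>Each merge pushes the accumulated exponent into the next zero, which becomes its
  successor.\<close>

lemma merge_steps_block:
  "(j + p) # L \<in> set (merge_steps p (j # replicate p 0 @ L))"
proof (induction p arbitrary: j)
  case (Suc p)
  have "Suc j # replicate p 0 @ L \<in> set (merges (j # replicate (Suc p) 0 @ L))" by simp
  then show ?case using Suc[of "Suc j"] unfolding merge_steps_Suc_left by auto
qed simp

text \<open>Cut the zeros into r blocks of length p + 1 and collapse each block. That this list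
  occurs at all makes its coefficient in Garland's formula nonzero.\<close>

lemma replicate_reachable:
  "replicate r p \<in> set (merge_steps (r * p) (replicate (r * p + r) 0))"
proof (induction r)
  case (Suc r)
  let ?L = "replicate (r * p + r) (0::nat)"
  have "p # replicate r p \<in> set (merge_steps (r * p) (p # ?L))"
    by (rule merge_steps_Cons[OF Suc])
  moreover have "p # ?L \<in> set (merge_steps p (0 # replicate p 0 @ ?L))"
    using merge_steps_block[of 0 p ?L] by simp
  moreover have "0 # replicate p 0 @ ?L = replicate (Suc r * p + Suc r) (0::nat)"
    by (simp add: replicate_add[symmetric] algebra_simps)
  ultimately show ?case using merge_steps_trans[of "p # ?L" p _ "p # replicate r p" "r * p"] by simp
qed simp

text \<open>In the application \<open>C\<close> is the free algebra on a set of letters, a proper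
  part of its type; \<open>Z\<close> consists of the enveloping relations, and \<open>J\<close> of
  the operators sending the generator into a given submodule.\<close>

locale left_ideal_mod =
  fixes C Z J :: "'r::ring_1 set"
  assumes C_one: "1 \<in> C" and C_diff: "u \<in> C \<Longrightarrow> v \<in> C \<Longrightarrow> u - v \<in> C"
    and C_mult: "u \<in> C \<Longrightarrow> v \<in> C \<Longrightarrow> u * v \<in> C"
    and Z_left: "u \<in> C \<Longrightarrow> z \<in> Z \<Longrightarrow> u * z \<in> Z"
    and Z_right: "u \<in> C \<Longrightarrow> z \<in> Z \<Longrightarrow> z * u \<in> Z"
    and Z_zero: "0 \<in> Z" and Z_diff: "u \<in> Z \<Longrightarrow> v \<in> Z \<Longrightarrow> u - v \<in> Z"
    and Z_J: "Z \<subseteq> J"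
    and J_diff: "u \<in> J \<Longrightarrow> v \<in> J \<Longrightarrow> u - v \<in> J"
    and J_left: "u \<in> C \<Longrightarrow> v \<in> J \<Longrightarrow> u * v \<in> J"
begin

lemma C_zero: "0 \<in> C" using C_diff[OF C_one C_one] by simp
lemma C_minus: "u \<in> C \<Longrightarrow> - u \<in> C" using C_diff[OF C_zero, of u] by simp
lemma C_add: "u \<in> C \<Longrightarrow> v \<in> C \<Longrightarrow> u + v \<in> C" using C_diff[OF _ C_minus, of u v] by simp
lemma Z_minus: "u \<in> Z \<Longrightarrow> - u \<in> Z" using Z_diff[OF Z_zero, of u] by simp
lemma Z_add: "u \<in> Z \<Longrightarrow> v \<in> Z \<Longrightarrow> u + v \<in> Z" using Z_diff[OF _ Z_minus, of u v] by simp
lemma J_zero: "0 \<in> J" using Z_zero Z_J by auto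
lemma J_minus: "u \<in> J \<Longrightarrow> - u \<in> J" using J_diff[OF J_zero, of u] by simp
lemma J_add: "u \<in> J \<Longrightarrow> v \<in> J \<Longrightarrow> u + v \<in> J" using J_diff[OF _ J_minus, of u v] by simp
lemma J_cong: "u - v \<in> J \<Longrightarrow> u \<in> J \<longleftrightarrow> v \<in> J"
  using J_add[of "u - v" v] J_diff[of u "u - v"] by auto
lemma C_power: "u \<in> C \<Longrightarrow> u ^ k \<in> C" by (induction k) (auto intro: C_one C_mult)
lemma C_of_nat: "of_nat k \<in> C" by (induction k) (auto intro: C_zero C_one C_add)
lemma C_of_int: "of_int k \<in> C"
  by (cases k rule: int_cases2) (auto intro: C_of_nat C_minus)
lemma J_sum_list: "(\<And>u. u \<in> set us \<Longrightarrow> u \<in> J) \<Longrightarrow> sum_list us \<in> J"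
  by (induction us) (auto intro: J_zero J_add)
lemma C_prod_list: "(\<And>u. u \<in> set us \<Longrightarrow> u \<in> C) \<Longrightarrow> prod_list us \<in> C"
  by (induction us) (auto intro: C_one C_mult)
lemma C_sum_list: "(\<And>u. u \<in> set us \<Longrightarrow> u \<in> C) \<Longrightarrow> sum_list us \<in> C"
  by (induction us) (auto intro: C_zero C_add)

end

text \<open>\<open>e\<close>, \<open>f j\<close>, \<open>h j\<close> stand for $e \otimes t$, $f \otimes t^j$, $h \otimes t^{j+1}$ in
  $\mathfrak{sl}_2[t]$; the relations hold modulo the two-sided ideal \<open>Z\<close>.\<close>

locale sl2_left_ideal = left_ideal_mod C Z J
  for C Z J :: "'r::ring_1 set" +
  fixes e :: 'r and f h :: "nat \<Rightarrow> 'r"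
  assumes e_C: "e \<in> C" and f_C: "f j \<in> C" and h_C: "h j \<in> C"
    and e_J: "e \<in> J" and h_J: "h j \<in> J"
    and ef: "e * f j - f j * e - h j \<in> Z"
    and hf: "h c * f b - f b * h c + 2 * f (b + Suc c) \<in> Z"
    and ff: "f i * f j - f j * f i \<in> Z"
    and J_cancel: "0 < m \<Longrightarrow> u \<in> C \<Longrightarrow> of_nat m * u \<in> J \<Longrightarrow> u \<in> J"
begin

definition mon :: "nat list \<Rightarrow> 'r" where "mon L = prod_list (map f L)"

abbreviation mon_sum :: "nat list list \<Rightarrow> 'r" where "mon_sum Ls \<equiv> sum_list (map mon Ls)"

lemma mon_simps [simp]: "mon [] = 1" "mon (a # L) = f a * mon L"
  "mon (L @ M) = mon L * mon M" "mon (replicate k a) = f a ^ k"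
  by (simp_all add: mon_def prod_list_replicate)

lemma mon_C [simp]: "mon L \<in> C"
  unfolding mon_def by (intro C_prod_list) (auto intro: f_C)

lemma mon_sum_C [simp]: "mon_sum Ls \<in> C"
  by (intro C_sum_list) auto

lemma mon_sum_Cons: "mon_sum (map ((#) a) Ls) = f a * mon_sum Ls"
  by (induction Ls) (auto simp: algebra_simps)

text \<open>Moving \<open>h c\<close> past a factor f_b costs -2 f_{b+c+1}; after the last factor it
  lies in \<open>J\<close>.\<close>

lemma bump_relation: "h c * mon L + 2 * mon_sum (bump (Suc c) L) \<in> J"
proof (induction L)
  case Nil then show ?case using h_J by simp
next
  case (Cons b L)
  have eq: "h c * mon (b # L) + 2 * mon_sum (bump (Suc c) (b # L)) =
     (h c * f b - f b * h c + 2 * f (b + Suc c)) * mon L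
     + f b * (h c * mon L + 2 * mon_sum (bump (Suc c) L))"
    by (simp add: mon_sum_Cons algebra_simps mult_2 del: map_map)
  show ?case unfolding eq
    by (rule J_add[OF subsetD[OF Z_J Z_right[OF mon_C hf]] J_left[OF f_C Cons]])
qed

text \<open>Same scheme for \<open>e\<close>, except that passing f_b leaves \<open>h b\<close> in
  front of the remaining factors, which \<open>bump_relation\<close> disposes of.\<close>

lemma merges_relation: "e * mon L + 2 * mon_sum (merges L) \<in> J"
proof (induction L)
  case Nil then show ?case using e_J by simp
next
  case (Cons b L)
  have eq: "e * mon (b # L) + 2 * mon_sum (merges (b # L)) =
     (e * f b - f b * e - h b) * mon L + f b * (e * mon L + 2 * mon_sum (merges L))
     + (h b * mon L + 2 * mon_sum (bump (Suc b) L))"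
    by (simp add: mon_sum_Cons algebra_simps mult_2 del: map_map)
  show ?case unfolding eq
    by (rule J_add[OF J_add[OF subsetD[OF Z_J Z_right[OF mon_C ef]] J_left[OF f_C Cons]] bump_relation])
qed

lemma merges_relation_sum:
  "e * mon_sum Ls + 2 * mon_sum (concat (map merges Ls)) \<in> J"
proof (induction Ls)
  case (Cons L Ls)
  have "e * mon_sum (L # Ls) + 2 * mon_sum (concat (map merges (L # Ls))) =
     (e * mon L + 2 * mon_sum (merges L))
     + (e * mon_sum Ls + 2 * mon_sum (concat (map merges Ls)))"
    by (simp add: algebra_simps)
  also have "\<dots> \<in> J" by (rule J_add[OF merges_relation Cons])
  finally show ?case .
qed (simp add: J_zero)

text \<open>Garland's formula without its coefficients: all contributions have the same sign, so that
  they cannot cancel.\<close>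

lemma garland: "e ^ s * mon L - of_int ((- 2) ^ s) * mon_sum (merge_steps s L) \<in> J"
proof (induction s)
  case 0 then show ?case by (simp add: J_zero)
next
  case (Suc s)
  let ?a = "of_int ((- 2) ^ s) :: 'r" and ?S = "mon_sum (merge_steps s L)"
  have comm: "e * ?a = ?a * e" by (metis mult_of_int_commute)
  have comm2: "2 * ?a = ?a * 2" by (metis mult_of_int_commute of_int_numeral)
  have eq: "e ^ Suc s * mon L - of_int ((- 2) ^ Suc s) * mon_sum (merge_steps (Suc s) L) =
     e * (e ^ s * mon L - ?a * ?S)
     + ?a * (e * ?S + 2 * mon_sum (merge_steps (Suc s) L))"
    using comm comm2 by (simp add: algebra_simps flip: mult.assoc)
  show ?case unfolding eq
    using J_add[OF J_left[OF e_C Suc] J_left[OF C_of_int[of "(- 2) ^ s"] merges_relation_sum]]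
    by simp
qed

lemma J_cancel_int: assumes "m \<noteq> 0" "u \<in> C" shows "of_int m * u \<in> J \<longleftrightarrow> u \<in> J"
proof
  assume "of_int m * u \<in> J"
  moreover have "of_int m * u = of_nat (nat \<bar>m\<bar>) * u \<or> of_int m * u = - (of_nat (nat \<bar>m\<bar>) * u)"
    by (cases "m \<ge> 0") (auto simp: of_nat_nat)
  ultimately have "of_nat (nat \<bar>m\<bar>) * u \<in> J" using J_minus by force
  then show "u \<in> J" using J_cancel[of "nat \<bar>m\<bar>" u] assms by auto
qed (use J_left C_of_int in blast)

text \<open>The factor (-2)^s may be dropped because \<open>J\<close> is closed under division by
  positive integers.\<close>

lemma garland_iff:
  "e ^ s * f 0 ^ (s + r) \<in> J \<longleftrightarrow> mon_sum (merge_steps s (replicate (s + r) 0)) \<in> J"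
  using J_cong[OF garland[of s "replicate (s + r) 0"]] J_cancel_int[of "(- 2) ^ s"] by simp

text \<open>\<open>J\<close> is only a left ideal, so a factor known to lie in it has to stand
  rightmost; the f_j commute modulo \<open>Z\<close>, which allows all copies of one of them to be
  moved there.\<close>

lemma collect: "mon L - mon (filter (\<lambda>b. b \<noteq> c) L) * f c ^ count_list L c \<in> Z"
proof (induction L)
  case Nil then show ?case by (simp add: Z_zero)
next
  case (Cons a L)
  let ?R = "mon (filter (\<lambda>b. b \<noteq> c) L)" and ?k = "count_list L c"
  have swap: "f c * mon M - mon M * f c \<in> Z" for M
  proof (induction M)
    case (Cons b M)
    have "f c * mon (b # M) - mon (b # M) * f c =
       (f c * f b - f b * f c) * mon M + f b * (f c * mon M - mon M * f c)"
      by (simp add: algebra_simps)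
    then show ?case using Z_add[OF Z_right[OF mon_C ff] Z_left[OF f_C Cons]] by simp
  qed (simp add: Z_zero)
  show ?case
  proof (cases "a = c")
    case True
    have "mon (a # L) - mon (filter (\<lambda>b. b \<noteq> c) (a # L)) * f c ^ count_list (a # L) c =
       f c * (mon L - ?R * f c ^ ?k) + (f c * ?R - ?R * f c) * f c ^ ?k"
      using True by (simp add: algebra_simps)
    then show ?thesis
      using Z_add[OF Z_left[OF f_C Cons] Z_right[OF C_power[OF f_C] swap]] by simp
  next
    case False
    then have "mon (a # L) - mon (filter (\<lambda>b. b \<noteq> c) (a # L)) * f c ^ count_list (a # L) c =
       f a * (mon L - ?R * f c ^ ?k)"
      by (simp add: algebra_simps)
    then show ?thesis using Z_left[OF f_C Cons] by simp
  qed
qed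

lemma J_power_le: assumes "f c ^ k \<in> J" "k \<le> l" shows "f c ^ l \<in> J"
proof -
  have "f c ^ l = f c ^ (l - k) * f c ^ k" using assms by (simp flip: power_add)
  then show ?thesis using J_left[OF C_power[OF f_C] assms(1)] by simp
qed

lemma mon_J: assumes "f c ^ k \<in> J" "k \<le> count_list L c" shows "mon L \<in> J"
proof -
  have "mon L - mon (filter (\<lambda>b. b \<noteq> c) L) * f c ^ count_list L c \<in> J"
    using collect Z_J by blast
  then show ?thesis using J_cong J_left[OF mon_C J_power_le[OF assms]] by blast
qed

text \<open>Bracketing with \<open>h p\<close> shifts f_s to f_{s+p+1}; of the two products in the
  commutator one lies in \<open>J\<close> because of f_s, the other because of
  \<open>h p\<close>.\<close>

lemma f_J_le: assumes "f s \<in> J" "s \<le> j" shows "f j \<in> J"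
proof (cases "j = s")
  case False
  define p where "p = j - Suc s"
  have j: "j = s + Suc p" using False assms unfolding p_def by simp
  have "h p * f s - f s * h p + 2 * f j \<in> J" using hf[of p s] Z_J j by blast
  then have "2 * f j \<in> J"
    using J_diff[OF _ J_diff[OF J_left[OF h_C assms(1)] J_left[OF f_C h_J]], of _ p s p]
    by fastforce
  then show ?thesis using J_cancel[of 2 "f j"] f_C by simp
qed (use assms in simp)

lemma mon_J_part: assumes "f s \<in> J" "j \<in> set L" "s \<le> j" shows "mon L \<in> J"
proof (rule mon_J[of j 1])
  show "1 \<le> count_list L j" using assms(2) by (metis count_list_0_iff less_one not_less)
qed (use f_J_le[OF assms(1,3)] in simp)

end

section \<open>Power relations against Garland relations for rectangles and fat hooks\<close>

lemma sum_list_part_bound: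
  assumes "\<forall>j\<in>set L. j \<le> c" shows "sum_list L \<le> c * length (L::nat list)"
  using assms by (induction L) auto

lemma sum_list_eq_replicate:
  assumes "\<forall>j\<in>set L. j \<le> c" "sum_list L = c * length (L::nat list)"
  shows "L = replicate (length L) c"
  using assms
proof (induction L)
  case (Cons a L)
  have "sum_list L \<le> c * length L" using Cons.prems by (intro sum_list_part_bound) auto
  then have "a = c" "sum_list L = c * length L" using Cons.prems by auto
  then show ?case using Cons by auto
qed simp

text \<open>An entry different from c falls short of c by at least one, which pays for its unit in
  the length; entries equal to c are charged to the count.\<close>

lemma sum_list_count_bound:
  assumes "\<forall>j\<in>set L. j \<le> c"
  shows "sum_list L + length L \<le> c * length (L::nat list) + count_list L c"
  using assms
proof (induction L)
  case (Cons a L)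
  then show ?case by (cases "a = c") fastforce+
qed simp

context sl2_left_ideal
begin

text \<open>Pigeonhole: r exponents below c add up to at most r (c - 1), which is less than
  s.\<close>

lemma garland_vanish:
  assumes "f c \<in> J" "1 \<le> s" "s + r \<ge> 1 + r * c"
  shows "e ^ s * f 0 ^ (s + r) \<in> J"
  unfolding garland_iff
proof (intro J_sum_list)
  fix u assume "u \<in> set (map mon (merge_steps s (replicate (s + r) 0)))"
  then obtain L where L: "L \<in> set (merge_steps s (replicate (s + r) 0))" "u = mon L" by auto
  from merge_steps_shape[OF L(1)] have sh: "length L = r" "sum_list L = s"
    by (auto simp: sum_list_replicate)
  have "\<exists>j\<in>set L. c \<le> j"
  proof (rule ccontr)
    assume "\<not> ?thesis"
    \<comment> \<open>Truncated subtraction matters only for c = 0; there the assumption empties L,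
      and s = \<open>sum_list L\<close> = 0 contradicts 1 \<le> s.\<close>
    then have *: "\<forall>j\<in>set L. j \<le> c - 1" and c: "c \<ge> 1 \<or> L = []"
      by (auto simp: not_le) (metis One_nat_def Suc_leI gr0I last_in_set less_nat_zero_code)
    have "s \<le> (c - 1) * r" using sum_list_part_bound[OF *] sh by simp
    then show False using assms c sh by (cases c) (auto simp: algebra_simps)
  qed
  then show "u \<in> J" using mon_J_part[OF assms(1)] L(2) by auto
qed

text \<open>If no exponent exceeds c, the total s forces c to occur more than k times, and the
  corresponding power of f_c can be collected on the right.\<close>

lemma garland_vanish_hook:
  assumes "f (Suc c) \<in> J" "f c ^ Suc k \<in> J" "s + r \<ge> 1 + r * c + k"
  shows "e ^ s * f 0 ^ (s + r) \<in> J"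
  unfolding garland_iff
proof (intro J_sum_list)
  fix u assume "u \<in> set (map mon (merge_steps s (replicate (s + r) 0)))"
  then obtain L where L: "L \<in> set (merge_steps s (replicate (s + r) 0))" "u = mon L" by auto
  from merge_steps_shape[OF L(1)] have sh: "length L = r" "sum_list L = s"
    by (auto simp: sum_list_replicate)
  show "u \<in> J"
  proof (cases "\<exists>j\<in>set L. Suc c \<le> j")
    case True then show ?thesis using mon_J_part[OF assms(1)] L(2) by auto
  next
    case False
    then have "\<forall>j\<in>set L. j \<le> c" by (auto simp: not_less_eq_eq)
    from sum_list_count_bound[OF this] have "Suc k \<le> count_list L c"
      using sh assms(3) by (simp add: algebra_simps)
    then show ?thesis using mon_J[OF assms(2)] L(2) by auto
  qed
qed

text \<open>Exponents at most p with average exactly p all equal p, so every other monomial contains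
  some f_j with j > p and drops out; what remains is a positive multiple of f_p^r.\<close>

lemma garland_extract:
  assumes "f (Suc p) \<in> J" "e ^ (r * p) * f 0 ^ (r * p + r) \<in> J"
  shows "f p ^ r \<in> J"
proof -
  let ?P = "merge_steps (r * p) (replicate (r * p + r) 0)" and ?R = "replicate r p"
  have *: "mon_sum ?P \<in> J" using assms(2) garland_iff by blast
  have dich: "mon L \<in> J" if "L \<in> set ?P" "L \<noteq> ?R" for L
  proof -
    from merge_steps_shape[OF that(1)] have sh: "length L = r" "sum_list L = r * p"
      by (auto simp: sum_list_replicate)
    have "\<not> (\<forall>j\<in>set L. j \<le> p)"
      using sum_list_eq_replicate[of L p] sh that(2) by (auto simp: mult.commute)
    then show ?thesis using mon_J_part[OF assms(1)] by (auto simp: not_le Suc_le_eq)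
  qed
  have "mon_sum Ls - of_nat (count_list Ls ?R) * f p ^ r \<in> J" if "set Ls \<subseteq> set ?P" for Ls
    using that
  proof (induction Ls)
    case (Cons L Ls)
    then have IH: "mon_sum Ls - of_nat (count_list Ls ?R) * f p ^ r \<in> J" by simp
    show ?case
    proof (cases "L = ?R")
      case True then show ?thesis using IH by (simp add: algebra_simps)
    next
      case False
      then have "mon L \<in> J" using dich Cons.prems by simp
      then show ?thesis using J_add[OF _ IH, of "mon L"] False by (simp add: algebra_simps)
    qed
  qed (simp add: J_zero)
  from this[of ?P] * have "of_nat (count_list ?P ?R) * f p ^ r \<in> J"
    using J_cong by auto
  moreover have "0 < count_list ?P ?R"
    using replicate_reachable[of r p] by (metis count_list_0_iff gr0I)
  ultimately show ?thesis using J_cancel C_power[OF f_C] by blast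
qed

text \<open>For r = 1 a merged list has a single entry, which must be s, so the sum is a positive
  multiple of f_s.\<close>

lemma garland_one:
  assumes "1 \<le> s" "e ^ s * f 0 ^ (s + 1) \<in> J" shows "f s \<in> J"
proof -
  have "L = [s]" if "L \<in> set (merge_steps s (replicate (s + 1) 0))" for L
  proof -
    from merge_steps_shape[OF that] have "length L = 1" "sum_list L = s"
      by (auto simp: sum_list_replicate)
    then show ?thesis by (cases L) auto
  qed
  then have "mon_sum (merge_steps s (replicate (s + 1) 0)) =
      sum_list (map (\<lambda>_. f s) (merge_steps s (replicate (s + 1) 0)))"
    by (intro arg_cong[of _ _ sum_list] map_cong refl) force
  then have "mon_sum (merge_steps s (replicate (s + 1) 0)) =
      of_nat (length (merge_steps s (replicate (s + 1) 0))) * f s"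
    by (simp add: sum_list_triv)
  moreover have "0 < length (merge_steps s (replicate (s + 1) 0))"
    using replicate_reachable[of 1 s] by (auto intro: length_pos_if_in_set)
  ultimately show ?thesis using assms(2) J_cancel f_C garland_iff by metis
qed

text \<open>For every k the bound r k + tail is at least sum_j min(r, p_j), which is piecewise
  linear in r with breaks at the distinct parts. Forward, r = 1 and r = k2 + 1 yield the two
  relations; backward, the ranges of r between the breaks are treated one by one.\<close>

lemma hook_relations_iff:
  assumes N: "f 0 ^ (sum_list p + 1) \<in> J" and p: "rectangular p \<or> special p"
  shows "(\<forall>s r. 1 \<le> s \<and> 1 \<le> r \<and> (\<exists>k\<ge>1. s + r \<ge> 1 + r * k + sum_list (drop k p))
            \<longrightarrow> e ^ s * f 0 ^ (s + r) \<in> J)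
     \<longleftrightarrow> f (length p) \<in> J \<and> (special p \<longrightarrow> f (length p - 1) ^ (last p + 1) \<in> J)"
    (is "?V \<longleftrightarrow> ?B")
proof
  assume V: ?V
  have len: "f (length p) \<in> J"
  proof (cases "p = []")
    case True then show ?thesis using N by simp
  next
    case False
    then have "1 \<le> length p" by (simp add: Suc_leI)
    \<comment> \<open>With r = 1 and k = s = \<open>length p\<close> the tail is empty and the bound
      holds with equality.\<close>
    then show ?thesis
      by (intro garland_one V[rule_format]) (auto intro!: exI[of _ "length p"])
  qed
  moreover have "f (length p - 1) ^ (last p + 1) \<in> J" if sp: "special p"
  proof -
    obtain k1 k2 c where p: "1 \<le> k2" "1 \<le> c" "p = replicate c k1 @ [k2]"
      using sp unfolding special_def by auto
    \<comment> \<open>k = c leaves the tail [k2], and r = k2 + 1 is the least r exceeding it; again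
      the bound is an equality.\<close>
    have "e ^ ((k2 + 1) * c) * f 0 ^ ((k2 + 1) * c + (k2 + 1)) \<in> J"
      by (rule V[rule_format]) (use p in \<open>auto intro!: exI[of _ c]\<close>)
    from garland_extract[OF _ this] len p show ?thesis by simp
  qed
  ultimately show ?B by blast
next
  assume B: ?B
  show ?V
  proof (intro allI impI, elim conjE exE)
    fix s r k :: nat
    assume sr: "1 \<le> s" "1 \<le> r" "1 \<le> k" and k: "1 + r * k + sum_list (drop k p) \<le> s + r"
    \<comment> \<open>The two easy regimes: the power of f_0 lies in \<open>J\<close> already, or
      some exponent reaches \<open>length p\<close>.\<close>
    have big: "e ^ s * f 0 ^ (s + r) \<in> J" if "sum_list p + 1 \<le> s + r"
      by (intro J_left C_power e_C J_power_le[OF N that])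
    have small: "e ^ s * f 0 ^ (s + r) \<in> J" if "1 + r * length p \<le> s + r"
      using garland_vanish[OF _ sr(1) that] B by blast
    from p show "e ^ s * f 0 ^ (s + r) \<in> J"
    proof
      assume "rectangular p"
      then obtain m c where p: "p = replicate c m"
        unfolding rectangular_def by (metis replicate_0)
      show ?thesis
      proof (cases "c \<le> k")
        case True
        then have "r * c \<le> r * k" by simp
        moreover have "1 + r * k \<le> s + r" using k by linarith
        ultimately have "1 + r * length p \<le> s + r" unfolding p length_replicate by linarith
        then show ?thesis by (rule small)
      next
        case False
        define d where "d = c - k"
        have c: "c = k + d" using False unfolding d_def by simp
        have k': "1 + r * k + d * m \<le> s + r" using k p c by (simp add: sum_list_replicate)
        \<comment> \<open>The d parts beyond k contribute d m. This may be lowered to d r if r \<le>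
          m; otherwise r k may be lowered to m k.\<close>
        show ?thesis
        proof (cases "r \<le> m")
          case True
          then have "d * r \<le> d * m" by simp
          moreover have "r * length p = r * k + d * r" by (simp add: p c algebra_simps)
          ultimately show ?thesis using k' by (intro small) linarith
        next
          case False
          then have "m * k \<le> r * k" by simp
          moreover have "sum_list p = m * k + d * m"
            by (simp add: p c sum_list_replicate algebra_simps)
          ultimately show ?thesis using k' by (intro big) linarith
        qed
      qed
    next
      assume sp: "special p"
      then obtain k1 k2 c where p: "k2 < k1" "p = replicate c k1 @ [k2]"
        unfolding special_def by auto
      show ?thesis
      proof (cases "c < k")
        case True
        then have "r * Suc c \<le> r * k" by (intro mult_le_mono2) simp
        moreover have "1 + r * k \<le> s + r" using k by linarith
        ultimately have "1 + r * length p \<le> s + r" unfolding p(2) by simp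
        then show ?thesis by (rule small)
      next
        case False
        define d where "d = c - k"
        have c: "c = k + d" using False unfolding d_def by simp
        have k': "1 + r * k + d * k1 + k2 \<le> s + r"
          using k p c by (simp add: sum_list_replicate)
        \<comment> \<open>min(r, k1) and min(r, k2) take three shapes; only the middle range calls
          for the bounded power of f_c.\<close>
        consider "r \<le> k2" | "k2 < r" "r \<le> k1" | "k1 < r" by linarith
        then show ?thesis
        proof cases
          case 1
          then have "d * r \<le> d * k1" using p(1) by simp
          moreover have "r * length p = r * k + d * r + r" by (simp add: p c algebra_simps)
          ultimately show ?thesis using k' 1 by (intro small) linarith
        next
          case 2
          then have "d * r \<le> d * k1" by simp
          moreover have "r * c = r * k + d * r" by (simp add: c algebra_simps)
          ultimately have "1 + r * c + k2 \<le> s + r" using k' by linarith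
          from garland_vanish_hook[OF _ _ this] show ?thesis using B sp p by simp
        next
          case 3
          then have "k1 * k \<le> r * k" by simp
          moreover have "sum_list p = k1 * k + d * k1 + k2"
            by (simp add: p c sum_list_replicate algebra_simps)
          ultimately show ?thesis using k' by (intro big) linarith
        qed
      qed
    qed
  qed
qed

end

section \<open>Enveloping algebras and cyclic modules\<close>

lemma free_algebra_simps [simp]:
  "monoid.mult (free_algebra L) = (*)" "one (free_algebra L) = 1"
  "zero (free_algebra L) = 0" "add (free_algebra L) = (+)"
  by (simp_all add: free_algebra_def)

lemma carrier_free_algebra:
  "p \<in> carrier (free_algebra L) \<longleftrightarrow> (\<forall>w\<in>Poly_Mapping.keys p. set (letters w) \<subseteq> L)"
  by (simp add: free_algebra_def)

lemma letters_plus [simp]: "letters (v + w) = letters v @ letters w"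
  by (simp add: plus_free_word_def)

lemma letters_zero [simp]: "letters 0 = []"
  by (simp add: zero_free_word_def)

lemma free_algebra_closed:
  "0 \<in> carrier (free_algebra L)" "1 \<in> carrier (free_algebra L)"
  "p \<in> carrier (free_algebra L) \<Longrightarrow> q \<in> carrier (free_algebra L) \<Longrightarrow> p + q \<in> carrier (free_algebra L)"
  "p \<in> carrier (free_algebra L) \<Longrightarrow> q \<in> carrier (free_algebra L) \<Longrightarrow> p * q \<in> carrier (free_algebra L)"
  "p \<in> carrier (free_algebra L) \<Longrightarrow> - p \<in> carrier (free_algebra L)"
  "p \<in> carrier (free_algebra L) \<Longrightarrow> q \<in> carrier (free_algebra L) \<Longrightarrow> p - q \<in> carrier (free_algebra L)"
proof -
  show "0 \<in> carrier (free_algebra L)" "1 \<in> carrier (free_algebra L)"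
    by (auto simp: carrier_free_algebra)
  show "p \<in> carrier (free_algebra L) \<Longrightarrow> - p \<in> carrier (free_algebra L)"
    by (auto simp: carrier_free_algebra)
  assume p: "p \<in> carrier (free_algebra L)" and q: "q \<in> carrier (free_algebra L)"
  show "p + q \<in> carrier (free_algebra L)"
    using p q Poly_Mapping.keys_add[of p q] unfolding carrier_free_algebra by blast
  show "p - q \<in> carrier (free_algebra L)"
    using p q keys_diff[of p q] unfolding carrier_free_algebra by blast
  show "p * q \<in> carrier (free_algebra L)"
    unfolding carrier_free_algebra
  proof
    fix w assume "w \<in> Poly_Mapping.keys (p * q)"
    then obtain u v where "w = u + v" "u \<in> Poly_Mapping.keys p" "v \<in> Poly_Mapping.keys q"
      using keys_mult[of p q] by blast
    then show "set (letters w) \<subseteq> L" using p q unfolding carrier_free_algebra by auto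
  qed
qed

lemma letter_closed: "y \<in> L \<Longrightarrow> letter y \<in> carrier (free_algebra L)"
  by (simp add: carrier_free_algebra letter_def)

lemma const_closed: "const c \<in> carrier (free_algebra L)"
  by (simp add: carrier_free_algebra const_def)

lemma const_simps: "const 1 = 1" "const (a * b) = const a * const b" "const (of_nat m) = of_nat m"
proof -
  show "const 1 = 1" by (simp add: const_def)
  show "const (a * b) = const a * const b" by (simp add: const_def mult_single)
  show "const (of_nat m) = of_nat m"
    by (induction m) (auto simp: const_def single_add)
qed

lemma const_commute: "const c * p = p * (const c :: 'a free_alg)"
proof (induction p rule: update_induct)
  case (update f w v)
  have "Poly_Mapping.update w v f = f + Poly_Mapping.single w v"
    using update(1) by (intro poly_mapping_eqI)
      (auto simp: lookup_update lookup_add lookup_single when_def in_keys_iff)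
  moreover have "const c * Poly_Mapping.single w v = Poly_Mapping.single w v * const c"
    by (simp add: const_def mult_single mult.commute)
  ultimately show ?case using update(3) by (simp add: algebra_simps)
qed simp

lemma free_algebra_ring: "ring (free_algebra L)"
proof (rule ringI)
  show "abelian_group (free_algebra L)"
    by (rule abelian_groupI)
      (auto simp: free_algebra_closed algebra_simps intro: bexI[of _ "- x" for x])
  show "Group.monoid (free_algebra L)"
    by (rule Group.monoidI) (auto intro: free_algebra_closed simp: algebra_simps)
qed (auto simp: algebra_simps)

text \<open>What puts the generators of \<open>env_ideal\<close> into the carrier of the free
  algebra.\<close>

definition bracket_closed :: "('a::ab_group_add) km_data \<Rightarrow> 'a set \<Rightarrow> bool" where
  "bracket_closed K L \<longleftrightarrow> (\<forall>y\<in>L. \<forall>z\<in>L. y + z \<in> L) \<and> (\<forall>c. \<forall>y\<in>L. scale K c y \<in> L)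
     \<and> (\<forall>y\<in>L. \<forall>z\<in>L. lie K y z \<in> L)"

lemma env_ideal_ideal:
  assumes "bracket_closed K L" shows "ideal (env_ideal K L) (free_algebra L)"
  unfolding env_ideal_def
  by (rule ring.genideal_ideal[OF free_algebra_ring])
    (use assms in \<open>auto simp: bracket_closed_def intro!: free_algebra_closed letter_closed const_closed\<close>)

lemma env_ideal_relations:
  assumes L: "bracket_closed K L" and y: "y \<in> L"
  shows "z \<in> L \<Longrightarrow> letter (y + z) - letter y - letter z \<in> env_ideal K L"
    "letter (scale K c y) - const c * letter y \<in> env_ideal K L"
    "z \<in> L \<Longrightarrow> letter y * letter z - letter z * letter y - letter (lie K y z) \<in> env_ideal K L"
proof -
  let ?G = "{letter (y + z) - letter y - letter z | y z. y \<in> L \<and> z \<in> L}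
      \<union> {letter (scale K c y) - const c * letter y | c y. y \<in> L}
      \<union> {letter y * letter z - letter z * letter y - letter (lie K y z) | y z. y \<in> L \<and> z \<in> L}"
  have "?G \<subseteq> env_ideal K L"
    unfolding env_ideal_def
    by (rule ring.genideal_self[OF free_algebra_ring])
      (use L in \<open>auto simp: bracket_closed_def intro!: free_algebra_closed letter_closed const_closed\<close>)
  note G = subsetD[OF this]
  show "letter (scale K c y) - const c * letter y \<in> env_ideal K L"
    by (rule G, rule UnI1, rule UnI2) (use y in auto)
  assume z: "z \<in> L"
  show "letter (y + z) - letter y - letter z \<in> env_ideal K L"
    by (rule G, rule UnI1, rule UnI1) (use y z in auto)
  show "letter y * letter z - letter z * letter y - letter (lie K y z) \<in> env_ideal K L"
    by (rule G, rule UnI2) (use y z in auto)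
qed

lemma env_of_hom:
  assumes "bracket_closed K L"
  shows "env_of K L \<in> ring_hom (free_algebra L) (env K L)"
proof -
  interpret ideal "env_ideal K L" "free_algebra L" by (rule env_ideal_ideal[OF assms])
  have "env_of K L = (+>\<^bsub>free_algebra L\<^esub>) (env_ideal K L)" by (auto simp: env_of_def)
  then show ?thesis using rcos_ring_hom by (simp add: env_def)
qed

lemma env_ring: assumes "bracket_closed K L" shows "ring (env K L)"
  unfolding env_def by (rule ideal.quotient_is_ring[OF env_ideal_ideal[OF assms]])

lemma env_of_closed:
  "bracket_closed K L \<Longrightarrow> p \<in> carrier (free_algebra L) \<Longrightarrow> env_of K L p \<in> carrier (env K L)"
  using env_of_hom ring_hom_closed by fastforce

lemma env_of_power:
  assumes "bracket_closed K L" "p \<in> carrier (free_algebra L)"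
  shows "env_of K L (p ^ k) = env_of K L p [^]\<^bsub>env K L\<^esub> (k::nat)"
proof (induction k)
  case 0 then show ?case using ring_hom_one[OF env_of_hom[OF assms(1)]] by simp
next
  case (Suc k)
  have "p ^ k \<in> carrier (free_algebra L)"
    by (induction k) (auto intro: free_algebra_closed assms)
  then have "env_of K L (p ^ k * p) = env_of K L (p ^ k) \<otimes>\<^bsub>env K L\<^esub> env_of K L p"
    using ring_hom_mult[OF env_of_hom[OF assms(1)]] assms(2) by fastforce
  then show ?case using Suc by (simp add: power_Suc2 del: power_Suc)
qed

section \<open>Submodules of a cyclic module as left ideals of operators\<close>

lemma regular_module_simps [simp]:
  "carrier (regular_module R) = carrier R" "monoid.mult (regular_module R) = monoid.mult R"
  "one (regular_module R) = one R" "zero (regular_module R) = zero R"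
  "add (regular_module R) = add R" "smult (regular_module R) = monoid.mult R"
  by (simp_all add: regular_module_def)

lemma a_r_coset_regular [simp]: "I +>\<^bsub>regular_module R\<^esub> u = I +>\<^bsub>R\<^esub> u"
  by (simp add: a_r_coset_def r_coset_def)

lemma a_rcosets_regular [simp]: "a_rcosets\<^bsub>regular_module R\<^esub> I = a_rcosets\<^bsub>R\<^esub> I"
  by (simp add: A_RCOSETS_def RCOSETS_def r_coset_def)

lemma set_add_regular [simp]: "set_add (regular_module R) = set_add R"
  by (intro ext) (simp add: set_add_def set_mult_def)

lemma subgroup_regular [simp]:
  "subgroup H (add_monoid (regular_module R)) = subgroup H (add_monoid R)"
  by (simp add: subgroup_def m_inv_def)

lemma submodule_gen_regular:
  assumes "ring R" "S \<subseteq> carrier R"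
  shows "submodule (submodule_gen R (regular_module R) S) R (regular_module R)"
    "S \<subseteq> submodule_gen R (regular_module R) S"
proof -
  interpret ring R by fact
  let ?F = "{N. submodule N R (regular_module R) \<and> S \<subseteq> N}"
  have "subgroup (carrier R) (add_monoid (regular_module R))"
    unfolding subgroup_regular by (rule add.subgroup_self)
  then have "submodule (carrier R) R (regular_module R)"
    by (simp add: submodule_def submodule_axioms_def)
  \<comment> \<open>The family is nonempty, so its intersection does not degenerate to the whole
    type.\<close>
  then have F: "carrier R \<in> ?F" using assms by simp
  show "submodule (submodule_gen R (regular_module R) S) R (regular_module R)"
    unfolding submodule_gen_def
  proof (intro submodule.intro submodule_axioms.intro)
    show "subgroup (\<Inter> ?F) (add_monoid (regular_module R))"
      unfolding subgroup_regular by (rule add.subgroups_Inter)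
        (use F in \<open>auto simp: submodule_def simp del: regular_module_simps\<close>)
  qed (auto simp: submodule_def submodule_axioms_def)
  show "S \<subseteq> submodule_gen R (regular_module R) S" by (auto simp: submodule_gen_def)
qed

text \<open>\<open>I\<close> will be the left ideal of defining relations and \<open>J\<close> the
  preimage of N, so that u applied to the generator lies in N iff u lies in
  \<open>J\<close>.\<close>

locale cyclic_pullback = ring R for R :: "'u ring" (structure) +
  fixes S :: "'u set" and N :: "'u set set"
  assumes S: "S \<subseteq> carrier R" and N: "submodule N R (cyclic_module R S)"
begin

definition "I = submodule_gen R (regular_module R) S"
definition "J = {u \<in> carrier R. I +> u \<in> N}"

lemma I: "submodule I R (regular_module R)" "S \<subseteq> I"
  using submodule_gen_regular[OF ring_axioms S] unfolding I_def by auto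

lemma I_subgroup: "abelian_subgroup I R"
  by (rule abelian_subgroupI3)
    (use I(1) is_abelian_group subgroup_regular[of I R] in
      \<open>auto simp: submodule_def additive_subgroup_def simp del: regular_module_simps\<close>)

interpretation abelian_subgroup I R by (rule I_subgroup)

text \<open>The action on \<open>quot_module\<close> is a union over all representatives; left
  multiplication preserves \<open>I\<close>, so they all give the same coset and the union
  collapses.\<close>

lemma smult_coset:
  assumes "u \<in> carrier R" "v \<in> carrier R"
  shows "u \<odot>\<^bsub>cyclic_module R S\<^esub> (I +> v) = I +> (u \<otimes> v)"
proof -
  have "I +> (u \<otimes> y) = I +> (u \<otimes> v)" if y: "y \<in> I +> v" for y
  proof -
    obtain i where i: "i \<in> I" "y = i \<oplus> v" using y by (auto simp: a_r_coset_def')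
    have iR: "i \<in> carrier R" using i a_subset by auto
    have "u \<otimes> i \<in> I"
      using I(1) assms(1) i(1) unfolding submodule_def submodule_axioms_def by simp
    moreover have "u \<otimes> y = u \<otimes> i \<oplus> u \<otimes> v" using i iR assms by (simp add: r_distr)
    ultimately have "u \<otimes> y \<in> I +> (u \<otimes> v)" by (auto simp: a_r_coset_def')
    then show ?thesis using a_repr_independence[of "u \<otimes> y" I "u \<otimes> v"] assms a_subgroup by auto
  qed
  moreover have "v \<in> I +> v" using assms(2) by (rule a_rcos_self)
  ultimately have "(\<Union>y\<in>I +> v. I +> (u \<otimes> y)) = I +> (u \<otimes> v)" by blast
  then show ?thesis by (simp add: cyclic_module_def quot_module_def flip: I_def)
qed

lemma smult_generator:
  assumes "u \<in> carrier R" shows "u \<odot>\<^bsub>cyclic_module R S\<^esub> cyclic_generator R S = I +> u"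
  using smult_coset[OF assms one_closed] assms by (simp add: cyclic_generator_def flip: I_def)

lemma N_closed:
  "X \<in> N \<Longrightarrow> Y \<in> N \<Longrightarrow> X <+> Y \<in> N" "u \<in> carrier R \<Longrightarrow> X \<in> N \<Longrightarrow> u \<odot>\<^bsub>cyclic_module R S\<^esub> X \<in> N"
  "I \<in> N"
proof -
  have sub: "subgroup N (add_monoid (cyclic_module R S))" using N by (simp add: submodule_def)
  show "X \<in> N \<Longrightarrow> Y \<in> N \<Longrightarrow> X <+> Y \<in> N"
    using subgroup.m_closed[OF sub, of X Y] by (simp add: cyclic_module_def quot_module_def)
  show "I \<in> N"
    using subgroup.one_closed[OF sub] by (simp add: cyclic_module_def quot_module_def flip: I_def)
  show "u \<in> carrier R \<Longrightarrow> X \<in> N \<Longrightarrow> u \<odot>\<^bsub>cyclic_module R S\<^esub> X \<in> N"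
    using N by (simp add: submodule_def submodule_axioms_def)
qed

lemma J_mult: "u \<in> carrier R \<Longrightarrow> v \<in> J \<Longrightarrow> u \<otimes> v \<in> J"
  unfolding J_def using N_closed(2)[of u "I +> v"] smult_coset by auto

lemma J_minus: "u \<in> J \<Longrightarrow> v \<in> J \<Longrightarrow> u \<ominus> v \<in> J"
proof -
  assume u: "u \<in> J" and v: "v \<in> J"
  have "\<ominus> \<one> \<otimes> v \<in> J" using J_mult[OF _ v] by simp
  then have "\<ominus> v \<in> J" using v by (simp add: J_def l_minus)
  then show "u \<ominus> v \<in> J"
    using u N_closed(1)[of "I +> u" "I +> (\<ominus> v)"] a_rcos_sum[of u "\<ominus> v"]
    unfolding J_def a_minus_def by simp
qed

lemma I_J: "I \<subseteq> J"
proof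
  fix u assume u: "u \<in> I"
  then have "I +> u = I" using a_coset_join2[OF _ a_subgroup] a_subset by auto
  then show "u \<in> J" using N_closed(3) a_subset u by (auto simp: J_def)
qed

lemma mem_N_iff: "u \<in> carrier R \<Longrightarrow> u \<odot>\<^bsub>cyclic_module R S\<^esub> cyclic_generator R S \<in> N \<longleftrightarrow> u \<in> J"
  by (simp add: smult_generator J_def)

end

text \<open>The generated submodule is the intersection of the submodules containing the generators
  and depends only on that family.\<close>

lemma submodule_gen_cong:
  assumes "\<And>N. submodule N R M \<Longrightarrow> A \<subseteq> N \<longleftrightarrow> B \<subseteq> N"
  shows "submodule_gen R M A = submodule_gen R M B"
  unfolding submodule_gen_def using assms by (metis (no_types, lifting))

lemma module_isomorphic_refl: "module_isomorphic R M M"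
  unfolding module_isomorphic_def by (intro exI[of _ id]) auto

section \<open>Real roots and the null root\<close>

definition unit_root :: "nat \<Rightarrow> root" where "unit_root i = (\<lambda>j. if j = i then 1 else 0)"

definition mul :: "int \<Rightarrow> root \<Rightarrow> root" where "mul k \<gamma> = (\<lambda>i. k * \<gamma> i)"

lemma mul_apply [simp]: "mul k \<gamma> i = k * \<gamma> i" by (simp add: mul_def)

definition pair :: "twisted_type \<Rightarrow> nat \<Rightarrow> root \<Rightarrow> int" where
  "pair T i \<gamma> = (\<Sum>j\<le>rk T. gcm T i j * \<gamma> j)"

text \<open>The squared lengths of the simple roots, up to a factor: for $1 \<le> i \<le> n$ this is
  also the number $d_{\alpha_i}$.\<close>

fun symm :: "twisted_type \<Rightarrow> nat \<Rightarrow> nat" where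
  "symm (Aff_A n) i = (if i = n then 2 else 1)"
| "symm (Aff_D n) i = (if i = 0 \<or> i = n then 1 else 2)"
| "symm Aff_E i = (if 3 \<le> i then 2 else 1)"
| "symm Aff_D4 i = (if i = 2 then 3 else 1)"

text \<open>The marks of the affine diagrams, with coefficient 1 at node 0;
  \<open>is_delta_null\<close> identifies this vector with \<delta>.\<close>

fun null_root :: "twisted_type \<Rightarrow> root" where
  "null_root (Aff_A n) i = (if i > n then 0 else if i \<le> 1 \<or> i = n then 1 else 2)"
| "null_root (Aff_D n) i = (if i > n then 0 else 1)"
| "null_root Aff_E i = (if i > 4 then 0 else if i = 0 \<or> i = 4 then 1 else if i = 2 then 3 else 2)"
| "null_root Aff_D4 i = (if i > 2 then 0 else if i = 1 then 2 else 1)"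

lemma unit_root_simps [simp]: "unit_root i i = 1" "j \<noteq> i \<Longrightarrow> unit_root i j = 0"
  by (auto simp: unit_root_def)

lemma unit_root_nonneg: "0 \<le> unit_root i j"
  by (simp add: unit_root_def)

lemma gcm_diag [simp]: "gcm T i i = 2"
  by (cases T) auto

lemma gcm_nonpos: "i \<noteq> j \<Longrightarrow> gcm T i j \<le> 0"
  by (cases T) auto

lemma symm_pos: "0 < symm T i"
  by (cases T) auto

lemma symm_gcm:
  assumes "valid_type T" "i \<le> rk T" "j \<le> rk T"
  shows "int (symm T i) * gcm T i j = int (symm T j) * gcm T j i"
  using assms by (cases T) auto

lemma gcm_zero: assumes "valid_type T" "i \<le> rk T" "j \<le> rk T" "gcm T i j = 0" shows "gcm T j i = 0"
  using symm_gcm[OF assms(1-3)] symm_pos[of T j] assms(4) by simp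

lemma pair_linear:
  "pair T i (\<gamma> + \<mu>) = pair T i \<gamma> + pair T i \<mu>" "pair T i (\<gamma> - \<mu>) = pair T i \<gamma> - pair T i \<mu>"
  "pair T i (- \<gamma>) = - pair T i \<gamma>" "pair T i (mul k \<gamma>) = k * pair T i \<gamma>" "pair T i 0 = 0"
  by (simp_all add: pair_def sum.distrib sum_subtractf sum_negf sum_distrib_left algebra_simps)

lemma pair_unit: "j \<le> rk T \<Longrightarrow> pair T i (unit_root j) = gcm T i j"
  unfolding pair_def by (subst sum.remove[of _ j]) (auto intro!: sum.neutral)

lemma pair_support:
  assumes "S \<subseteq> {..rk T}" "\<And>j. j \<le> rk T \<Longrightarrow> j \<notin> S \<Longrightarrow> gcm T i j * \<gamma> j = 0"
  shows "pair T i \<gamma> = (\<Sum>j\<in>S. gcm T i j * \<gamma> j)"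
  unfolding pair_def by (rule sum.mono_neutral_right) (use assms in auto)

lemma reflect_eq: "reflect T i \<gamma> = \<gamma> - mul (pair T i \<gamma>) (unit_root i)"
  by (rule ext) (simp add: reflect_def pair_def unit_root_def)

lemma reflect_linear:
  "reflect T i (\<gamma> + \<mu>) = reflect T i \<gamma> + reflect T i \<mu>"
  "reflect T i (\<gamma> - \<mu>) = reflect T i \<gamma> - reflect T i \<mu>"
  "reflect T i (- \<gamma>) = - reflect T i \<gamma>" "reflect T i (mul k \<gamma>) = mul k (reflect T i \<gamma>)"
  "reflect T i 0 = 0"
  by (rule ext, simp add: reflect_eq pair_linear algebra_simps)+

lemma reflect_unit: "i \<le> rk T \<Longrightarrow> reflect T i (unit_root i) = - unit_root i"
  by (rule ext) (simp add: reflect_eq pair_unit)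

lemma reflect_reflect: "i \<le> rk T \<Longrightarrow> reflect T i (reflect T i \<gamma>) = \<gamma>"
  by (rule ext) (simp add: reflect_eq pair_linear pair_unit)

lemma reflect_other: "k \<noteq> i \<Longrightarrow> reflect T i \<gamma> k = \<gamma> k"
  by (simp add: reflect_def)

lemma reflect_self: "reflect T i \<gamma> i = \<gamma> i - pair T i \<gamma>"
  by (simp add: reflect_def pair_def)

lemma reflect_lattice: "i \<le> rk T \<Longrightarrow> \<gamma> \<in> root_lattice T \<Longrightarrow> reflect T i \<gamma> \<in> root_lattice T"
  by (auto simp: root_lattice_def reflect_def)

lemma pair_A:
  assumes "3 \<le> n" "i \<le> n"
  shows "pair (Aff_A n) i \<gamma> = 2 * \<gamma> i -
    (if i \<le> 1 then \<gamma> 2 else (if i = 2 then \<gamma> 0 else 0) + \<gamma> (i - 1)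
       + (if i = n then 0 else if i = n - 1 then 2 * \<gamma> n else \<gamma> (Suc i)))"
proof -
  consider "i = 0" | "i = 1" | "i = 2" | "3 \<le> i" "i < n" | "i = n" using assms by linarith
  then show ?thesis
  proof cases
    case 1
    then show ?thesis using assms by (subst pair_support[of "{0,2}"]) auto
  next
    case 2
    then show ?thesis using assms by (subst pair_support[of "{1,2}"]) auto
  next
    case 3
    then show ?thesis using assms by (subst pair_support[of "{0,1,2,3}"]) auto
  next
    case 4
    define k where "k = i - 1"
    have i: "i = Suc k" "2 \<le> k" using 4 unfolding k_def by auto
    then show ?thesis using assms 4 by (subst pair_support[of "{k,Suc k,Suc (Suc k)}"]) auto
  next
    case 5
    then show ?thesis using assms by (subst pair_support[of "{n - 1,n}"]) auto
  qed
qed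

lemma pair_D:
  assumes "4 \<le> n" "i \<le> n"
  shows "pair (Aff_D n) i \<gamma> = 2 * \<gamma> i -
    (if i = 0 then 2 * \<gamma> 1 else if i = n then 2 * \<gamma> (n - 1) else \<gamma> (i - 1) + \<gamma> (Suc i))"
proof -
  consider "i = 0" | "i = n" | "1 \<le> i" "i < n" using assms by linarith
  then show ?thesis
  proof cases
    case 1
    then show ?thesis using assms by (subst pair_support[of "{0,1}"]) auto
  next
    case 2
    then show ?thesis using assms by (subst pair_support[of "{n - 1,n}"]) auto
  next
    case 3
    define k where "k = i - 1"
    have i: "i = Suc k" using 3 unfolding k_def by auto
    then show ?thesis using assms 3 by (subst pair_support[of "{k,Suc k,Suc (Suc k)}"]) auto
  qed
qed

lemma pair_E: "pair Aff_E i \<gamma> = (\<Sum>j\<in>{0,1,2,3,4}. gcm Aff_E i j * \<gamma> j)"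
  by (rule pair_support) auto

lemma pair_D4: "pair Aff_D4 i \<gamma> = (\<Sum>j\<in>{0,1,2}. gcm Aff_D4 i j * \<gamma> j)"
  by (rule pair_support) auto

lemma null_root_pair: assumes "valid_type T" "i \<le> rk T" shows "pair T i (null_root T) = 0"
proof (cases T)
  case (Aff_A n)
  have n: "3 \<le> n" "i \<le> n" using assms Aff_A by auto
  consider "i = 0" | "i = 1" | "i = 2" "n = 3" | "i = 2" "3 < n" | "3 \<le> i" "i < n - 1"
    | "3 \<le> i" "i = n - 1" | "i = n" using n by linarith
  then show ?thesis unfolding Aff_A pair_A[OF n] by cases (use n in simp_all, presburger+)
next
  case (Aff_D n)
  have n: "4 \<le> n" "i \<le> n" using assms Aff_D by auto
  then show ?thesis unfolding Aff_D pair_D[OF n] by simp presburger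
next
  case Aff_E
  then have "i \<in> {0,1,2,3,4}" using assms by auto
  then show ?thesis using Aff_E by (auto simp: pair_E)
next
  case Aff_D4
  then have "i \<in> {0,1,2}" using assms by auto
  then show ?thesis using Aff_D4 by (auto simp: pair_D4)
qed

lemma null_root_0 [simp]: "null_root T 0 = 1"
  by (cases T) auto

lemma null_root_pos: "i \<le> rk T \<Longrightarrow> 0 < null_root T i"
  by (cases T) auto

lemma null_root_lattice: "null_root T \<in> root_lattice T"
  by (cases T) (auto simp: root_lattice_def)

text \<open>Together with the coefficient 1 at node 0 this gives two odd coordinates, which the
  parity argument in \<open>real_not_even\<close> exploits.\<close>

lemma null_root_odd: assumes "valid_type T" shows "\<exists>i\<le>rk T. i \<noteq> 0 \<and> odd (null_root T i)"
proof -
  have "rk T \<noteq> 0 \<and> odd (null_root T (rk T))" using assms by (cases T) auto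
  then show ?thesis by auto
qed

lemma reflect_null: "valid_type T \<Longrightarrow> i \<le> rk T \<Longrightarrow> reflect T i (null_root T) = null_root T"
  by (rule ext) (simp add: reflect_eq null_root_pair)

text \<open>Row i of the linear system determines coefficient i + 1 from the earlier ones, so
  vanishing at node 0 spreads along the diagram. In \<open>Aff_A\<close> the fork at node 2 breaks
  this order, and rows 0 and 1 settle the nodes 2 and 1 beforehand.\<close>

lemma pair_kernel_zero:
  assumes T: "valid_type T" and \<gamma>: "\<gamma> \<in> root_lattice T" "\<gamma> 0 = 0"
    and ker: "\<And>i. i \<le> rk T \<Longrightarrow> pair T i \<gamma> = 0"
  shows "\<gamma> = 0"
proof -
  have step: "\<gamma> (Suc i) = 0"
    if "\<And>j. j \<le> i \<Longrightarrow> \<gamma> j = 0" "Suc i \<le> rk T" "gcm T i (Suc i) \<noteq> 0" "\<And>j. Suc i < j \<Longrightarrow> gcm T i j = 0" for i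
  proof -
    have "pair T i \<gamma> = (\<Sum>j\<in>{Suc i}. gcm T i j * \<gamma> j)"
    proof (rule pair_support)
      fix j assume "j \<notin> {Suc i}"
      then consider "j \<le> i" | "Suc i < j" by fastforce
      then show "gcm T i j * \<gamma> j = 0" using that by cases auto
    qed (use that in auto)
    then show ?thesis using ker[of i] that by simp
  qed
  have "\<forall>j\<le>i. \<gamma> j = 0" if "i \<le> rk T" for i
  proof (cases "\<exists>n. T = Aff_A n")
    case True
    then obtain n where Aff_A: "T = Aff_A n" by blast
    have n: "3 \<le> n" using T Aff_A by simp
    have 0: "\<gamma> 2 = 0" "\<gamma> 1 = 0" using ker[of 0] ker[of 1] \<gamma>(2) n Aff_A by (auto simp: pair_A)
    then have two: "\<gamma> j = 0" if "j \<le> 2" for j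
      using \<gamma>(2) that by (auto simp: numeral_2_eq_2 le_Suc_eq)
    show ?thesis using \<open>i \<le> rk T\<close>
    proof (induction i)
      case (Suc i)
      show ?case
      proof (cases "Suc i \<le> 2")
        case True then show ?thesis using two by auto
      next
        case False
        have "\<gamma> (Suc i) = 0" by (rule step) (use Suc False Aff_A in auto)
        then show ?thesis using Suc by (auto simp: le_Suc_eq)
      qed
    qed (use \<gamma> in simp)
  next
    case False
    show ?thesis using \<open>i \<le> rk T\<close>
    proof (induction i)
      case (Suc i)
      have "gcm T i (Suc i) \<noteq> 0" "\<And>j. Suc i < j \<Longrightarrow> gcm T i j = 0"
        using False Suc.prems by (cases T; auto)+
      then have "\<gamma> (Suc i) = 0" by (intro step) (use Suc in auto)
      then show ?case using Suc by (auto simp: le_Suc_eq)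
    qed (use \<gamma> in simp)
  qed
  then have "\<gamma> i = 0" for i using \<gamma>(1) by (cases "i \<le> rk T") (auto simp: root_lattice_def)
  then show ?thesis by (simp add: fun_eq_iff)
qed

text \<open>The Weyl invariant form, scaled to be integral: \<alpha>_i has squared length 2
  \<open>symm T i\<close>.\<close>

definition form :: "twisted_type \<Rightarrow> root \<Rightarrow> root \<Rightarrow> int" where
  "form T \<gamma> \<mu> = (\<Sum>i\<le>rk T. int (symm T i) * \<gamma> i * pair T i \<mu>)"

lemma form_linear:
  "form T (\<gamma> + \<gamma>') \<mu> = form T \<gamma> \<mu> + form T \<gamma>' \<mu>" "form T (\<gamma> - \<gamma>') \<mu> = form T \<gamma> \<mu> - form T \<gamma>' \<mu>"
  "form T (mul k \<gamma>) \<mu> = k * form T \<gamma> \<mu>"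
  by (simp_all add: form_def sum.distrib sum_subtractf sum_distrib_left algebra_simps)

lemma form_unit: "i \<le> rk T \<Longrightarrow> form T (unit_root i) \<mu> = int (symm T i) * pair T i \<mu>"
  unfolding form_def by (subst sum.remove[of _ i]) (auto intro!: sum.neutral)

lemma form_sym: assumes "valid_type T" shows "form T \<gamma> \<mu> = form T \<mu> \<gamma>"
proof -
  have "form T \<gamma> \<mu> = (\<Sum>i\<le>rk T. \<Sum>j\<le>rk T. int (symm T i) * gcm T i j * \<gamma> i * \<mu> j)"
    by (simp add: form_def pair_def sum_distrib_left algebra_simps)
  also have "\<dots> = (\<Sum>j\<le>rk T. \<Sum>i\<le>rk T. int (symm T j) * gcm T j i * \<mu> j * \<gamma> i)"
    by (subst sum.swap, intro sum.cong refl) (use symm_gcm[OF assms] in \<open>simp add: algebra_simps\<close>)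
  also have "\<dots> = form T \<mu> \<gamma>"
    by (simp add: form_def pair_def sum_distrib_left algebra_simps)
  finally show ?thesis .
qed

lemma form_null: "valid_type T \<Longrightarrow> form T \<gamma> (null_root T) = 0"
  by (simp add: form_def null_root_pair)

text \<open>Pairing with the null root, which lies in the radical, writes 0 as a sum of terms of one
  sign with positive weights. So every pairing vanishes, and \<open>pair_kernel_zero\<close> applies
  after subtracting a multiple of the null root.\<close>

lemma pair_nonpos_null:
  assumes T: "valid_type T" and \<gamma>: "\<gamma> \<in> root_lattice T" and np: "\<And>i. i \<le> rk T \<Longrightarrow> pair T i \<gamma> \<le> 0"
  shows "\<gamma> = mul (\<gamma> 0) (null_root T)"
proof -
  let ?t = "\<lambda>i. int (symm T i) * null_root T i * - pair T i \<gamma>"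
  have "form T (null_root T) \<gamma> = 0" using form_sym[OF T] form_null[OF T] by simp
  then have "(\<Sum>i\<le>rk T. ?t i) = 0" by (simp add: form_def sum_negf)
  moreover have "0 \<le> ?t i" if "i \<le> rk T" for i
    using np[OF that] null_root_pos[OF that] by (intro mult_nonneg_nonneg) auto
  ultimately have "?t i = 0" if "i \<le> rk T" for i
    using sum_nonneg_eq_0_iff[of "{..rk T}" ?t] that by auto
  then have z: "pair T i \<gamma> = 0" if "i \<le> rk T" for i
    using that null_root_pos[OF that] symm_pos[of T i] by fastforce
  have "\<gamma> - mul (\<gamma> 0) (null_root T) = 0"
  proof (rule pair_kernel_zero[OF T])
    show "\<gamma> - mul (\<gamma> 0) (null_root T) \<in> root_lattice T"
      using \<gamma> null_root_lattice[of T] by (auto simp: root_lattice_def)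
  qed (use z null_root_pair[OF T] in \<open>auto simp: pair_linear\<close>)
  then show ?thesis by simp
qed

lemma form_reflect:
  assumes "valid_type T" "i \<le> rk T"
  shows "form T (reflect T i \<gamma>) \<mu> = form T \<gamma> (reflect T i \<mu>)"
proof -
  have "form T \<gamma> (reflect T i \<mu>) = form T (reflect T i \<mu>) \<gamma>" by (rule form_sym[OF assms(1)])
  moreover have "form T \<mu> \<gamma> = form T \<gamma> \<mu>" by (rule form_sym[OF assms(1)])
  ultimately show ?thesis using assms(2) by (simp add: reflect_eq form_linear form_unit)
qed

lemma form_reflect_reflect:
  assumes "valid_type T" "i \<le> rk T"
  shows "form T (reflect T i \<gamma>) (reflect T i \<mu>) = form T \<gamma> \<mu>"
  by (simp only: form_reflect[OF assms] reflect_reflect[OF assms(2)])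

text \<open>Real roots reached inside a subdiagram: I = {1..n} describes the finite roots, and I =
  support of the root is what the classification of roots delivers.\<close>

inductive real_in :: "twisted_type \<Rightarrow> nat set \<Rightarrow> root \<Rightarrow> bool" for T I where
  simple: "i \<in> I \<Longrightarrow> real_in T I (unit_root i)"
| reflection: "real_in T I \<gamma> \<Longrightarrow> i \<in> I \<Longrightarrow> real_in T I (reflect T i \<gamma>)"

lemma real_in_mono: "real_in T I \<gamma> \<Longrightarrow> I \<subseteq> I' \<Longrightarrow> real_in T I' \<gamma>"
  by (induction rule: real_in.induct) (auto intro: real_in.intros)

lemma real_in_real: "real_in T I \<gamma> \<Longrightarrow> I \<subseteq> {..rk T} \<Longrightarrow> real_root T \<gamma>"
proof (induction rule: real_in.induct)
  case (simple i) then show ?case using real_root.simple[of i T] by (auto simp: unit_root_def)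
qed (auto intro: real_root.reflection)

lemma real_real_in: "real_root T \<gamma> \<Longrightarrow> real_in T {..rk T} \<gamma>"
proof (induction rule: real_root.induct)
  case (simple i) then show ?case using real_in.simple[of i "{..rk T}" T] by (simp add: unit_root_def)
qed (auto intro: real_in.reflection)

lemma real_in_minus: "real_in T I \<gamma> \<Longrightarrow> I \<subseteq> {..rk T} \<Longrightarrow> real_in T I (- \<gamma>)"
proof (induction rule: real_in.induct)
  case (simple i)
  then have "reflect T i (unit_root i) = - unit_root i" by (intro reflect_unit) auto
  then show ?case using real_in.reflection[OF real_in.simple[OF simple(1)] simple(1), of T] by (simp only:)
next
  case (reflection \<gamma> i)
  then show ?case using real_in.reflection[of T I "- \<gamma>" i]
    by (simp only: reflect_linear)
qed

lemma real_minus: "real_root T \<gamma> \<Longrightarrow> real_root T (- \<gamma>)"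
  using real_real_in real_in_minus real_in_real by blast

lemma real_unit: "i \<le> rk T \<Longrightarrow> real_root T (unit_root i)"
  using real_root.simple[of i T] by (simp add: unit_root_def)

text \<open>Reflections fix the null root and preserve twice the lattice, so simple roots suffice.
  Their single odd coordinate forces k odd, but an odd multiple of the null root has at least two
  odd coordinates.\<close>

lemma real_not_even:
  assumes "valid_type T" "real_root T \<gamma>" shows "\<gamma> \<noteq> mul 2 \<mu> + mul k (null_root T)"
proof -
  have "real_in T {..rk T} \<gamma>" by (rule real_real_in[OF assms(2)])
  then show ?thesis
  proof (induction arbitrary: \<mu> rule: real_in.induct)
    case (simple j)
    show ?case
    proof
      assume eq: "unit_root j = mul 2 \<mu> + mul k (null_root T)"
      have par: "odd (unit_root j i) \<longleftrightarrow> odd k \<and> odd (null_root T i)" for i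
        using fun_cong[OF eq, of i] by simp
      obtain i where i: "i \<noteq> 0" "odd (null_root T i)" using null_root_odd[OF assms(1)] by auto
      have "odd k" using par[of j] by simp
      then have "odd (unit_root j 0)" "odd (unit_root j i)" using par i(2) by auto
      then show False using i(1) by (auto simp: unit_root_def split: if_splits)
    qed
  next
    case (reflection \<gamma> i)
    show ?case
    proof
      assume "reflect T i \<gamma> = mul 2 \<mu> + mul k (null_root T)"
      then have "reflect T i (reflect T i \<gamma>) = reflect T i (mul 2 \<mu> + mul k (null_root T))" by simp
      then have "\<gamma> = mul 2 (reflect T i \<mu>) + mul k (null_root T)"
        using reflection(2) assms(1) by (simp add: reflect_reflect reflect_linear reflect_null)
      then show False using reflection.IH by blast
    qed
  qed
qed

text \<open>The reflection in \<beta> is a Weyl conjugate of a simple one, hence permutes real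
  roots. Its coefficient is carried along as an integer valued function because
  2(\<beta>,\<gamma>)/(\<beta>,\<beta>) has to be known to be integral.\<close>

lemma reflection_in_real_root:
  assumes T: "valid_type T" and "real_root T \<beta>"
  shows "\<exists>\<phi>. (\<forall>\<gamma>. \<phi> \<gamma> * form T \<beta> \<beta> = 2 * form T \<beta> \<gamma>) \<and> (\<forall>\<gamma>. real_root T \<gamma> \<longrightarrow> real_root T (\<gamma> - mul (\<phi> \<gamma>) \<beta>))"
proof -
  have "real_in T {..rk T} \<beta>" by (rule real_real_in[OF assms(2)])
  then show ?thesis
  proof (induction rule: real_in.induct)
    case (simple i)
    then have i: "i \<le> rk T" by simp
    show ?case
    proof (intro exI[of _ "pair T i"] conjI allI impI)
      fix \<gamma> assume "real_root T \<gamma>"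
      from real_root.reflection[OF this i]
      show "real_root T (\<gamma> - mul (pair T i \<gamma>) (unit_root i))" by (simp only: reflect_eq)
    qed (use i in \<open>simp add: form_unit pair_unit\<close>)
  next
    case (reflection \<beta> i)
    then obtain \<phi> where \<phi>: "\<And>\<gamma>. \<phi> \<gamma> * form T \<beta> \<beta> = 2 * form T \<beta> \<gamma>"
      "\<And>\<gamma>. real_root T \<gamma> \<Longrightarrow> real_root T (\<gamma> - mul (\<phi> \<gamma>) \<beta>)" by blast
    have i: "i \<le> rk T" using reflection by simp
    show ?case
    proof (intro exI[of _ "\<lambda>\<gamma>. \<phi> (reflect T i \<gamma>)"] conjI allI impI)
      fix \<gamma>
      show "\<phi> (reflect T i \<gamma>) * form T (reflect T i \<beta>) (reflect T i \<beta>) = 2 * form T (reflect T i \<beta>) \<gamma>"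
        using \<phi>(1)[of "reflect T i \<gamma>"] by (simp only: form_reflect_reflect[OF T i] form_reflect[OF T i] reflect_reflect[OF i])
      assume "real_root T \<gamma>"
      then have "real_root T (reflect T i (reflect T i \<gamma> - mul (\<phi> (reflect T i \<gamma>)) \<beta>))"
        using i by (intro real_root.reflection \<phi>(2))
      then show "real_root T (\<gamma> - mul (\<phi> (reflect T i \<gamma>)) (reflect T i \<beta>))"
        using i by (simp add: reflect_linear reflect_reflect)
    qed
  qed
qed

lemma real_reflect:
  assumes "valid_type T" "real_root T \<beta>" "real_root T \<gamma>" "k * form T \<beta> \<beta> = 2 * form T \<beta> \<gamma>" "form T \<beta> \<beta> \<noteq> 0"
  shows "real_root T (\<gamma> - mul k \<beta>)"
proof -
  obtain \<phi> where \<phi>: "\<And>\<gamma>. \<phi> \<gamma> * form T \<beta> \<beta> = 2 * form T \<beta> \<gamma>"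
    "\<And>\<gamma>. real_root T \<gamma> \<Longrightarrow> real_root T (\<gamma> - mul (\<phi> \<gamma>) \<beta>)"
    using reflection_in_real_root[OF assms(1,2)] by blast
  have "\<phi> \<gamma> = k" using \<phi>(1)[of \<gamma>] assms(4,5) by (metis mult_cancel_right)
  then show ?thesis using \<phi>(2)[OF assms(3)] by simp
qed

section \<open>Root strings and root lengths\<close>

lemma form_shift:
  assumes "valid_type T"
  shows "form T (\<gamma> + mul a (null_root T)) (\<mu> + mul b (null_root T)) = form T \<gamma> \<mu>"
proof -
  have "form T (\<gamma> + mul a (null_root T)) \<nu> = form T \<gamma> \<nu>" for \<gamma> \<nu> a
    using form_null[OF assms, of \<nu>] form_sym[OF assms, of "null_root T" \<nu>] by (simp add: form_linear)
  then show ?thesis using form_sym[OF assms] by metis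
qed

lemma reflect_shift:
  assumes "valid_type T" "i \<le> rk T"
  shows "reflect T i (\<gamma> + mul a (null_root T)) = reflect T i \<gamma> + mul a (null_root T)"
  by (simp only: reflect_linear reflect_null[OF assms])

lemma reflect_real_shift:
  assumes "valid_type T" "i \<le> rk T" "real_root T (\<gamma> + mul a (null_root T))" "\<mu> = reflect T i \<gamma>"
  shows "real_root T (\<mu> + mul a (null_root T))"
  using real_root.reflection[OF assms(3,2)] by (simp only: reflect_shift[OF assms(1,2)] assms(4))

text \<open>Reflecting \<alpha>_i + b\<delta> in \<alpha>_i + a\<delta> and then in \<alpha>_i gives
  \<alpha>_i + (b - 2a)\<delta>. The given root supplies 1, hence -1, and steps of length 2 from 0,
  1 and -1 reach every integer.\<close>

lemma short_string_real:
  assumes T: "valid_type T" and i: "i \<le> rk T" and base: "real_root T (null_root T - unit_root i)"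
  shows "real_root T (unit_root i + mul k (null_root T))"
proof -
  let ?S = "\<lambda>k. real_root T (unit_root i + mul k (null_root T))"
  have "null_root T - unit_root i = - unit_root i + mul 1 (null_root T)" by (rule ext) simp
  with base have "real_root T (- unit_root i + mul 1 (null_root T))" by (simp only:)
  from reflect_real_shift[OF T i this, of "unit_root i"] have 1: "?S 1"
    using reflect_unit[OF i] reflect_reflect[OF i, of "unit_root i"] by (simp only:)
  have "unit_root i + mul 0 (null_root T) = unit_root i" by (rule ext) simp
  with real_unit[OF i] have 0: "?S 0" by (simp only:)
  have closed: "?S (b - 2 * a)" if "?S a" "?S b" for a b
  proof -
    have "form T (unit_root i) (unit_root i) \<noteq> 0"
      using symm_pos[of T i] i by (simp add: form_unit pair_unit)
    then have "real_root T (unit_root i + mul b (null_root T) - mul 2 (unit_root i + mul a (null_root T)))"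
      by (intro real_reflect[OF T that]) (simp_all only: form_shift[OF T] mult.commute not_False_eq_True)
    moreover have "unit_root i + mul b (null_root T) - mul 2 (unit_root i + mul a (null_root T))
       = - unit_root i + mul (b - 2 * a) (null_root T)"
      by (rule ext) (simp add: algebra_simps)
    ultimately have "real_root T (- unit_root i + mul (b - 2 * a) (null_root T))" by (simp only:)
    from reflect_real_shift[OF T i this, of "unit_root i"] show ?thesis
      using reflect_unit[OF i] reflect_reflect[OF i, of "unit_root i"] by (simp only:)
  qed
  have m1: "?S (- 1)" using closed[OF 1 1] by simp
  define S where "S k = ?S k" for k
  have S: "S 0" "S 1" "S (- 1)" "S a \<Longrightarrow> S b \<Longrightarrow> S (b - 2 * a)" for a b
    using 0 1 m1 closed unfolding S_def by blast+
  have "S (int n) \<and> S (- int n)" for n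
  proof (induction n rule: less_induct)
    case (less n)
    consider "n = 0" | "n = 1" | "2 \<le> n" by linarith
    then show ?case
    proof cases
      case 3
      then have "S (int (n - 2)) \<and> S (- int (n - 2))" by (intro less) simp
      with S(4)[OF S(3), of "int (n - 2)"] S(4)[OF S(2), of "- int (n - 2)"] 3
      show ?thesis by (simp add: of_nat_diff)
    qed (use S in simp_all)
  qed
  then have "S k" by (cases k rule: int_cases2) blast+
  then show ?thesis unfolding S_def .
qed

text \<open>Across a simple bond s_i s_j carries \<alpha>_i to \<alpha>_j, and both reflections fix
  \<delta>.\<close>

lemma adjacent_string_real:
  assumes T: "valid_type T" and ij: "i \<le> rk T" "j \<le> rk T" "i \<noteq> j" "gcm T i j = -1" "gcm T j i = -1"
    and real: "real_root T (unit_root i + mul k (null_root T))"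
  shows "real_root T (unit_root j + mul k (null_root T))"
proof (rule reflect_real_shift[OF T ij(1) reflect_real_shift[OF T ij(2) real refl]])
  have "reflect T j (unit_root i) = unit_root i + unit_root j"
    by (rule ext) (simp add: reflect_eq pair_unit ij)
  then show "unit_root j = reflect T i (reflect T j (unit_root i))"
    by (intro ext) (simp add: reflect_eq pair_linear pair_unit ij)
qed

text \<open>Applied with \<alpha>_i the short end of a multiple bond. Reflecting s_i \<alpha>_j =
  \<alpha>_j + m\<alpha>_i in \<alpha>_i - k\<delta> subtracts m(\<alpha>_i - k\<delta>) and leaves
  \<alpha>_j + km\<delta>.\<close>

lemma long_string_real:
  assumes T: "valid_type T" and ij: "i \<le> rk T" "j \<le> rk T" "i \<noteq> j" "gcm T i j = - m"
    and real: "\<And>k. real_root T (unit_root i + mul k (null_root T))"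
  shows "real_root T (unit_root j + mul (k * m) (null_root T))"
proof -
  let ?\<beta> = "unit_root i + mul (- k) (null_root T)" and ?\<gamma> = "unit_root j + mul m (unit_root i)"
  have "reflect T i (unit_root j) = ?\<gamma>"
    by (rule ext) (simp add: reflect_eq pair_unit ij)
  with real_root.reflection[OF real_unit[OF ij(2)] ij(1)] have \<gamma>: "real_root T ?\<gamma>" by (simp only:)
  have \<gamma>0: "?\<gamma> = ?\<gamma> + mul 0 (null_root T)" by (rule ext) simp
  have "form T ?\<beta> ?\<beta> = 2 * int (symm T i)"
    unfolding form_shift[OF T] using ij by (simp add: form_unit pair_unit)
  moreover have "form T ?\<beta> ?\<gamma> = int (symm T i) * m"
    by (subst \<gamma>0, unfold form_shift[OF T]) (simp add: form_unit pair_unit pair_linear ij)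
  ultimately have "real_root T (?\<gamma> - mul m ?\<beta>)"
    using symm_pos[of T i] by (intro real_reflect[OF T real \<gamma>]) simp_all
  moreover have "?\<gamma> - mul m ?\<beta> = unit_root j + mul (k * m) (null_root T)"
    by (rule ext) (simp add: algebra_simps)
  ultimately show ?thesis by (simp only:)
qed

lemma reflect_upd: "reflect T i \<gamma> = \<gamma>(i := \<gamma> i - pair T i \<gamma>)"
  by (simp add: reflect_def pair_def)

lemma real_step: "real_root T \<gamma> \<Longrightarrow> i \<le> rk T \<Longrightarrow> \<gamma>(i := \<gamma> i - pair T i \<gamma>) = \<mu> \<Longrightarrow> real_root T \<mu>"
  using real_root.reflection[of T \<gamma> i] by (simp only: reflect_upd)

text \<open>\<delta> - \<alpha>_n equals \<alpha>_0 + ... + \<alpha>_{n-1} and is reached from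
  \<alpha>_0 by one reflection per node.\<close>

lemma null_minus_short_real_D: assumes n: "4 \<le> n" shows "real_root (Aff_D n) (null_root (Aff_D n) - unit_root n)"
proof -
  have "real_root (Aff_D n) (\<lambda>i. if i \<le> j then 1 else 0)" if "j < n" for j
    using that
  proof (induction j)
    case 0
    have "unit_root 0 = (\<lambda>i. if i \<le> 0 then 1 else 0)" by (rule ext) (simp add: unit_root_def)
    then show ?case using real_unit[of 0 "Aff_D n"] by (simp only: le0)
  next
    case (Suc j)
    then have "real_root (Aff_D n) (\<lambda>i. if i \<le> j then 1 else 0)" by simp
    then show ?case
      by (rule real_step[of _ _ "Suc j"])
        (use Suc n in \<open>auto simp: pair_D fun_eq_iff\<close>)
  qed
  from this[of "n - 1"] have "real_root (Aff_D n) (\<lambda>i. if i \<le> n - 1 then 1 else 0)" using n by simp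
  moreover have "(\<lambda>i. if i \<le> n - 1 then 1 else 0) = null_root (Aff_D n) - unit_root n"
    by (rule ext) (use n in \<open>simp add: unit_root_def, presburger\<close>)
  ultimately show ?thesis by (simp only:)
qed

lemma null_minus_short_real_A: assumes n: "3 \<le> n" shows "real_root (Aff_A n) (null_root (Aff_A n) - unit_root 1)"
proof -
  \<comment> \<open>The target is \<alpha>_0 + 2(\<alpha>_2 + ... + \<alpha>_{n-1}) + \<alpha>_n:
    \<open>?u\<close> runs from node 0 through 2 up to n, and \<open>?w\<close> comes back, doubling
    the nodes n - 1 down to 2.\<close>
  let ?u = "\<lambda>k i. if i = 0 \<or> 2 \<le> i \<and> i \<le> k then 1 else 0 :: int"
  let ?w = "\<lambda>k i. ?u n i + (if k \<le> i \<and> i < n then 1 else 0)"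
  have up: "real_root (Aff_A n) (?u k)" if "2 \<le> k" "k \<le> n" for k
    using that
  proof (induction k rule: dec_induct)
    case base
    have "real_root (Aff_A n) (unit_root 0)" by (rule real_unit) simp
    then show ?case
      by (rule real_step[of _ _ 2]) (use n in \<open>auto simp: pair_A fun_eq_iff unit_root_def\<close>)
  next
    case (step k)
    then have "real_root (Aff_A n) (?u k)" by simp
    then show ?case
      by (rule real_step[of _ _ "Suc k"]) (use step n in \<open>auto simp: pair_A fun_eq_iff\<close>)
  qed
  have down: "real_root (Aff_A n) (?w (n - j))" if "j \<le> n - 2" for j
    using that
  proof (induction j)
    case 0
    have "?w (n - 0) = ?u n" by (rule ext) auto
    then show ?case using up[of n] n by (simp only:)
  next
    case (Suc j)
    define k where "k = n - Suc j"
    have k: "n - j = Suc k" "2 \<le> k" "k < n" using Suc.prems n unfolding k_def by auto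
    have "real_root (Aff_A n) (?w (Suc k))" using Suc k by simp
    moreover have "pair (Aff_A n) k (?w (Suc k)) = - 1"
    proof -
      consider "k = 2" "n = 3" | "k = 2" "3 < n" | "3 \<le> k" "k = n - 1" | "3 \<le> k" "k < n - 1"
        using k by linarith
      then show ?thesis using n k by cases (simp_all add: pair_A, presburger+)
    qed
    ultimately have "real_root (Aff_A n) (?w k)"
      by (elim real_step[of _ _ k]) (use k n in \<open>auto simp: fun_eq_iff\<close>)
    then show ?case unfolding k_def .
  qed
  have "?w (n - (n - 2)) = null_root (Aff_A n) - unit_root 1"
    by (rule ext) (use n in \<open>auto simp: unit_root_def\<close>)
  with down[of "n - 2"] show ?thesis by (simp only:)
qed

lemma null_minus_short_real_E: "real_root Aff_E (null_root Aff_E - unit_root 1)"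
proof -
  have "real_root Aff_E (\<lambda>i. if i = 0 then 1 else 0)"
    using real_unit[of 0 Aff_E] by (simp add: unit_root_def)
  then have "real_root Aff_E (\<lambda>i. if i \<le> 1 then 1 else 0)"
    by (rule real_step[of _ _ 1]) (auto simp: pair_E fun_eq_iff)
  then have "real_root Aff_E (\<lambda>i. if i \<le> 2 then 1 else 0)"
    by (rule real_step[of _ _ 2]) (auto simp: pair_E fun_eq_iff)
  then have "real_root Aff_E (\<lambda>i. if i \<le> 3 then 1 else 0)"
    by (rule real_step[of _ _ 3]) (auto simp: pair_E fun_eq_iff)
  then have "real_root Aff_E (\<lambda>i. if i \<le> 4 then 1 else 0)"
    by (rule real_step[of _ _ 4]) (auto simp: pair_E fun_eq_iff)
  then have "real_root Aff_E (\<lambda>i. if i = 2 then 2 else if i \<le> 4 then 1 else 0)"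
    by (rule real_step[of _ _ 2]) (auto simp: pair_E fun_eq_iff)
  then have "real_root Aff_E (\<lambda>i. if i = 2 \<or> i = 3 then 2 else if i \<le> 4 then 1 else 0)"
    by (rule real_step[of _ _ 3]) (auto simp: pair_E fun_eq_iff)
  then have "real_root Aff_E (\<lambda>i. if i = 2 then 3 else if i = 3 then 2 else if i \<le> 4 then 1 else 0)"
    by (rule real_step[of _ _ 2]) (auto simp: pair_E fun_eq_iff)
  moreover have "(\<lambda>i. if i = 2 then 3 else if i = 3 then 2 else if i \<le> 4 then 1 else 0)
      = null_root Aff_E - unit_root 1"
    by (rule ext) (auto simp: unit_root_def)
  ultimately show ?thesis by (simp only:)
qed

lemma null_minus_short_real_D4: "real_root Aff_D4 (null_root Aff_D4 - unit_root 1)"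
proof -
  have "real_root Aff_D4 (\<lambda>i. if i = 0 then 1 else 0)"
    using real_unit[of 0 Aff_D4] by (simp add: unit_root_def)
  then have "real_root Aff_D4 (\<lambda>i. if i \<le> 1 then 1 else 0)"
    by (rule real_step[of _ _ 1]) (auto simp: pair_D4 fun_eq_iff)
  then have "real_root Aff_D4 (\<lambda>i. if i \<le> 2 then 1 else 0)"
    by (rule real_step[of _ _ 2]) (auto simp: pair_D4 fun_eq_iff)
  moreover have "(\<lambda>i. if i \<le> 2 then 1 else 0) = null_root Aff_D4 - unit_root 1"
    by (rule ext) (auto simp: unit_root_def)
  ultimately show ?thesis by (simp only:)
qed

text \<open>The finite diagram is traversed from a short simple root whose full string is known
  (node n for \<open>Aff_D\<close>, node 1 otherwise): simple bonds transport the string, the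
  multiple bond multiplies its step.\<close>

lemma simple_string_real:
  assumes T: "valid_type T" and i: "1 \<le> i" "i \<le> rk T"
  shows "real_root T (unit_root i + mul (k * int (symm T i)) (null_root T))"
proof (cases T)
  case (Aff_A n)
  have n: "3 \<le> n" using T Aff_A by simp
  have short: "real_root T (unit_root j + mul k (null_root T))" if "1 \<le> j" "j < n" for j k
    using that
  proof (induction j rule: dec_induct)
    case base
    have "real_root T (null_root T - unit_root 1)" using null_minus_short_real_A[OF n] by (simp only: Aff_A)
    have "1 \<le> rk T" using n Aff_A by simp
    from short_string_real[OF T this \<open>real_root T (null_root T - unit_root 1)\<close>] show ?case .
  next
    case (step j)
    show ?case
      by (rule adjacent_string_real[OF T _ _ _ _ _ step.IH]) (use step.hyps step.prems n Aff_A in auto)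
  qed
  show ?thesis
  proof (cases "i = n")
    case True
    have "real_root T (unit_root n + mul (k * 2) (null_root T))"
      by (rule long_string_real[OF T _ _ _ _ short[of "n - 1"]]) (use n Aff_A in auto)
    moreover have "int (symm T i) = 2" using True Aff_A by simp
    ultimately show ?thesis by (simp only: True)
  next
    case False
    then have "int (symm T i) = 1" "i < n" using i Aff_A by auto
    then show ?thesis using short[OF i(1), of k] by (simp only: mult_1_right)
  qed
next
  case (Aff_D n)
  have n: "4 \<le> n" using T Aff_D by simp
  have "real_root T (null_root T - unit_root n)" using null_minus_short_real_D[OF n] by (simp only: Aff_D)
  then have short: "real_root T (unit_root n + mul k (null_root T))" for k
    by (rule short_string_real[OF T, rotated]) (simp only: Aff_D rk.simps order_refl)
  have long: "real_root T (unit_root (n - Suc j) + mul (k * 2) (null_root T))" if "j < n - 1" for j k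
    using that
  proof (induction j)
    case 0
    show ?case by (rule long_string_real[OF T _ _ _ _ short]) (use n Aff_D in auto)
  next
    case (Suc j)
    show ?case
      by (rule adjacent_string_real[OF T _ _ _ _ _ Suc.IH]) (use Suc.prems n Aff_D in auto)
  qed
  show ?thesis
  proof (cases "i = n")
    case False
    then have "n - Suc (n - Suc i) = i" "n - Suc i < n - 1" "int (symm T i) = 2"
      using i Aff_D by auto
    then show ?thesis using long[of "n - Suc i" k] by (simp only:)
  next
    case True
    then have "int (symm T i) = 1" using Aff_D by simp
    then show ?thesis using short[of k] by (simp only: True mult_1_right)
  qed
next
  case Aff_E
  have "real_root T (null_root T - unit_root 1)" using null_minus_short_real_E by (simp only: Aff_E)
  then have 1: "real_root T (unit_root 1 + mul k (null_root T))" for k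
    by (rule short_string_real[OF T, rotated]) (simp add: Aff_E)
  have 2: "real_root T (unit_root 2 + mul k (null_root T))" for k
    by (rule adjacent_string_real[OF T _ _ _ _ _ 1]) (use Aff_E in auto)
  have 3: "real_root T (unit_root 3 + mul (k * 2) (null_root T))" for k
    by (rule long_string_real[OF T _ _ _ _ 2]) (use Aff_E in auto)
  have 4: "real_root T (unit_root 4 + mul (k * 2) (null_root T))" for k
    by (rule adjacent_string_real[OF T _ _ _ _ _ 3]) (use Aff_E in auto)
  have "i = 1 \<or> i = 2 \<or> i = 3 \<or> i = 4" using i Aff_E by auto
  moreover have "int (symm T 1) = 1" "int (symm T 2) = 1" "int (symm T 3) = 2" "int (symm T 4) = 2"
    using Aff_E by simp_all
  ultimately show ?thesis using 1[of k] 2[of k] 3[of k] 4[of k] by (elim disjE) (simp_all only: mult_1_right)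
next
  case Aff_D4
  have "real_root T (null_root T - unit_root 1)" using null_minus_short_real_D4 by (simp only: Aff_D4)
  then have 1: "real_root T (unit_root 1 + mul k (null_root T))" for k
    by (rule short_string_real[OF T, rotated]) (simp add: Aff_D4)
  have 2: "real_root T (unit_root 2 + mul (k * 3) (null_root T))" for k
    by (rule long_string_real[OF T _ _ _ _ 1]) (use Aff_D4 in auto)
  have "i = 1 \<or> i = 2" using i Aff_D4 by auto
  moreover have "int (symm T 1) = 1" "int (symm T 2) = 3" using Aff_D4 by simp_all
  ultimately show ?thesis using 1[of k] 2[of k] by (elim disjE) (simp_all only: mult_1_right)
qed

text \<open>A finite root is conjugate to a simple root by reflections that preserve the form and
  fix \<delta>.\<close>

lemma string_real:
  assumes T: "valid_type T" and "real_in T {1..rk T} \<alpha>"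
  shows "\<exists>i\<in>{1..rk T}. form T \<alpha> \<alpha> = 2 * int (symm T i)
    \<and> (\<forall>k. real_root T (\<alpha> + mul (k * int (symm T i)) (null_root T)))"
  using assms(2)
proof (induction rule: real_in.induct)
  case (simple i)
  then show ?case
    by (intro bexI[of _ i] conjI allI simple_string_real[OF T]) (simp_all add: form_unit pair_unit)
next
  case (reflection \<gamma> i)
  then have i: "i \<le> rk T" by simp
  from reflection.IH show ?case
    using reflect_real_shift[OF T i] form_reflect_reflect[OF T i, of \<gamma> \<gamma>] by (metis (no_types, lifting))
qed

lemma symmetrizer_symm: "valid_type T \<Longrightarrow> symmetrizer T (\<lambda>i. real (symm T i))"
  unfolding symmetrizer_def using symm_gcm[of T] symm_pos[of T]
  by (metis of_int_mult of_int_of_nat_eq of_nat_0_less_iff)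

text \<open>The diagram is connected and each edge fixes the ratio of the values at its ends;
  \<open>symm\<close> is 1 at node 0 in every type. This reduces the quantification over
  symmetrizers in \<open>long_root\<close> and \<open>short_root\<close> to one form.\<close>

lemma symmetrizer_unique:
  assumes T: "valid_type T" and c: "symmetrizer T c" and i: "i \<le> rk T"
  shows "c i = c 0 * real (symm T i)"
proof -
  have edge: "c j = c 0 * real (symm T j)"
    if "c i = c 0 * real (symm T i)" "i \<le> rk T" "j \<le> rk T" "gcm T i j \<noteq> 0" for i j
  proof -
    have "c i * of_int (gcm T i j) = c j * of_int (gcm T j i)"
      using c that unfolding symmetrizer_def by blast
    moreover have "real (symm T i) * of_int (gcm T i j) = real (symm T j) * of_int (gcm T j i)"
      using symm_gcm[OF T that(2,3)] by (metis of_int_mult of_int_of_nat_eq)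
    moreover have "gcm T j i \<noteq> 0" using gcm_zero[OF T that(3,2)] that(4) by blast
    ultimately show ?thesis using that(1) by (metis (no_types) mult.assoc mult_cancel_right of_int_eq_0_iff)
  qed
  have start: "c 0 = c 0 * real (symm T 0)" by (cases T) (use T in auto)
  show ?thesis
  proof (cases "\<exists>n. T = Aff_A n")
    case True
    then obtain n where Aff_A: "T = Aff_A n" by blast
    have n: "3 \<le> n" using T Aff_A by simp
    have 2: "c 2 = c 0 * real (symm T 2)" by (rule edge[OF start]) (use n Aff_A in auto)
    have 1: "c 1 = c 0 * real (symm T 1)" by (rule edge[OF 2]) (use n Aff_A in auto)
    have "c j = c 0 * real (symm T j)" if "2 \<le> j" "j \<le> n" for j
      using that
    proof (induction j rule: dec_induct)
      case (step j)
      then have "c j = c 0 * real (symm T j)" by simp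
      then show ?case by (rule edge) (use step Aff_A in auto)
    qed (rule 2)
    moreover have "i = 0 \<or> i = 1 \<or> 2 \<le> i" by linarith
    ultimately show ?thesis using start 1 i Aff_A by auto
  next
    case False
    show ?thesis using i
    proof (induction i)
      case (Suc i)
      have "gcm T i (Suc i) \<noteq> 0" using False Suc.prems by (cases T; auto)
      then show ?case by (intro edge[OF Suc.IH]) (use Suc.prems in auto)
    qed (rule start)
  qed
qed

lemma sq_length_form:
  assumes T: "valid_type T" and c: "symmetrizer T c"
  shows "sq_length T c \<gamma> = c 0 * of_int (form T \<gamma> \<gamma>)" "0 < c 0"
proof -
  show "0 < c 0" using c by (simp add: symmetrizer_def)
  have "of_int (form T \<gamma> \<gamma>) =
      (\<Sum>i\<le>rk T. \<Sum>j\<le>rk T. real (symm T i) * of_int (\<gamma> i) * (of_int (gcm T i j) * of_int (\<gamma> j)))"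
    by (simp add: form_def pair_def sum_distrib_left)
  moreover have "c i * of_int (gcm T i j) * of_int (\<gamma> i) * of_int (\<gamma> j) =
      c 0 * (real (symm T i) * of_int (\<gamma> i) * (of_int (gcm T i j) * of_int (\<gamma> j)))"
    if "i \<in> {..rk T}" for i j
    using symmetrizer_unique[OF T c, of i] that by (simp only: atMost_iff mult_ac)
  ultimately show "sq_length T c \<gamma> = c 0 * of_int (form T \<gamma> \<gamma>)"
    unfolding sq_length_def by (simp only: sum_distrib_left cong: sum.cong)
qed

lemma symm_values:
  assumes "valid_type T"
  shows "1 \<le> i \<Longrightarrow> i \<le> rk T \<Longrightarrow> symm T i = 1 \<or> symm T i = twist T"
    "\<exists>i\<in>{1..rk T}. symm T i = 1" "\<exists>i\<in>{1..rk T}. symm T i = twist T" "1 < twist T"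
proof -
  show "1 \<le> i \<Longrightarrow> i \<le> rk T \<Longrightarrow> symm T i = 1 \<or> symm T i = twist T" by (cases T) auto
  show "1 < twist T" by (cases T) auto
  show "\<exists>i\<in>{1..rk T}. symm T i = 1"
  proof (cases T)
    case (Aff_A n) then show ?thesis using assms by (intro bexI[of _ 1]) auto
  next
    case (Aff_D n) then show ?thesis using assms by (intro bexI[of _ n]) auto
  qed (auto intro: bexI[of _ 1])
  show "\<exists>i\<in>{1..rk T}. symm T i = twist T"
  proof (cases T)
    case (Aff_A n) then show ?thesis using assms by (intro bexI[of _ n]) auto
  next
    case (Aff_D n) then show ?thesis using assms by (intro bexI[of _ 1]) auto
  next
    case Aff_E then show ?thesis by (intro bexI[of _ 3]) auto
  next
    case Aff_D4 then show ?thesis by (intro bexI[of _ 2]) auto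
  qed
qed

section \<open>Exponentials of locally nilpotent inner derivations\<close>

context complex_lie_algebra
begin

lemma br_zero [simp]: "br 0 x = 0" "br x 0 = 0"
  using br_add_left[of 0 0 x] br_add_right[of x 0 0] by auto

lemma br_minus [simp]: "br (- x) y = - br x y" "br x (- y) = - br x y"
  using br_add_left[of "- x" x y] br_add_right[of x "- y" y]
  by (simp_all add: eq_neg_iff_add_eq_0)

lemma br_diff: "br (x - y) z = br x z - br y z" "br x (y - z) = br x y - br x z"
  using br_add_left[of x "- y" z] br_add_right[of x y "- z"] by simp_all

lemma br_anti: "br x y = - br y x"
proof -
  have "br x y + br y x = br (x + y) (x + y)"
    unfolding br_add_left br_add_right by (simp add: br_self)
  then have "br x y + br y x = 0" by (simp only: br_self)
  then show ?thesis by (rule eq_neg_iff_add_eq_0[THEN iffD2])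
qed

lemma leibniz: "br a (br x y) = br (br a x) y + br x (br a y)"
proof -
  have "br x (br y a) = - br x (br a y)" by (subst br_anti[of y a]) simp
  moreover have "br y (br a x) = - br (br a x) y" by (rule br_anti)
  ultimately show ?thesis using jacobi[of a x y] by (simp add: algebra_simps)
qed

lemma br_br_left: "br (br x y) z = br x (br y z) - br y (br x z)"
  using leibniz[of x y z] by simp

lemma br_sum_right: "br a (sum g A) = (\<Sum>k\<in>A. br a (g k))"
  by (induction A rule: infinite_finite_induct) (auto simp: br_add_right)

lemma br_sum_left: "br (sum g A) a = (\<Sum>k\<in>A. br (g k) a)"
  by (induction A rule: infinite_finite_induct) (auto simp: br_add_left)

definition locnil :: "'a \<Rightarrow> 'a set" where
  "locnil a = {x. \<exists>N. (br a ^^ N) x = 0}"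

lemma ad_pow_linear:
  "(br a ^^ k) 0 = 0" "(br a ^^ k) (x + y) = (br a ^^ k) x + (br a ^^ k) y"
  "(br a ^^ k) (sc c x) = sc c ((br a ^^ k) x)"
  by (induction k) (auto simp: br_add_right br_scale_right)

lemma ad_pow_mono: "(br a ^^ N) x = 0 \<Longrightarrow> N \<le> k \<Longrightarrow> (br a ^^ k) x = 0"
  using funpow_add[of "k - N" N "br a"] by (auto simp: ad_pow_linear)

text \<open>Divided powers of ad a, whose Leibniz rule has no binomial coefficients.\<close>

definition dpow :: "'a \<Rightarrow> nat \<Rightarrow> 'a \<Rightarrow> 'a" where
  "dpow a k x = sc (1 / fact k) ((br a ^^ k) x)"

lemma dpow_simps: "dpow a 0 x = x" "br a (dpow a k x) = sc (of_nat (Suc k)) (dpow a (Suc k) x)"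
  by (auto simp: dpow_def br_scale_right field_simps simp del: of_nat_Suc)

lemma dpow_eq_0_iff: "dpow a k x = 0 \<longleftrightarrow> (br a ^^ k) x = 0"
  by (simp add: dpow_def)

lemma dpow_linear: "dpow a k 0 = 0" "dpow a k (x + y) = dpow a k x + dpow a k y"
  "dpow a k (sc c x) = sc c (dpow a k x)"
  by (simp_all add: dpow_def ad_pow_linear scale_right_distrib mult.commute)

lemma dpow_leibniz: "dpow a m (br x y) = (\<Sum>k\<le>m. br (dpow a k x) (dpow a (m - k) y))"
proof (induction m)
  case 0 then show ?case by (simp add: dpow_simps)
next
  case (Suc m)
  let ?g = "\<lambda>i j. br (dpow a i x) (dpow a j y)"
  have "sc (of_nat (Suc m)) (dpow a (Suc m) (br x y)) = br a (dpow a m (br x y))"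
    by (simp only: dpow_simps)
  also have "\<dots> = (\<Sum>k\<le>m. sc (of_nat (Suc k)) (?g (Suc k) (m - k)))
      + (\<Sum>k\<le>m. sc (of_nat (Suc m - k)) (?g k (Suc m - k)))"
    unfolding Suc br_sum_right leibniz dpow_simps sum.distrib[symmetric]
    by (intro sum.cong) (auto simp: br_scale_left br_scale_right Suc_diff_le simp del: of_nat_Suc)
  also have "(\<Sum>k\<le>m. sc (of_nat (Suc k)) (?g (Suc k) (m - k)))
      = (\<Sum>k\<le>Suc m. sc (of_nat k) (?g k (Suc m - k)))"
    unfolding sum.atMost_Suc_shift by simp
  also have "(\<Sum>k\<le>m. sc (of_nat (Suc m - k)) (?g k (Suc m - k)))
      = (\<Sum>k\<le>Suc m. sc (of_nat (Suc m - k)) (?g k (Suc m - k)))"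
    by simp
  also have "(\<Sum>k\<le>Suc m. sc (of_nat k) (?g k (Suc m - k)))
      + (\<Sum>k\<le>Suc m. sc (of_nat (Suc m - k)) (?g k (Suc m - k)))
      = sc (of_nat (Suc m)) (\<Sum>k\<le>Suc m. ?g k (Suc m - k))"
    unfolding sum.distrib[symmetric] scale_sum_right
    by (intro sum.cong) (auto simp flip: scale_left_distrib of_nat_add)
  finally show ?case by (metis of_nat_eq_0_iff old.nat.distinct(2) scale_left_imp_eq)
qed

text \<open>The series is cut at the nilpotency index of its argument; any other bound N with
  \<open>(br a ^^ N) x = 0\<close> gives the same sum (\<open>ad_exp_eq\<close>).\<close>

definition ad_exp :: "'a \<Rightarrow> 'a \<Rightarrow> 'a" where
  "ad_exp a x = (\<Sum>k<(LEAST N. (br a ^^ N) x = 0). dpow a k x)"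

lemma ad_exp_eq: assumes "(br a ^^ N) x = 0" shows "ad_exp a x = (\<Sum>k<N. dpow a k x)"
proof -
  let ?M = "LEAST N. (br a ^^ N) x = 0"
  have M: "?M \<le> N" "(br a ^^ ?M) x = 0" by (rule Least_le, rule assms) (rule LeastI, rule assms)
  have "(\<Sum>k<N. dpow a k x) = (\<Sum>k<?M. dpow a k x)"
    by (rule sum.mono_neutral_right)
      (use M(1) ad_pow_mono[OF M(2)] in \<open>auto simp: dpow_eq_0_iff not_less simp del: funpow.simps\<close>)
  then show ?thesis by (simp add: ad_exp_def)
qed

lemma locnil_add: assumes "x \<in> locnil a" "y \<in> locnil a"
  shows "x + y \<in> locnil a" "ad_exp a (x + y) = ad_exp a x + ad_exp a y"
    "br x y \<in> locnil a" "ad_exp a (br x y) = br (ad_exp a x) (ad_exp a y)"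
proof -
  obtain M1 M2 where M: "(br a ^^ M1) x = 0" "(br a ^^ M2) y = 0"
    using assms unfolding locnil_def by auto
  define N where "N = max M1 M2"
  have x: "(br a ^^ k) x = 0" and y: "(br a ^^ k) y = 0" if "N \<le> k" for k
    using M that ad_pow_mono unfolding N_def by auto
  have xy: "(br a ^^ N) (x + y) = 0" using x y by (simp add: ad_pow_linear)
  then show "x + y \<in> locnil a" by (auto simp: locnil_def)
  show "ad_exp a (x + y) = ad_exp a x + ad_exp a y"
    using ad_exp_eq[OF xy] ad_exp_eq[OF x[OF order_refl]] ad_exp_eq[OF y[OF order_refl]]
    by (simp add: dpow_linear sum.distrib)
  have "dpow a (N + N) (br x y) = 0"
    unfolding dpow_leibniz
  proof (intro sum.neutral ballI)
    fix k
    show "br (dpow a k x) (dpow a (N + N - k) y) = 0"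
      using x[of k] y[of "N + N - k"] by (cases "N \<le> k") (auto simp: dpow_def)
  qed
  then have nil: "(br a ^^ (N + N)) (br x y) = 0" by (simp add: dpow_eq_0_iff)
  then show "br x y \<in> locnil a" by (auto simp: locnil_def)
  have "ad_exp a (br x y) = (\<Sum>m<N+N. \<Sum>k\<le>m. br (dpow a k x) (dpow a (m - k) y))"
    using ad_exp_eq[OF nil] by (simp add: dpow_leibniz)
  also have "\<dots> = (\<Sum>(i,j)\<in>{(i,j). i + j < N + N}. br (dpow a i x) (dpow a j y))"
    by (rule sum.triangle_reindex[symmetric])
  \<comment> \<open>The triangle i + j < 2N contains the square of side N, and outside the square
    one of the factors vanishes.\<close>
  also have "\<dots> = (\<Sum>(i,j)\<in>{..<N}\<times>{..<N}. br (dpow a i x) (dpow a j y))"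
  proof (rule sum.mono_neutral_right)
    show "finite {(i,j). i + j < N + N}"
      by (rule finite_subset[of _ "{..<N+N}\<times>{..<N+N}"]) auto
    have zero: "br (dpow a i x) (dpow a j y) = 0" if "\<not> (i < N \<and> j < N)" for i j
      using x[of i] y[of j] that by (auto simp: dpow_def)
    then show "\<forall>p\<in>{(i,j). i + j < N + N} - {..<N}\<times>{..<N}.
        (case p of (i, j) \<Rightarrow> br (dpow a i x) (dpow a j y)) = 0"
      using zero by auto
  qed auto
  also have "\<dots> = br (ad_exp a x) (ad_exp a y)"
    using ad_exp_eq[OF x[OF order_refl]] ad_exp_eq[OF y[OF order_refl]]
    by (simp add: br_sum_left br_sum_right sum.cartesian_product[symmetric]) (rule sum.swap)
  finally show "ad_exp a (br x y) = br (ad_exp a x) (ad_exp a y)" .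
qed

lemma locnil_scale: assumes "x \<in> locnil a"
  shows "sc c x \<in> locnil a" "ad_exp a (sc c x) = sc c (ad_exp a x)"
proof -
  obtain N where N: "(br a ^^ N) x = 0" using assms unfolding locnil_def by auto
  then have cN: "(br a ^^ N) (sc c x) = 0" by (simp only: ad_pow_linear scale_zero_right)
  then show "sc c x \<in> locnil a" unfolding locnil_def by blast
  show "ad_exp a (sc c x) = sc c (ad_exp a x)"
    unfolding ad_exp_eq[OF N] ad_exp_eq[OF cN] dpow_linear scale_sum_right ..
qed

lemma locnil_zero: "0 \<in> locnil a"
  unfolding locnil_def using ad_pow_linear(1) by blast

text \<open>Applying the last nonvanishing power of ad a to exp(ad a) x leaves only the leading
  term. Injectivity is what carries nonzero root vectors to nonzero ones.\<close>

lemma ad_exp_inj: assumes "x \<in> locnil a" "ad_exp a x = 0" shows "x = 0"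
proof (rule ccontr)
  assume x: "x \<noteq> 0"
  define N where "N = (LEAST N. (br a ^^ N) x = 0)"
  have "\<exists>N. (br a ^^ N) x = 0" using assms(1) unfolding locnil_def by blast
  then have N: "(br a ^^ N) x = 0" unfolding N_def by (rule LeastI_ex)
  have "N \<noteq> 0" using N x by (metis funpow_0)
  then obtain M where M: "N = Suc M" by (cases N) auto
  have "M < (LEAST N. (br a ^^ N) x = 0)" using M unfolding N_def by simp
  then have nz: "(br a ^^ M) x \<noteq> 0" by (rule not_less_Least)
  have zero: "(br a ^^ M) (dpow a (Suc k) x) = 0" for k
  proof -
    have "(br a ^^ (M + Suc k)) x = 0" by (rule ad_pow_mono[OF N]) (simp add: M)
    then show ?thesis by (simp only: dpow_def ad_pow_linear funpow_add o_apply scale_zero_right)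
  qed
  have "(br a ^^ M) (sum g A) = (\<Sum>k\<in>A. (br a ^^ M) (g k))" for g and A :: "nat set"
    by (induction A rule: infinite_finite_induct)
      (simp_all only: ad_pow_linear sum.infinite sum.empty sum.insert not_False_eq_True)
  then have "(br a ^^ M) (\<Sum>k<Suc M. dpow a k x) = (br a ^^ M) x"
    by (simp only: sum.lessThan_Suc_shift ad_pow_linear zero dpow_simps sum.neutral_const add_0_right)
  moreover have "(\<Sum>k<Suc M. dpow a k x) = 0"
    using assms(2) unfolding ad_exp_eq[OF N] M .
  moreover have "(br a ^^ M) 0 = 0" by (rule ad_pow_linear)
  ultimately show False using nz by argo
qed

lemma ad_exp_mem:
  assumes "subspace S" "\<And>y. y \<in> S \<Longrightarrow> br a y \<in> S" "x \<in> S"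
  shows "ad_exp a x \<in> S"
proof -
  have "(br a ^^ k) x \<in> S" for k
    by (induction k) (simp_all only: funpow.simps id_apply o_apply assms)
  then show ?thesis unfolding ad_exp_def dpow_def
    by (intro subspace_sum subspace_scale assms)
qed

end

section \<open>Weights\<close>

text \<open>Exchanges e_i and f_i, with signs that keep [e_i, f_i] equal to the coroot and the
  Cartan matrix unchanged. The positive half of the dual is the negative half of K, so statements
  need a proof for one half only.\<close>

definition dual :: "('a::ab_group_add) km_data \<Rightarrow> 'a km_data" where
  "dual K = K\<lparr>chev_e := chev_f K, chev_f := chev_e K, sroot := \<lambda>i h. - sroot K i h,
     scoroot := \<lambda>i. - scoroot K i\<rparr>"

lemma dual_simps [simp]:
  "scale (dual K) = scale K" "lie (dual K) = lie K" "cartan (dual K) = cartan K"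
  "chev_e (dual K) = chev_f K" "chev_f (dual K) = chev_e K"
  "sroot (dual K) i h = - sroot K i h" "scoroot (dual K) i = - scoroot K i"
  by (simp_all add: dual_def)

locale affine = complex_lie_algebra "scale K" "lie K"
  for K :: "('a::ab_group_add) km_data" +
  fixes T :: twisted_type
  assumes valid: "valid_type T"
    and cartan_subspace: "subspace (cartan K)"
    and coroot_cartan: "i \<le> rk T \<Longrightarrow> scoroot K i \<in> cartan K"
    and sroot_add: "i \<le> rk T \<Longrightarrow> h \<in> cartan K \<Longrightarrow> h' \<in> cartan K \<Longrightarrow>
      sroot K i (h + h') = sroot K i h + sroot K i h'"
    and sroot_scale: "i \<le> rk T \<Longrightarrow> h \<in> cartan K \<Longrightarrow> sroot K i (scale K c h) = c * sroot K i h"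
    and sroot_indep: "(\<And>h. h \<in> cartan K \<Longrightarrow> (\<Sum>i\<le>rk T. a i * sroot K i h) = 0) \<Longrightarrow> i \<le> rk T \<Longrightarrow> a i = 0"
    and sroot_coroot: "i \<le> rk T \<Longrightarrow> j \<le> rk T \<Longrightarrow> sroot K j (scoroot K i) = of_int (gcm T i j)"
    and cartan_br: "h \<in> cartan K \<Longrightarrow> h' \<in> cartan K \<Longrightarrow> lie K h h' = 0"
    and h_e: "i \<le> rk T \<Longrightarrow> h \<in> cartan K \<Longrightarrow> lie K h (chev_e K i) = scale K (sroot K i h) (chev_e K i)"
    and h_f: "i \<le> rk T \<Longrightarrow> h \<in> cartan K \<Longrightarrow> lie K h (chev_f K i) = scale K (- sroot K i h) (chev_f K i)"
    and e_f: "i \<le> rk T \<Longrightarrow> j \<le> rk T \<Longrightarrow>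
      lie K (chev_e K i) (chev_f K j) = (if i = j then scoroot K i else 0)"
    and gen: "lie_generated K (cartan K \<union> chev_e K ` {..rk T} \<union> chev_f K ` {..rk T}) = UNIV"
    and no_ideal: "lie_ideal K J \<Longrightarrow> J \<inter> cartan K = {0} \<Longrightarrow> J = {0}"

lemma twisted_affine_affine: assumes "twisted_affine T K" shows "affine K T"
proof -
  have indep: "\<forall>c. (\<forall>h\<in>cartan K. (\<Sum>i\<le>rk T. c i * sroot K i h) = 0) \<longrightarrow> (\<forall>i\<le>rk T. c i = 0)"
    using assms unfolding twisted_affine_def by (elim conjE)
  show ?thesis
    using assms unfolding twisted_affine_def
  proof (elim conjE, intro affine.intro affine_axioms.intro)
    show "a i = 0" if "\<And>h. h \<in> cartan K \<Longrightarrow> (\<Sum>i\<le>rk T. a i * sroot K i h) = 0" "i \<le> rk T" for a i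
      using indep[rule_format, of a] that by simp
  qed (assumption | simp)+
qed

context affine
begin

lemma affine_dual: "affine (dual K) T"
proof (intro affine.intro affine_axioms.intro)
  show "complex_lie_algebra (scale (dual K)) (lie (dual K))"
    by (simp add: complex_lie_algebra_axioms)
  show "c i = 0" if *: "\<And>h. h \<in> cartan (dual K) \<Longrightarrow> (\<Sum>i\<le>rk T. c i * sroot (dual K) i h) = 0"
    and "i \<le> rk T" for c i
    by (rule sroot_indep[of c]) (use that in \<open>auto simp: sum_negf\<close>)
  show "lie (dual K) (chev_e (dual K) i) (chev_f (dual K) j) =
      (if i = j then scoroot (dual K) i else 0)" if "i \<le> rk T" "j \<le> rk T" for i j
    using e_f[OF that(2,1)] br_anti[of "chev_f K i"] by auto
  show "lie_generated (dual K) (cartan (dual K) \<union> chev_e (dual K) ` {..rk T} \<union>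
      chev_f (dual K) ` {..rk T}) = UNIV"
    using gen by (simp add: lie_generated_def lie_subalgebra_def Un_commute Un_left_commute Un_assoc)
  show "J = {0}" if "lie_ideal (dual K) J" "J \<inter> cartan (dual K) = {0}" for J
    using no_ideal[of J] that by (simp add: lie_ideal_def)
  show "sroot (dual K) j (scoroot (dual K) i) = of_int (gcm T i j)" if "i \<le> rk T" "j \<le> rk T" for i j
    using sroot_coroot[OF that] sroot_scale[OF that(2) coroot_cartan[OF that(1)], of "-1"] by simp
qed (use valid cartan_subspace sroot_add sroot_scale cartan_br h_e h_f coroot_cartan in
     \<open>auto intro: subspace_neg\<close>)

text \<open>By the Jacobi identity the elements mapping S into itself form a subalgebra, so
  generators suffice.\<close>

lemma lie_ideal_of_generators:
  assumes "subspace S"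
    and "\<And>g x. g \<in> cartan K \<union> chev_e K ` {..rk T} \<union> chev_f K ` {..rk T} \<Longrightarrow> x \<in> S \<Longrightarrow> lie K g x \<in> S"
  shows "lie_ideal K S"
proof -
  let ?A = "{y. \<forall>x\<in>S. lie K y x \<in> S}"
  have "lie_subalgebra K ?A"
    unfolding lie_subalgebra_def
  proof (intro conjI ballI)
    show "subspace ?A"
      using assms(1) by (auto intro!: subspaceI simp: br_add_left br_scale_left subspace_0 subspace_add subspace_scale)
    fix y z assume "y \<in> ?A" "z \<in> ?A"
    then show "lie K y z \<in> ?A" using assms(1) by (auto simp: br_br_left intro: subspace_diff)
  qed
  then have "lie_generated K (cartan K \<union> chev_e K ` {..rk T} \<union> chev_f K ` {..rk T}) \<subseteq> ?A"
    using assms(2) unfolding lie_generated_def by blast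
  then show ?thesis using assms(1) gen by (auto simp: lie_ideal_def)
qed

lemma generated_UNIV:
  assumes "subspace S"
    and "\<And>y z. y \<in> S \<Longrightarrow> z \<in> S \<Longrightarrow> lie K y z \<in> S"
    and "cartan K \<union> chev_e K ` {..rk T} \<union> chev_f K ` {..rk T} \<subseteq> S"
  shows "S = UNIV"
  using assms gen unfolding lie_generated_def lie_subalgebra_def by blast

abbreviation rs :: "root \<Rightarrow> 'a set" where "rs \<equiv> root_space K T"
abbreviation rf :: "root \<Rightarrow> 'a \<Rightarrow> complex" where "rf \<equiv> root_fun K T"

lemma rf_add: "rf (\<gamma> + \<mu>) h = rf \<gamma> h + rf \<mu> h"
  by (simp add: root_fun_def sum.distrib algebra_simps)

lemma rf_minus: "rf (- \<gamma>) h = - rf \<gamma> h"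
  by (simp add: root_fun_def sum_negf)

lemma rf_diff: "rf (\<gamma> - \<mu>) h = rf \<gamma> h - rf \<mu> h"
  using rf_add[of \<gamma> "- \<mu>" h] by (simp add: rf_minus)

lemma rf_zero: "rf 0 h = 0"
  by (simp add: root_fun_def)

lemma rf_mult: "rf (\<lambda>i. k * \<gamma> i) h = of_int k * rf \<gamma> h"
  by (simp add: root_fun_def sum_distrib_left mult.assoc)

lemma rf_unit: "i \<le> rk T \<Longrightarrow> rf (unit_root i) h = sroot K i h"
  unfolding root_fun_def unit_root_def
  by (subst sum.remove[of _ i]) (auto intro!: sum.neutral)

lemma rf_lin: "h \<in> cartan K \<Longrightarrow> h' \<in> cartan K \<Longrightarrow> rf \<gamma> (h + h') = rf \<gamma> h + rf \<gamma> h'"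
  "h \<in> cartan K \<Longrightarrow> rf \<gamma> (scale K c h) = c * rf \<gamma> h"
  by (auto simp: root_fun_def sroot_add sroot_scale sum.distrib sum_distrib_left algebra_simps
      intro!: sum.cong)

lemma rf_coroot: "i \<le> rk T \<Longrightarrow> rf \<gamma> (scoroot K i) = of_int (\<Sum>j\<le>rk T. gcm T i j * \<gamma> j)"
  by (simp add: root_fun_def sroot_coroot mult.commute)

lemma rs_mem: "x \<in> rs \<gamma> \<Longrightarrow> h \<in> cartan K \<Longrightarrow> lie K h x = scale K (rf \<gamma> h) x"
  by (simp add: root_space_def)

lemma rs_mem_right: "x \<in> rs \<gamma> \<Longrightarrow> h \<in> cartan K \<Longrightarrow> lie K x h = scale K (- rf \<gamma> h) x"
  using rs_mem[of x \<gamma> h] br_anti[of x h] by simp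

lemma rs_subspace: "subspace (rs \<gamma>)"
  by (rule subspaceI)
    (auto simp: root_space_def br_add_right br_scale_right scale_right_distrib mult.commute)

lemma rs_br: assumes "x \<in> rs \<gamma>" "y \<in> rs \<mu>" shows "lie K x y \<in> rs (\<gamma> + \<mu>)"
  using assms by (simp add: root_space_def leibniz br_scale_left br_scale_right rf_add scale_left_distrib)

lemma cartan_rs: "h \<in> cartan K \<Longrightarrow> h \<in> rs 0"
  by (simp add: root_space_def cartan_br rf_zero)

lemma e_rs: "i \<le> rk T \<Longrightarrow> chev_e K i \<in> rs (unit_root i)"
  by (simp add: root_space_def h_e rf_unit)

lemma f_rs: "i \<le> rk T \<Longrightarrow> chev_f K i \<in> rs (- unit_root i)"
  by (simp add: root_space_def h_f rf_unit rf_minus)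

lemma rs_dual: "root_space (dual K) T \<gamma> = rs (- \<gamma>)"
  by (simp add: root_space_def root_fun_def sum_negf)

lemma lattice_simps:
  "0 \<in> root_lattice T" "\<gamma> \<in> root_lattice T \<Longrightarrow> \<mu> \<in> root_lattice T \<Longrightarrow> \<gamma> + \<mu> \<in> root_lattice T"
  "\<gamma> \<in> root_lattice T \<Longrightarrow> - \<gamma> \<in> root_lattice T"
  "\<gamma> \<in> root_lattice T \<Longrightarrow> \<mu> \<in> root_lattice T \<Longrightarrow> \<gamma> - \<mu> \<in> root_lattice T"
  "i \<le> rk T \<Longrightarrow> unit_root i \<in> root_lattice T"
  by (auto simp: root_lattice_def unit_root_def)

lemma rf_separates:
  assumes "\<gamma> \<in> root_lattice T" "\<mu> \<in> root_lattice T" "\<gamma> \<noteq> \<mu>"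
  obtains h where "h \<in> cartan K" "rf \<gamma> h \<noteq> rf \<mu> h"
proof -
  have "\<exists>h\<in>cartan K. rf \<gamma> h \<noteq> rf \<mu> h"
  proof (rule ccontr)
    assume "\<not> ?thesis"
    then have "\<And>h. h \<in> cartan K \<Longrightarrow> (\<Sum>i\<le>rk T. of_int ((\<gamma> - \<mu>) i) * sroot K i h) = 0"
      using rf_diff[of \<gamma> \<mu>] by (simp add: root_fun_def)
    then have "of_int ((\<gamma> - \<mu>) i) = (0::complex)" if "i \<le> rk T" for i
      using sroot_indep[of "\<lambda>i. of_int ((\<gamma> - \<mu>) i)"] that by blast
    then have "\<gamma> i = \<mu> i" for i
      using assms(1,2) by (cases "i \<le> rk T") (auto simp: root_lattice_def)
    then show False using assms(3) by auto
  qed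
  then show thesis using that by blast
qed

text \<open>Subtracting from h its value on the weight \<nu> removes that summand and rescales the
  others, by a nonzero factor at \<mu> when h separates \<mu> from \<nu>.\<close>

lemma weight_independence:
  assumes "finite F" "F \<subseteq> root_lattice T" "\<And>\<mu>. \<mu> \<in> F \<Longrightarrow> y \<mu> \<in> rs \<mu>" "sum y F = 0" "\<mu> \<in> F"
  shows "y \<mu> = 0"
  using assms
proof (induction F arbitrary: y \<mu> rule: finite_induct)
  case (insert \<nu> F)
  have *: "y \<mu> = 0" if \<mu>: "\<mu> \<in> F" for \<mu>
  proof -
    have ne: "\<mu> \<noteq> \<nu>" using that insert.hyps by auto
    obtain h where h: "h \<in> cartan K" "rf \<mu> h \<noteq> rf \<nu> h"
      by (rule rf_separates[of \<mu> \<nu>]) (use insert.prems(1) \<mu> ne in auto)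
    let ?z = "\<lambda>\<mu>. scale K (rf \<mu> h - rf \<nu> h) (y \<mu>)"
    have "0 = lie K h (sum y (insert \<nu> F)) - scale K (rf \<nu> h) (sum y (insert \<nu> F))"
      by (simp add: insert.prems(3))
    also have "\<dots> = sum ?z (insert \<nu> F)"
      unfolding br_sum_right scale_sum_right sum_subtractf[symmetric]
      by (intro sum.cong) (auto simp: rs_mem[OF insert.prems(2) h(1)] scale_left_diff_distrib)
    finally have "sum ?z F = 0" using insert.hyps by simp
    then have "?z \<mu> = 0"
      using insert.IH[of ?z \<mu>] insert.prems that rs_subspace by (auto intro: subspace_scale)
    then show ?thesis using h by simp
  qed
  then have "y \<nu> = 0" using insert.prems(3) insert.hyps by simp
  then show ?case using * insert.prems(4) by auto
qed simp

text \<open>Vectors of distinct weights are independent, so all components of x of weight other than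
  \<gamma> cancel. This reads off root spaces from a spanning set of weight vectors.\<close>

lemma graded_span:
  assumes W: "\<And>\<mu>. \<mu> \<in> Q \<Longrightarrow> W \<mu> \<subseteq> rs \<mu>" and Q: "Q \<subseteq> root_lattice T" "\<gamma> \<in> root_lattice T"
    and x: "x \<in> rs \<gamma>" "x \<in> span (\<Union>\<mu>\<in>Q. W \<mu>)"
  shows "x \<in> span (if \<gamma> \<in> Q then W \<gamma> else {})"
proof -
  have "\<exists>F y. finite F \<and> F \<subseteq> Q \<and> (\<forall>\<mu>\<in>F. y \<mu> \<in> span (W \<mu>)) \<and> x = sum y F"
    using x(2)
  proof (induction rule: span_induct_alt)
    case base then show ?case by (intro exI[of _ "{}"]) auto
  next
    case (step c w x)
    then obtain F y \<mu> where F: "finite F" "F \<subseteq> Q" "\<forall>\<mu>\<in>F. y \<mu> \<in> span (W \<mu>)" "x = sum y F"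
      and \<mu>: "\<mu> \<in> Q" "w \<in> W \<mu>" by blast
    let ?y = "\<lambda>\<nu>. (if \<nu> \<in> F then y \<nu> else 0) + (if \<nu> = \<mu> then scale K c w else 0)"
    have "sum ?y (insert \<mu> F) = (\<Sum>\<nu>\<in>insert \<mu> F. if \<nu> \<in> F then y \<nu> else 0) + scale K c w"
      using F(1) by (simp add: sum.distrib sum.delta)
    also have "(\<Sum>\<nu>\<in>insert \<mu> F. if \<nu> \<in> F then y \<nu> else 0) = sum y F"
      using F(1) by (intro sum.mono_neutral_cong_right) auto
    finally have "scale K c w + x = sum ?y (insert \<mu> F)" using F(4) by simp
    moreover have "?y \<nu> \<in> span (W \<nu>)" if "\<nu> \<in> insert \<mu> F" for \<nu>
      by (rule span_add) (use F(3) \<mu> in \<open>simp_all add: span_scale span_base span_zero\<close>)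
    ultimately show ?case using F(1,2) \<mu>(1)
      by (intro exI[of _ "insert \<mu> F"] exI[of _ ?y] conjI ballI)
        (assumption | simp only: finite_insert insert_subset)+
  qed
  then obtain F y where F: "finite F" "F \<subseteq> Q" "\<forall>\<mu>\<in>F. y \<mu> \<in> span (W \<mu>)" "x = sum y F" by blast
  have y: "y \<mu> \<in> rs \<mu>" if "\<mu> \<in> F" for \<mu>
    by (rule subsetD[OF span_minimal[OF W[OF subsetD[OF F(2) that]] rs_subspace] bspec[OF F(3) that]])
  let ?z = "\<lambda>\<mu>. (if \<mu> \<in> F then y \<mu> else 0) - (if \<mu> = \<gamma> then x else 0)"
  have "sum ?z (insert \<gamma> F) = (\<Sum>\<nu>\<in>insert \<gamma> F. if \<nu> \<in> F then y \<nu> else 0) - x"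
    using F(1) by (simp add: sum_subtractf sum.delta)
  also have "(\<Sum>\<nu>\<in>insert \<gamma> F. if \<nu> \<in> F then y \<nu> else 0) = sum y F"
    using F(1) by (intro sum.mono_neutral_cong_right) auto
  finally have "sum ?z (insert \<gamma> F) = 0" using F(4) by simp
  moreover have "?z \<mu> \<in> rs \<mu>" for \<mu>
    by (rule subspace_diff[OF rs_subspace])
      (use y x(1) subspace_0[OF rs_subspace] in simp_all)
  ultimately have "?z \<gamma> = 0"
    using weight_independence[of "insert \<gamma> F" ?z \<gamma>] F(1,2) Q by auto
  then have "x = (if \<gamma> \<in> F then y \<gamma> else 0)" by simp
  then show ?thesis using F(2,3) by (cases "\<gamma> \<in> F") (auto simp: span_zero)
qed

end

section \<open>The triangular decomposition\<close>

text \<open>Iterated brackets with the e_i, together with their weight. Started at e_j they span the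
  positive half; started at a vector killed by all f_k they span an ideal.\<close>

inductive raised :: "('a::ab_group_add) km_data \<Rightarrow> twisted_type \<Rightarrow> root \<Rightarrow> 'a \<Rightarrow> root \<Rightarrow> 'a \<Rightarrow> bool"
  for K T \<gamma> v where
  start: "raised K T \<gamma> v \<gamma> v"
| raise: "raised K T \<gamma> v \<mu> x \<Longrightarrow> i \<le> rk T \<Longrightarrow>
    raised K T \<gamma> v (\<mu> + unit_root i) (lie K (chev_e K i) x)"

lemma raised_ge: "raised K T \<gamma> v \<mu> x \<Longrightarrow> \<gamma> i \<le> \<mu> i"
proof (induction rule: raised.induct)
  case (raise \<mu> x j)
  then show ?case using unit_root_nonneg[of j i] by simp
qed simp

lemma raised_outside: "raised K T \<gamma> v \<mu> x \<Longrightarrow> rk T < i \<Longrightarrow> \<mu> i = \<gamma> i"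
  by (induction rule: raised.induct) auto

context affine
begin

definition pos_words :: "root \<Rightarrow> 'a set" where
  "pos_words \<mu> = {x. \<exists>j\<le>rk T. raised K T (unit_root j) (chev_e K j) \<mu> x}"

lemma raised_rs: "raised K T \<gamma> v \<mu> x \<Longrightarrow> v \<in> rs \<gamma> \<Longrightarrow> x \<in> rs \<mu>"
proof (induction rule: raised.induct)
  case (raise \<mu> x i)
  have "lie K (chev_e K i) x \<in> rs (unit_root i + \<mu>)" by (rule rs_br[OF e_rs]) (use raise in auto)
  then show ?case by (subst add.commute)
qed

lemma pos_words_rs: "pos_words \<mu> \<subseteq> rs \<mu>"
  unfolding pos_words_def using raised_rs e_rs by blast

lemma pos_words_weight:
  assumes "x \<in> pos_words \<mu>" shows "0 \<le> \<mu> i" "\<mu> \<in> root_lattice T" "\<exists>i\<le>rk T. 0 < \<mu> i"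
proof -
  obtain j where j: "j \<le> rk T" "raised K T (unit_root j) (chev_e K j) \<mu> x"
    using assms by (auto simp: pos_words_def)
  have ge: "unit_root j i \<le> \<mu> i" for i by (rule raised_ge[OF j(2)])
  show "0 \<le> \<mu> i" using ge[of i] unit_root_nonneg[of j i] by linarith
  show "\<exists>i\<le>rk T. 0 < \<mu> i" using ge[of j] j(1) by (intro exI[of _ j]) simp
  show "\<mu> \<in> root_lattice T"
    using raised_outside[OF j(2)] j(1) by (auto simp: root_lattice_def)
qed

lemma pos_words_raise:
  assumes "x \<in> pos_words \<mu>" "i \<le> rk T"
  shows "lie K (chev_e K i) x \<in> pos_words (\<mu> + unit_root i)"
  using assms by (auto simp: pos_words_def intro: raised.raise)

lemma e_pos_words: "i \<le> rk T \<Longrightarrow> chev_e K i \<in> pos_words (unit_root i)"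
  by (auto simp: pos_words_def intro: raised.start)

text \<open>Commuting f_k past e_i leaves at most a coroot, which acts on x by a scalar; the step
  for f_k therefore also uses that x lies in S, and both memberships are proved together.\<close>

lemma f_raised:
  assumes "raised K T \<gamma> v \<mu> x" "v \<in> rs \<gamma>" "k \<le> rk T" "subspace S" "v \<in> S" "lie K (chev_f K k) v \<in> S"
    and step: "\<And>y i. y \<in> S \<Longrightarrow> i \<le> rk T \<Longrightarrow> lie K (chev_e K i) y \<in> S"
  shows "x \<in> S \<and> lie K (chev_f K k) x \<in> S"
  using assms(1)
proof (induction rule: raised.induct)
  case start then show ?case using assms by simp
next
  case (raise \<mu> x i)
  have xs: "x \<in> rs \<mu>" by (rule raised_rs[OF raise(1) assms(2)])
  have "lie K (chev_f K k) (lie K (chev_e K i) x) =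
      lie K (chev_e K i) (lie K (chev_f K k) x) - lie K (if i = k then scoroot K i else 0) x"
    using br_br_left[of "chev_e K i" "chev_f K k" x] e_f[OF raise(2) assms(3)] by simp
  moreover have "lie K (if i = k then scoroot K i else 0) x \<in> S"
    using rs_mem[OF xs coroot_cartan[OF raise(2)]] raise.IH assms(4)
    by (auto intro: subspace_scale subspace_0)
  ultimately show ?case using raise step assms(4) by (auto intro: subspace_diff)
qed

lemma span_ad_closed:
  assumes "\<And>w. w \<in> S \<Longrightarrow> lie K g w \<in> span S'" "x \<in> span S"
  shows "lie K g x \<in> span S'"
  using assms(2)
proof (induction rule: span_induct_alt)
  case (step c w y)
  then show ?case using assms(1)[of w] by (simp add: br_add_right br_scale_right span_add span_scale)
qed (simp add: span_zero)

definition words_span :: "'a set" where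
  "words_span = span (cartan K \<union> (\<Union>\<mu>. pos_words \<mu>))"

lemma words_span_base: "x \<in> cartan K \<Longrightarrow> x \<in> words_span" "x \<in> pos_words \<mu> \<Longrightarrow> x \<in> words_span"
  by (auto simp: words_span_def intro!: span_base)

lemma words_span_subspace: "subspace words_span"
  by (simp add: words_span_def)

lemma e_cartan: "i \<le> rk T \<Longrightarrow> h \<in> cartan K \<Longrightarrow> lie K (chev_e K i) h = scale K (- sroot K i h) (chev_e K i)"
  using rs_mem_right[OF e_rs] rf_unit by simp

lemma e_words_span: assumes "i \<le> rk T" "x \<in> words_span" shows "lie K (chev_e K i) x \<in> words_span"
  using assms(2) unfolding words_span_def
proof (rule span_ad_closed[rotated], unfold words_span_def[symmetric])
  fix w assume "w \<in> cartan K \<union> (\<Union>\<mu>. pos_words \<mu>)"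
  then consider "w \<in> cartan K" | \<mu> where "w \<in> pos_words \<mu>" by blast
  then show "lie K (chev_e K i) w \<in> words_span"
  proof cases
    case 1
    then show ?thesis unfolding e_cartan[OF assms(1) 1]
      by (intro subspace_scale[OF words_span_subspace] words_span_base(2)[OF e_pos_words[OF assms(1)]])
  next
    case 2
    then show ?thesis by (intro words_span_base(2)[OF pos_words_raise[OF 2 assms(1)]])
  qed
qed

lemma f_pos_words: assumes "k \<le> rk T" "x \<in> pos_words \<mu>" shows "lie K (chev_f K k) x \<in> words_span"
proof -
  obtain j where j: "j \<le> rk T" "raised K T (unit_root j) (chev_e K j) \<mu> x"
    using assms(2) by (auto simp: pos_words_def)
  have "lie K (chev_f K k) (chev_e K j) = - (if j = k then scoroot K j else 0)"
    using br_anti[of "chev_f K k"] e_f[OF j(1) assms(1)] by simp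
  then have "lie K (chev_f K k) (chev_e K j) \<in> words_span"
    using subspace_neg[OF words_span_subspace words_span_base(1)[OF coroot_cartan[OF j(1)]]]
      subspace_0[OF words_span_subspace] by (cases "j = k") simp_all
  then show ?thesis
    using f_raised[OF j(2) e_rs[OF j(1)] assms(1) words_span_subspace
        words_span_base(2)[OF e_pos_words[OF j(1)]] _ e_words_span] by blast
qed

abbreviation neg_words :: "root \<Rightarrow> 'a set" where
  "neg_words \<equiv> affine.pos_words (dual K) T"

lemma dual_e_words:
  assumes "k \<le> rk T" "x \<in> neg_words \<mu>"
  shows "lie K (chev_e K k) x \<in> span (cartan K \<union> (\<Union>\<mu>. neg_words \<mu>))"
  using affine.f_pos_words[OF affine_dual assms] affine.words_span_def[OF affine_dual] by simp

lemma neg_words_weight: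
  assumes "x \<in> neg_words \<mu>" shows "0 \<le> \<mu> i" "\<mu> \<in> root_lattice T" "\<exists>i\<le>rk T. 0 < \<mu> i" "x \<in> rs (- \<mu>)"
  using affine.pos_words_weight[OF affine_dual assms] affine.pos_words_rs[OF affine_dual, of \<mu>] assms
  by (auto simp: rs_dual)

text \<open>The span is stable under all generators, the lowering ones on positive words by
  \<open>f_pos_words\<close> and the raising ones on negative words by duality. An ideal that
  contains the generators is everything.\<close>

lemma triangular: "span (cartan K \<union> (\<Union>\<mu>. pos_words \<mu>) \<union> (\<Union>\<mu>. neg_words \<mu>)) = UNIV"
proof -
  let ?G = "cartan K \<union> (\<Union>\<mu>. pos_words \<mu>) \<union> (\<Union>\<mu>. neg_words \<mu>)"
  let ?S = "span ?G"
  have pos: "words_span \<subseteq> ?S" unfolding words_span_def by (rule span_mono) auto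
  have neg: "span (cartan K \<union> (\<Union>\<mu>. neg_words \<mu>)) \<subseteq> ?S" by (rule span_mono) auto
  have hS: "h \<in> ?S" if "h \<in> cartan K" for h using that by (intro span_base) auto
  have fS: "chev_f K i \<in> neg_words (unit_root i)" if "i \<le> rk T" for i
    using affine.e_pos_words[OF affine_dual that] by simp
  have fw: "w \<in> ?S" if "w \<in> neg_words \<mu>" for w \<mu> using that by (intro span_base) auto
  have weight: "lie K h w \<in> ?S" if "h \<in> cartan K" "w \<in> rs \<mu>" "w \<in> ?S" for h w \<mu>
    unfolding rs_mem[OF that(2,1)] by (rule span_scale[OF that(3)])
  have "lie K g x \<in> ?S" if g: "g \<in> cartan K \<union> chev_e K ` {..rk T} \<union> chev_f K ` {..rk T}" and x: "x \<in> ?S" for g x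
  proof (rule span_ad_closed[OF _ x])
    fix w assume w: "w \<in> ?G"
    then consider "w \<in> cartan K" | \<mu> where "w \<in> pos_words \<mu>" | \<mu> where "w \<in> neg_words \<mu>" by blast
    note w_cases = this
    consider "g \<in> cartan K" | i where "i \<le> rk T" "g = chev_e K i" | i where "i \<le> rk T" "g = chev_f K i"
      using g by blast
    then show "lie K g w \<in> ?S"
    proof cases
      case 1
      have "\<exists>\<mu>. w \<in> rs \<mu>"
        using w_cases by cases (use cartan_rs pos_words_rs neg_words_weight(4) in blast)+
      then show ?thesis using weight[OF 1 _ span_base[OF w]] by blast
    next
      case e: 2
      show ?thesis
        using w_cases
      proof cases
        case 1 then show ?thesis using e_words_span[OF e(1) words_span_base(1)] pos e(2) by auto
      next
        case 2 then show ?thesis using e_words_span[OF e(1) words_span_base(2)] pos e(2) by blast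
      next
        case 3 then show ?thesis using dual_e_words[OF e(1)] neg e(2) by blast
      qed
    next
      case f: 3
      show ?thesis
        using w_cases
      proof cases
        case 1 then show ?thesis
          using rs_mem_right[OF f_rs[OF f(1)] 1] span_scale[OF fw[OF fS[OF f(1)]]] f(2)
          by (simp del: scale_minus_left)
      next
        case 2 then show ?thesis using f_pos_words[OF f(1)] pos f(2) by blast
      next
        case 3
        then show ?thesis using affine.pos_words_raise[OF affine_dual _ f(1)] fw f(2) by fastforce
      qed
    qed
  qed
  then have "lie_ideal K ?S" by (intro lie_ideal_of_generators) auto
  then have ideal: "lie K y z \<in> ?S" if "z \<in> ?S" for y z using that by (auto simp: lie_ideal_def)
  show ?thesis
  proof (rule generated_UNIV)
    show "cartan K \<union> chev_e K ` {..rk T} \<union> chev_f K ` {..rk T} \<subseteq> ?S"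
      using hS words_span_base(2)[OF e_pos_words] pos fw[OF fS] by blast
  qed (use ideal in auto)
qed

lemma root_space_words:
  assumes "x \<in> rs \<gamma>" "\<gamma> \<in> root_lattice T"
  shows "x \<in> span (if \<gamma> = 0 then cartan K else pos_words \<gamma> \<union> neg_words (- \<gamma>))"
proof -
  let ?W = "\<lambda>\<mu>. if \<mu> = 0 then cartan K else pos_words \<mu> \<union> neg_words (- \<mu>)"
  have "cartan K \<union> (\<Union>\<mu>. pos_words \<mu>) \<union> (\<Union>\<mu>. neg_words \<mu>) \<subseteq> (\<Union>\<mu>\<in>root_lattice T. ?W \<mu>)"
  proof (intro Un_least UN_least subsetI)
    fix w assume "w \<in> cartan K"
    then show "w \<in> (\<Union>\<mu>\<in>root_lattice T. ?W \<mu>)"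
      by (intro UN_I[of 0]) (auto simp: lattice_simps)
  next
    fix \<mu> w assume w: "w \<in> pos_words \<mu>"
    then have "\<mu> \<noteq> 0" using pos_words_weight(3)[OF w] by auto
    then show "w \<in> (\<Union>\<mu>\<in>root_lattice T. ?W \<mu>)"
      using w pos_words_weight(2)[OF w] by (intro UN_I[of \<mu>]) auto
  next
    fix \<mu> w assume w: "w \<in> neg_words \<mu>"
    then have "- \<mu> \<noteq> 0" using neg_words_weight(3)[OF w] by auto
    then show "w \<in> (\<Union>\<mu>\<in>root_lattice T. ?W \<mu>)"
      using w neg_words_weight(2)[OF w] by (intro UN_I[of "- \<mu>"]) (auto simp: lattice_simps)
  qed
  from span_mono[OF this] have x: "x \<in> span (\<Union>\<mu>\<in>root_lattice T. ?W \<mu>)"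
    unfolding triangular by blast
  have "?W \<mu> \<subseteq> rs \<mu>" for \<mu>
    using cartan_rs pos_words_rs[of \<mu>] neg_words_weight(4)[of _ "- \<mu>"] by auto
  from graded_span[OF this order_refl assms(2,1) x] assms(2) show ?thesis by simp
qed

lemma roots_words: assumes "\<gamma> \<in> roots K T" shows "pos_words \<gamma> \<noteq> {} \<or> neg_words (- \<gamma>) \<noteq> {}"
proof (rule ccontr)
  assume empty: "\<not> ?thesis"
  have \<gamma>: "\<gamma> \<in> root_lattice T" "\<gamma> \<noteq> 0" "rs \<gamma> \<noteq> {0}" using assms by (auto simp: roots_def zero_fun_def)
  have "rs \<gamma> \<subseteq> {0}" using root_space_words[of _ \<gamma>] \<gamma> empty by auto
  then show False using \<gamma>(3) subspace_0[OF rs_subspace] by blast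
qed

lemma roots_sign: assumes "\<gamma> \<in> roots K T" shows "(\<forall>i. 0 \<le> \<gamma> i) \<or> (\<forall>i. \<gamma> i \<le> 0)"
proof -
  consider x where "x \<in> pos_words \<gamma>" | x where "x \<in> neg_words (- \<gamma>)" using roots_words[OF assms] by blast
  then show ?thesis
  proof cases
    case 1 then show ?thesis using pos_words_weight(1)[OF 1] by blast
  next
    case 2
    have "\<gamma> i \<le> 0" for i using neg_words_weight(1)[OF 2, of i] by simp
    then show ?thesis by blast
  qed
qed

text \<open>A word whose weight is supported at node i involves e_i only, and [e_i, e_i] = 0 kills
  all words of length at least two.\<close>

lemma raised_simple:
  assumes "raised K T (unit_root j) (chev_e K j) \<mu> x" "\<And>k. k \<noteq> i \<Longrightarrow> \<mu> k = 0"
  shows "x = 0 \<or> \<mu> = unit_root i \<and> x = chev_e K i"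
  using assms
proof (induction rule: raised.induct)
  case start
  then have "j = i" using unit_root_simps(1)[of j] by fastforce
  then show ?case by simp
next
  case (raise \<mu> x k)
  have ge: "0 \<le> \<mu> l" for l using raised_ge[OF raise(1), of l] unit_root_nonneg[of j l] by linarith
  have k: "k = i"
  proof (rule ccontr)
    assume "k \<noteq> i"
    then show False using raise.prems[of k] ge[of k] by simp
  qed
  have "\<mu> l = 0" if "l \<noteq> i" for l using raise.prems[of l] that k by simp
  from raise.IH[OF this] show ?case using br_self k by auto
qed

lemma root_multiple_simple:
  assumes "\<gamma> \<in> roots K T" "\<And>k. k \<noteq> i \<Longrightarrow> \<gamma> k = 0" "0 \<le> \<gamma> i"
  shows "\<gamma> = unit_root i"
proof (rule ccontr)
  assume ne: "\<gamma> \<noteq> unit_root i"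
  have \<gamma>: "\<gamma> \<in> root_lattice T" "\<gamma> \<noteq> 0" "rs \<gamma> \<noteq> {0}" using assms by (auto simp: roots_def zero_fun_def)
  have "w = 0" if "w \<in> pos_words \<gamma>" for w
  proof -
    obtain j where "raised K T (unit_root j) (chev_e K j) \<gamma> w"
      using \<open>w \<in> pos_words \<gamma>\<close> by (auto simp: pos_words_def)
    from raised_simple[OF this assms(2)] show ?thesis using ne by blast
  qed
  moreover have "neg_words (- \<gamma>) = {}"
  proof (rule ccontr)
    assume "neg_words (- \<gamma>) \<noteq> {}"
    then obtain w where w: "w \<in> neg_words (- \<gamma>)" by blast
    then obtain k where "0 < (- \<gamma>) k" using neg_words_weight(3) by blast
    then show False using assms(2)[of k] assms(3) by (cases "k = i") auto
  qed
  ultimately have "rs \<gamma> \<subseteq> span {0}"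
    using root_space_words[of _ \<gamma>] \<gamma> span_mono[of "pos_words \<gamma>" "{0}"] by auto
  then show False using \<gamma>(3) subspace_0[OF rs_subspace[of \<gamma>]] by auto
qed

text \<open>The vectors raised from \<open>v\<close> span an ideal that meets the Cartan subalgebra trivially.\<close>

lemma highest_vector_zero:
  assumes "v \<in> rs \<gamma>" "\<gamma> \<in> root_lattice T" "\<And>i. 0 \<le> \<gamma> i" "\<gamma> \<noteq> 0"
    and f: "\<And>k. k \<le> rk T \<Longrightarrow> lie K (chev_f K k) v = 0"
  shows "v = 0"
proof -
  let ?W = "\<lambda>\<mu>. {x. raised K T \<gamma> v \<mu> x}"
  let ?S = "span (\<Union>\<mu>. ?W \<mu>)"
  have base: "x \<in> ?S" if "raised K T \<gamma> v \<mu> x" for \<mu> x using that by (intro span_base) auto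
  have e: "lie K (chev_e K i) y \<in> ?S" if "y \<in> ?S" "i \<le> rk T" for y i
    by (rule span_ad_closed[OF _ that(1)]) (use base raised.raise that(2) in blast)
  have "lie_ideal K ?S"
  proof (rule lie_ideal_of_generators)
    fix g x assume g: "g \<in> cartan K \<union> chev_e K ` {..rk T} \<union> chev_f K ` {..rk T}" and x: "x \<in> ?S"
    consider "g \<in> cartan K" | i where "i \<le> rk T" "g = chev_e K i" | i where "i \<le> rk T" "g = chev_f K i"
      using g by blast
    then show "lie K g x \<in> ?S"
    proof cases
      case 1
      show ?thesis
      proof (rule span_ad_closed[OF _ x])
        fix w assume "w \<in> (\<Union>\<mu>. ?W \<mu>)"
        then obtain \<mu> where w: "raised K T \<gamma> v \<mu> w" by blast
        show "lie K g w \<in> ?S"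
          unfolding rs_mem[OF raised_rs[OF w assms(1)] 1] by (rule span_scale[OF base[OF w]])
      qed
    next
      case 2 then show ?thesis using e[OF x] by simp
    next
      case 3
      have "lie K (chev_f K i) v \<in> ?S" using f[OF 3(1)] span_zero by simp
      note fr = f_raised[OF _ assms(1) 3(1) subspace_span base[OF raised.start] this e]
      show ?thesis unfolding 3(2) by (rule span_ad_closed[OF _ x]) (use fr in blast)
    qed
  qed auto
  moreover have "?S \<inter> cartan K = {0}"
  proof -
    have "x = 0" if "x \<in> ?S" "x \<in> cartan K" for x
    proof -
      \<comment> \<open>Weights only grow from the nonnegative, nonzero \<gamma>, so weight 0, that
        of the Cartan subalgebra, is never met.\<close>
      let ?Q = "{\<mu> \<in> root_lattice T. \<mu> \<noteq> 0}"
      have "(\<Union>\<mu>. ?W \<mu>) \<subseteq> (\<Union>\<mu>\<in>?Q. ?W \<mu>)"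
      proof
        fix w assume "w \<in> (\<Union>\<mu>. ?W \<mu>)"
        then obtain \<mu> where w: "raised K T \<gamma> v \<mu> w" by blast
        obtain i where "\<gamma> i \<noteq> 0" using assms(4) by (auto simp: fun_eq_iff)
        then have "\<mu> \<noteq> 0" using raised_ge[OF w, of i] assms(3)[of i] by auto
        moreover have "\<mu> \<in> root_lattice T"
          using raised_outside[OF w] assms(2) by (auto simp: root_lattice_def)
        ultimately show "w \<in> (\<Union>\<mu>\<in>?Q. ?W \<mu>)" using w by blast
      qed
      from subsetD[OF span_mono[OF this] that(1)] have x: "x \<in> span (\<Union>\<mu>\<in>?Q. ?W \<mu>)" .
      have "?W \<mu> \<subseteq> rs \<mu>" for \<mu> using raised_rs assms(1) by blast
      from graded_span[OF this _ lattice_simps(1) cartan_rs[OF that(2)] x] show "x = 0" by auto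
    qed
    then show ?thesis using subspace_0[OF cartan_subspace] span_zero by blast
  qed
  ultimately have "?S = {0}" by (rule no_ideal)
  then show ?thesis using base[OF raised.start] by blast
qed

end

section \<open>Integrability and the Weyl group\<close>

context complex_lie_algebra
begin

lemma locnil_subspace: "subspace (locnil a)"
  by (rule subspaceI) (simp_all only: locnil_zero locnil_add locnil_scale)

lemma ad_pow_commute: "br b a = 0 \<Longrightarrow> br b ((br a ^^ m) x) = (br a ^^ m) (br b x)"
proof (induction m)
  case (Suc m)
  then show ?case using br_br_left[of b a "(br a ^^ m) x"] by simp
qed simp

lemma ad_pow_br: "(br a ^^ m) (br a x) = (br a ^^ Suc m) x"
  by (simp add: funpow_swap1)

lemma ad_exp_1: assumes "br a x = 0" shows "ad_exp a x = x"
proof -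
  have "(br a ^^ 1) x = 0" using assms by simp
  from ad_exp_eq[OF this] show ?thesis by (simp add: dpow_simps)
qed

lemma ad_exp_2: assumes "br a (br a x) = 0" shows "ad_exp a x = x + br a x"
proof -
  have "(br a ^^ 2) x = 0" using assms by (simp add: numeral_2_eq_2)
  from ad_exp_eq[OF this] show ?thesis by (simp add: numeral_2_eq_2 dpow_def)
qed

lemma ad_exp_3:
  assumes "br a (br a (br a x)) = 0" shows "ad_exp a x = x + br a x + sc (1 / 2) (br a (br a x))"
proof -
  have "(br a ^^ 3) x = 0" using assms by (simp add: numeral_3_eq_3)
  from ad_exp_eq[OF this] show ?thesis by (simp add: numeral_3_eq_3 dpow_def)
qed

lemma locnil_uminus: "x \<in> locnil a \<Longrightarrow> x \<in> locnil (- a)"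
proof -
  have pow: "(br (- a) ^^ N) x = (br a ^^ N) x \<or> (br (- a) ^^ N) x = - (br a ^^ N) x" for N
    by (induction N) auto
  assume "x \<in> locnil a"
  then obtain N where "(br a ^^ N) x = 0" unfolding locnil_def by blast
  then have "(br (- a) ^^ N) x = 0" using pow[of N] by auto
  then show ?thesis unfolding locnil_def by blast
qed

end

context affine
begin

lemma rf_unit_coroot: "i \<le> rk T \<Longrightarrow> j \<le> rk T \<Longrightarrow> rf (unit_root j) (scoroot K i) = of_int (gcm T i j)"
  by (simp add: rf_unit sroot_coroot)

lemma ad_e_pow_rs:
  assumes "i \<le> rk T" "x \<in> rs \<gamma>" shows "(lie K (chev_e K i) ^^ m) x \<in> rs (\<gamma> + mul (int m) (unit_root i))"
proof (induction m)
  case 0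
  have "\<gamma> + mul (int 0) (unit_root i) = \<gamma>" by (rule ext) simp
  then show ?case using assms(2) by (simp only: funpow_0)
next
  case (Suc m)
  have "unit_root i + (\<gamma> + mul (int m) (unit_root i)) = \<gamma> + mul (int (Suc m)) (unit_root i)"
    by (rule ext) (simp add: algebra_simps)
  then show ?case using rs_br[OF e_rs[OF assms(1)] Suc] by (simp only: funpow.simps o_apply)
qed

text \<open>For the sl_2 of node i, e_j is a lowest weight vector of weight a_ij, and the
  coefficient vanishes at m = - a_ij.\<close>

lemma f_e_pow:
  assumes i: "i \<le> rk T" and j: "j \<le> rk T" and ij: "i \<noteq> j"
  shows "lie K (chev_f K i) ((lie K (chev_e K i) ^^ Suc m) (chev_e K j)) =
    scale K (- of_nat (Suc m) * (of_int (gcm T i j) + of_nat m)) ((lie K (chev_e K i) ^^ m) (chev_e K j))"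
proof (induction m)
  case 0
  have "lie K (chev_f K i) (chev_e K j) = 0"
    using e_f[OF j i] ij br_anti[of "chev_f K i" "chev_e K j"] by simp
  moreover have "lie K (chev_f K i) (chev_e K i) = - scoroot K i"
    using e_f[OF i i] br_anti[of "chev_f K i" "chev_e K i"] by simp
  ultimately show ?case
    using leibniz[of "chev_f K i" "chev_e K i" "chev_e K j"] rs_mem[OF e_rs[OF j] coroot_cartan[OF i]]
      rf_unit_coroot[OF i j] by simp
next
  case (Suc m)
  let ?E = "lie K (chev_e K i)" and ?y = "(lie K (chev_e K i) ^^ Suc m) (chev_e K j)"
  have fe: "lie K (chev_f K i) (chev_e K i) = - scoroot K i"
    using e_f[OF i i] br_anti[of "chev_f K i" "chev_e K i"] by simp
  have "rf (unit_root j + mul (int (Suc m)) (unit_root i)) (scoroot K i)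
      = of_int (gcm T i j) + 2 * of_nat (Suc m)"
    unfolding rf_add mul_def rf_mult rf_unit_coroot[OF i j] rf_unit_coroot[OF i i] by simp
  then have h: "lie K (scoroot K i) ?y = scale K (of_int (gcm T i j) + 2 * of_nat (Suc m)) ?y"
    using rs_mem[OF ad_e_pow_rs[OF i e_rs[OF j], of "Suc m"] coroot_cartan[OF i]] by (simp only:)
  have "lie K (chev_f K i) ((?E ^^ Suc (Suc m)) (chev_e K j)) = lie K (chev_f K i) (?E ?y)" by simp
  also have "\<dots> = - lie K (scoroot K i) ?y + ?E (lie K (chev_f K i) ?y)"
    using leibniz[of "chev_f K i" "chev_e K i" ?y] fe by simp
  also have "\<dots> = scale K (- (of_int (gcm T i j) + 2 * of_nat (Suc m))
      + (- of_nat (Suc m) * (of_int (gcm T i j) + of_nat m))) ?y"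
    unfolding h Suc br_scale_right scale_left_distrib scale_minus_left by simp
  also have "- (of_int (gcm T i j) + 2 * of_nat (Suc m)) + (- of_nat (Suc m) * (of_int (gcm T i j) + of_nat m))
     = - of_nat (Suc (Suc m)) * (of_int (gcm T i j) + of_nat (Suc m) :: complex)"
    by (simp add: algebra_simps)
  finally show ?case .
qed

text \<open>All f_k kill this vector, so \<open>highest_vector_zero\<close> applies: f_i by the
  coefficient in \<open>f_e_pow\<close>, and f_j because it turns e_j into a coroot, which ad e_i
  kills after two steps, or after one if a_ij = 0.\<close>

lemma serre:
  assumes i: "i \<le> rk T" and j: "j \<le> rk T" and ij: "i \<noteq> j"
  shows "(lie K (chev_e K i) ^^ Suc (nat (- gcm T i j))) (chev_e K j) = 0"
proof -
  let ?m = "nat (- gcm T i j)" and ?E = "lie K (chev_e K i)"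
  let ?v = "(?E ^^ Suc ?m) (chev_e K j)"
  have m: "of_int (gcm T i j) + of_nat ?m = (0::complex)"
  proof -
    have "gcm T i j + int ?m = 0" using gcm_nonpos[OF ij, of T] by simp
    then show ?thesis by (metis of_int_0 of_int_add of_int_of_nat_eq)
  qed
  show ?thesis
  proof (rule highest_vector_zero[of ?v "unit_root j + mul (int (Suc ?m)) (unit_root i)"])
    show "?v \<in> rs (unit_root j + mul (int (Suc ?m)) (unit_root i))" by (rule ad_e_pow_rs[OF i e_rs[OF j]])
    show "unit_root j + mul (int (Suc ?m)) (unit_root i) \<in> root_lattice T"
      using i j by (auto simp: root_lattice_def)
    show "0 \<le> (unit_root j + mul (int (Suc ?m)) (unit_root i)) k" for k
      using unit_root_nonneg[of j k] unit_root_nonneg[of i k] by simp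
    show "unit_root j + mul (int (Suc ?m)) (unit_root i) \<noteq> 0"
    proof
      assume "unit_root j + mul (int (Suc ?m)) (unit_root i) = 0"
      from fun_cong[OF this, of j] show False using ij by simp
    qed
  next
    fix k assume k: "k \<le> rk T"
    show "lie K (chev_f K k) ?v = 0"
    proof (cases "k = i")
      case True
      show ?thesis unfolding True f_e_pow[OF i j ij] m by simp
    next
      case False
      have "lie K (chev_f K k) (chev_e K i) = 0"
        using e_f[OF i k] False br_anti[of "chev_f K k" "chev_e K i"] by simp
      then have eq: "lie K (chev_f K k) ?v = (?E ^^ Suc ?m) (lie K (chev_f K k) (chev_e K j))"
        by (rule ad_pow_commute)
      have fe: "lie K (chev_f K k) (chev_e K j) = - (if j = k then scoroot K j else 0)"
        using e_f[OF j k] br_anti[of "chev_f K k" "chev_e K j"] by simp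
      have Eh: "?E (- scoroot K j) = scale K (of_int (gcm T j i)) (chev_e K i)"
        using e_cartan[OF i coroot_cartan[OF j]] sroot_coroot[OF j i] by simp
      have "(?E ^^ Suc ?m) (- scoroot K j) = 0"
      proof (cases "gcm T i j = 0")
        case True
        then have "gcm T j i = 0" by (rule gcm_zero[OF valid i j])
        then have "?E (- scoroot K j) = 0" using Eh by simp
        moreover have "Suc ?m = 1" using True by simp
        ultimately show ?thesis by (simp only: funpow.simps One_nat_def o_apply id_apply)
      next
        case False
        have "(?E ^^ 2) (- scoroot K j) = 0"
          by (simp only: numeral_2_eq_2 funpow.simps o_apply id_apply Eh br_scale_right br_self scale_zero_right)
        moreover have "2 \<le> Suc ?m" using False gcm_nonpos[OF ij, of T] by simp
        ultimately show ?thesis by (rule ad_pow_mono)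
      qed
      then show ?thesis unfolding eq fe by (cases "j = k") (simp_all only: simp_thms if_True if_False minus_zero ad_pow_linear)
    qed
  qed
qed

text \<open>Locally nilpotent vectors form a subalgebra, and it contains the generators: e_j by the
  Serre relations, the Cartan subalgebra after two steps, f_i after three.\<close>

lemma e_locnil: assumes i: "i \<le> rk T" shows "x \<in> locnil (chev_e K i)"
proof -
  let ?E = "lie K (chev_e K i)"
  have nil: "y \<in> locnil (chev_e K i)" if "(?E ^^ N) y = 0" for y N
    using that unfolding locnil_def by blast
  have "locnil (chev_e K i) = UNIV"
  proof (rule generated_UNIV[OF locnil_subspace])
    show "lie K y z \<in> locnil (chev_e K i)" if "y \<in> locnil (chev_e K i)" "z \<in> locnil (chev_e K i)" for y z
      using that by (rule locnil_add)
    show "cartan K \<union> chev_e K ` {..rk T} \<union> chev_f K ` {..rk T} \<subseteq> locnil (chev_e K i)"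
    proof
      fix g assume g: "g \<in> cartan K \<union> chev_e K ` {..rk T} \<union> chev_f K ` {..rk T}"
      have cart: "(?E ^^ 2) h = 0" if "h \<in> cartan K" for h
        using e_cartan[OF i that] by (simp add: numeral_2_eq_2 br_scale_right br_self)
      consider "g \<in> cartan K" | j where "j \<le> rk T" "g = chev_e K j" | j where "j \<le> rk T" "g = chev_f K j"
        using g by blast
      then show "g \<in> locnil (chev_e K i)"
      proof cases
        case 1 then show ?thesis by (intro nil[OF cart])
      next
        case 2
        show ?thesis
        proof (cases "j = i")
          case True
          then have "(?E ^^ 1) g = 0" using 2 by (simp add: br_self)
          then show ?thesis by (rule nil)
        next
          case False
          then show ?thesis using nil[OF serre[OF i 2(1)]] 2(2) by auto
        qed
      next
        case 3
        show ?thesis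
        proof (cases "j = i")
          case True
          then have "(?E ^^ 2) (?E g) = 0" using cart[OF coroot_cartan[OF i]] 3 e_f[OF i i] by simp
          then have "(?E ^^ Suc 2) g = 0" by (simp only: ad_pow_br)
          then show ?thesis by (rule nil)
        next
          case False
          then have "(?E ^^ 1) g = 0" using 3 e_f[OF i 3(1)] by simp
          then show ?thesis by (rule nil)
        qed
      qed
    qed
  qed
  then show ?thesis by simp
qed

lemma f_locnil: "i \<le> rk T \<Longrightarrow> x \<in> locnil (chev_f K i)"
  using affine.e_locnil[OF affine_dual, of i x] by simp

definition tau :: "nat \<Rightarrow> 'a \<Rightarrow> 'a" where
  "tau i x = ad_exp (chev_e K i) (ad_exp (- chev_f K i) (ad_exp (chev_e K i) x))"

lemma exp_e_hom: assumes "i \<le> rk T"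
  shows "ad_exp (chev_e K i) (x + y) = ad_exp (chev_e K i) x + ad_exp (chev_e K i) y"
    "ad_exp (chev_e K i) (scale K c x) = scale K c (ad_exp (chev_e K i) x)"
    "ad_exp (chev_e K i) (lie K x y) = lie K (ad_exp (chev_e K i) x) (ad_exp (chev_e K i) y)"
    "ad_exp (chev_e K i) x = 0 \<Longrightarrow> x = 0"
  by (rule locnil_add locnil_scale ad_exp_inj, (rule e_locnil[OF assms])+, assumption?)+

lemma exp_f_hom: assumes "i \<le> rk T"
  shows "ad_exp (- chev_f K i) (x + y) = ad_exp (- chev_f K i) x + ad_exp (- chev_f K i) y"
    "ad_exp (- chev_f K i) (scale K c x) = scale K c (ad_exp (- chev_f K i) x)"
    "ad_exp (- chev_f K i) (lie K x y) = lie K (ad_exp (- chev_f K i) x) (ad_exp (- chev_f K i) y)"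
    "ad_exp (- chev_f K i) x = 0 \<Longrightarrow> x = 0"
  by (rule locnil_add locnil_scale ad_exp_inj, (rule locnil_uminus[OF f_locnil[OF assms]])+, assumption?)+

lemma tau_hom: assumes "i \<le> rk T"
  shows "tau i (x + y) = tau i x + tau i y" "tau i (scale K c x) = scale K c (tau i x)"
    "tau i (lie K x y) = lie K (tau i x) (tau i y)" "tau i x = 0 \<Longrightarrow> x = 0"
  unfolding tau_def exp_e_hom(1-3)[OF assms] exp_f_hom(1-3)[OF assms]
  by (rule refl | (drule exp_e_hom(4)[OF assms] exp_f_hom(4)[OF assms])+, assumption)+

lemma tau_cartan:
  assumes i: "i \<le> rk T" and h: "h \<in> cartan K"
  shows "tau i h = h - scale K (sroot K i h) (scoroot K i)"
proof -
  let ?e = "chev_e K i" and ?f = "chev_f K i" and ?h = "scoroot K i" and ?a = "sroot K i h"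
  note hc = coroot_cartan[OF i]
  have aii: "sroot K i ?h = 2" using sroot_coroot[OF i i] by simp
  have e_h: "lie K ?e k = - scale K (sroot K i k) ?e" if "k \<in> cartan K" for k
    using e_cartan[OF i that] by simp
  have f_h: "lie K ?f k = scale K (sroot K i k) ?f" if "k \<in> cartan K" for k
    using rs_mem_right[OF f_rs[OF i] that] rf_unit[OF i] by (simp add: rf_minus)
  have fe: "lie K ?f ?e = - ?h" using e_f[OF i i] br_anti[of ?f ?e] by simp
  have ef: "lie K ?e ?f = ?h" using e_f[OF i i] by simp
  have exp_e_h: "ad_exp ?e k = k - scale K (sroot K i k) ?e" if "k \<in> cartan K" for k
    using ad_exp_2[of ?e k] e_h[OF that] by (simp add: br_scale_right br_self)
  have exp_e_e: "ad_exp ?e ?e = ?e" by (rule ad_exp_1) (rule br_self)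
  have exp_f_h: "ad_exp (- ?f) k = k - scale K (sroot K i k) ?f" if "k \<in> cartan K" for k
    using ad_exp_2[of "- ?f" k] f_h[OF that] by (simp add: br_scale_right br_self)
  \<comment> \<open>The terms are e, [-f, e] = h, and half of [-f, h] = -2 f.\<close>
  have exp_f_e: "ad_exp (- ?f) ?e = ?e + ?h - ?f"
  proof -
    have "lie K (- ?f) ?e = ?h" using fe by simp
    moreover have "lie K (- ?f) ?h = scale K (- 2) ?f" using f_h[OF hc] aii by simp
    moreover have "lie K (- ?f) (scale K (- 2) ?f) = 0" by (simp add: br_scale_right br_self)
    ultimately show ?thesis using ad_exp_3[of "- ?f" ?e] by simp
  qed
  have "tau i h = ad_exp ?e (ad_exp (- ?f) (h + scale K (- ?a) ?e))"
    unfolding tau_def exp_e_h[OF h] by simp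
  also have "\<dots> = ad_exp ?e (h + scale K (- ?a) ?h + scale K (- ?a) ?e)"
    unfolding exp_f_hom(1,2)[OF i] exp_f_h[OF h] exp_f_e by (simp add: algebra_simps scale_right_diff_distrib scale_right_distrib)
  also have "\<dots> = h - scale K ?a ?h"
    unfolding exp_e_hom(1,2)[OF i] exp_e_h[OF h] exp_e_h[OF hc] exp_e_e aii
    by (simp add: algebra_simps scale_right_diff_distrib scale_right_distrib)
      (simp add: scale_left_distrib[symmetric])
  finally show ?thesis .
qed

lemma tau_cartan_mem: "i \<le> rk T \<Longrightarrow> h \<in> cartan K \<Longrightarrow> tau i h \<in> cartan K"
  unfolding tau_cartan by (intro subspace_diff[OF cartan_subspace] subspace_scale[OF cartan_subspace] coroot_cartan)

lemma rf_tau: assumes "i \<le> rk T" "h \<in> cartan K" shows "rf \<gamma> (tau i h) = rf (reflect T i \<gamma>) h"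
proof -
  have "tau i h = h + scale K (- sroot K i h) (scoroot K i)" using tau_cartan[OF assms] by simp
  then have "rf \<gamma> (tau i h) = rf \<gamma> h + (- sroot K i h) * rf \<gamma> (scoroot K i)"
    using rf_lin(1)[OF assms(2) subspace_scale[OF cartan_subspace coroot_cartan[OF assms(1)]]]
      rf_lin(2)[OF coroot_cartan[OF assms(1)]] by (simp only:)
  also have "\<dots> = rf (reflect T i \<gamma>) h"
    unfolding reflect_eq rf_diff mul_def rf_mult rf_unit[OF assms(1)] rf_coroot[OF assms(1)] pair_def
    by simp
  finally show ?thesis .
qed

lemma tau_tau_cartan: assumes "i \<le> rk T" "h \<in> cartan K" shows "tau i (tau i h) = h"
proof -
  have "sroot K i (tau i h) = - sroot K i h"
    using rf_tau[OF assms, of "unit_root i"] reflect_unit[OF assms(1)] rf_unit[OF assms(1)]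
    by (simp add: rf_minus)
  then show ?thesis
    using tau_cartan[OF assms(1) tau_cartan_mem[OF assms]] tau_cartan[OF assms] by simp
qed

text \<open>On the Cartan subalgebra \<open>tau i\<close> is an involution, so h can be written as
  tau (tau h) and pulled inside the homomorphism.\<close>

lemma tau_rs: assumes i: "i \<le> rk T" and x: "x \<in> rs \<gamma>" shows "tau i x \<in> rs (reflect T i \<gamma>)"
  unfolding root_space_def
proof (intro CollectI ballI)
  fix h assume h: "h \<in> cartan K"
  have "lie K h (tau i x) = tau i (lie K (tau i h) x)"
    using tau_hom(3)[OF i] tau_tau_cartan[OF i h] by simp
  also have "\<dots> = scale K (rf \<gamma> (tau i h)) (tau i x)"
    using rs_mem[OF x tau_cartan_mem[OF i h]] tau_hom(2)[OF i] by simp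
  finally show "lie K h (tau i x) = scale K (rf (reflect T i \<gamma>) h) (tau i x)"
    by (simp only: rf_tau[OF i h])
qed

lemma roots_reflect: assumes i: "i \<le> rk T" and \<gamma>: "\<gamma> \<in> roots K T" shows "reflect T i \<gamma> \<in> roots K T"
proof -
  have *: "\<gamma> \<in> root_lattice T" "\<gamma> \<noteq> 0" "rs \<gamma> \<noteq> {0}" using \<gamma> by (auto simp: roots_def zero_fun_def)
  then obtain x where "x \<in> rs \<gamma>" "x \<noteq> 0" using subspace_0[OF rs_subspace] by blast
  then have "tau i x \<in> rs (reflect T i \<gamma>)" "tau i x \<noteq> 0" using tau_rs[OF i] tau_hom(4)[OF i] by auto
  then have "rs (reflect T i \<gamma>) \<noteq> {0}" by blast
  moreover have "reflect T i \<gamma> \<noteq> 0"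
  proof
    assume "reflect T i \<gamma> = 0"
    then have "reflect T i (reflect T i \<gamma>) = reflect T i 0" by (rule arg_cong)
    then have "\<gamma> = 0" by (simp only: reflect_reflect[OF i] reflect_linear)
    then show False using *(2) by simp
  qed
  ultimately show ?thesis using reflect_lattice[OF i *(1)] by (simp add: roots_def zero_fun_def)
qed

text \<open>The condition at the null root makes h act by one and the same scalar along a whole
  string \<gamma> + k\<delta>.\<close>

definition triple :: "root \<Rightarrow> 'a \<Rightarrow> 'a \<Rightarrow> 'a \<Rightarrow> bool" where
  "triple \<gamma> e f h \<longleftrightarrow> e \<in> rs \<gamma> \<and> f \<in> rs (- \<gamma>) \<and> h \<in> cartan K \<and> lie K e f = h
     \<and> rf \<gamma> h = 2 \<and> rf (null_root T) h = 0"

lemma triple_simple: assumes i: "i \<le> rk T" shows "triple (unit_root i) (chev_e K i) (chev_f K i) (scoroot K i)"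
proof -
  have "rf (null_root T) (scoroot K i) = 0"
    unfolding rf_coroot[OF i] using null_root_pair[OF valid i] by (simp only: pair_def of_int_0)
  then show ?thesis
    unfolding triple_def
    using e_rs[OF i] f_rs[OF i] coroot_cartan[OF i] e_f[OF i i] rf_unit_coroot[OF i i] by simp
qed

lemma triple_tau:
  assumes i: "i \<le> rk T" and t: "triple \<gamma> e f h" shows "triple (reflect T i \<gamma>) (tau i e) (tau i f) (tau i h)"
proof -
  have h: "h \<in> cartan K" using t by (simp add: triple_def)
  have "tau i f \<in> rs (reflect T i (- \<gamma>))" using t tau_rs[OF i] by (simp add: triple_def)
  then have "tau i f \<in> rs (- reflect T i \<gamma>)" by (simp only: reflect_linear)
  moreover have "rf (reflect T i \<gamma>) (tau i h) = 2" "rf (null_root T) (tau i h) = 0"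
    using t unfolding rf_tau[OF i h] reflect_reflect[OF i] reflect_null[OF valid i] triple_def by auto
  ultimately show ?thesis
    using t tau_rs[OF i] tau_cartan_mem[OF i h] tau_hom(3)[OF i, of e f] unfolding triple_def by simp
qed

lemma real_triple: assumes "real_root T \<gamma>" shows "\<exists>e f h. triple \<gamma> e f h"
  using assms
proof (induction rule: real_root.induct)
  case (simple i)
  have "triple (unit_root i) (chev_e K i) (chev_f K i) (scoroot K i)" by (rule triple_simple[OF simple])
  then show ?case unfolding unit_root_def by blast
next
  case (reflection \<gamma> i) then show ?case using triple_tau by blast
qed

lemma triple_nonzero: "triple \<gamma> e f h \<Longrightarrow> e \<noteq> 0 \<and> f \<noteq> 0"
proof -
  assume t: "triple \<gamma> e f h"
  have "h \<noteq> 0"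
  proof
    assume "h = 0"
    moreover have "rf \<gamma> 0 = 0" using rf_lin(2)[of 0 \<gamma> 0] subspace_0[OF cartan_subspace] by simp
    ultimately show False using t by (simp add: triple_def)
  qed
  then show ?thesis using t unfolding triple_def by auto
qed

lemma fin_alg_subalgebra: "lie_subalgebra K (fin_alg K T)"
  unfolding fin_alg_def lie_generated_def lie_subalgebra_def
  by (auto intro: subspace_Inter)

lemma fin_alg_generators: "chev_e K ` {1..rk T} \<union> chev_f K ` {1..rk T} \<subseteq> fin_alg K T"
  unfolding fin_alg_def lie_generated_def by blast

lemma fin_alg_closed:
  "subspace (fin_alg K T)" "x \<in> fin_alg K T \<Longrightarrow> y \<in> fin_alg K T \<Longrightarrow> lie K x y \<in> fin_alg K T"
  using fin_alg_subalgebra by (auto simp: lie_subalgebra_def)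

lemma tau_fin_alg: assumes "i \<in> {1..rk T}" "x \<in> fin_alg K T" shows "tau i x \<in> fin_alg K T"
proof -
  have e: "chev_e K i \<in> fin_alg K T" and "chev_f K i \<in> fin_alg K T"
    using fin_alg_generators assms(1) by blast+
  then have f: "- chev_f K i \<in> fin_alg K T" by (intro subspace_neg[OF fin_alg_closed(1)])
  show ?thesis unfolding tau_def
    by (intro ad_exp_mem[OF fin_alg_closed(1)] fin_alg_closed(2) e f assms(2))
qed

lemma fin_cartan_mem: "i \<in> {1..rk T} \<Longrightarrow> scoroot K i \<in> fin_cartan K T"
  by (auto simp: fin_cartan_def intro: span_base)

lemma fin_cartan_subspace: "subspace (fin_cartan K T)"
  by (simp add: fin_cartan_def)

lemma fin_triple:
  assumes "real_in T {1..rk T} \<gamma>"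
  shows "\<exists>e f h. triple \<gamma> e f h \<and> e \<in> fin_alg K T \<and> f \<in> fin_alg K T \<and> h \<in> fin_cartan K T"
  using assms
proof (induction rule: real_in.induct)
  case (simple i)
  have "triple (unit_root i) (chev_e K i) (chev_f K i) (scoroot K i)" by (rule triple_simple) (use simple in simp)
  then show ?case using fin_alg_generators fin_cartan_mem[OF simple] simple by blast
next
  case (reflection \<gamma> i)
  then obtain e f h where t: "triple \<gamma> e f h" "e \<in> fin_alg K T" "f \<in> fin_alg K T" "h \<in> fin_cartan K T" by blast
  have i: "i \<le> rk T" using reflection by simp
  have "tau i h \<in> fin_cartan K T"
    using tau_cartan[OF i] t(1,4) fin_cartan_mem[OF reflection(2)]
    by (simp add: triple_def subspace_diff[OF fin_cartan_subspace] subspace_scale[OF fin_cartan_subspace])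
  then show ?case using triple_tau[OF i t(1)] tau_fin_alg[OF reflection(2)] t(2,3) by blast
qed

lemma pos_roots_props:
  assumes "\<gamma> \<in> pos_roots K T"
  shows "\<gamma> \<in> root_lattice T" "\<gamma> \<in> roots K T" "0 \<le> \<gamma> i" "\<gamma> \<noteq> 0"
  using assms by (auto simp: pos_roots_def roots_def zero_fun_def)

text \<open>Reflecting in a simple root with positive coefficient and positive pairing lowers the height;
  if there is none, then the root is in the kernel of the Cartan matrix.\<close>

lemma pos_root_classification:
  assumes "\<gamma> \<in> pos_roots K T"
  shows "(\<exists>k. 0 < k \<and> \<gamma> = mul k (null_root T)) \<or> real_in T {i. i \<le> rk T \<and> \<gamma> i \<noteq> 0} \<gamma>"
  using assms
proof (induction "nat (\<Sum>i\<le>rk T. \<gamma> i)" arbitrary: \<gamma> rule: less_induct)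
  case less
  note \<gamma> = pos_roots_props[OF less.prems]
  have supp: "i \<le> rk T" if "\<gamma> i \<noteq> 0" for i using \<gamma>(1) that by (auto simp: root_lattice_def intro: leI)
  show ?case
  proof (cases "\<exists>i\<le>rk T. 0 < \<gamma> i \<and> 0 < pair T i \<gamma>")
    case True
    then obtain i where i: "i \<le> rk T" "0 < \<gamma> i" "0 < pair T i \<gamma>" by blast
    let ?\<mu> = "reflect T i \<gamma>"
    show ?thesis
    proof (cases "\<exists>j. j \<noteq> i \<and> \<gamma> j \<noteq> 0")
      case False
      then have "\<gamma> = unit_root i" using root_multiple_simple[OF \<gamma>(2), of i] i(2) by auto
      then show ?thesis using real_in.simple[of i "{i. i \<le> rk T \<and> \<gamma> i \<noteq> 0}" T] i by auto
    next
      case True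
      then obtain j where j: "j \<noteq> i" "\<gamma> j \<noteq> 0" by blast
      have root: "?\<mu> \<in> roots K T" by (rule roots_reflect[OF i(1) \<gamma>(2)])
      \<comment> \<open>The reflection changes coordinate i only, so the positive coordinate j
        survives and, roots having a sign, all of \<open>?\<mu>\<close> is nonnegative.\<close>
      have "0 < ?\<mu> j" using j \<gamma>(3)[of j] reflect_other[OF j(1), of T \<gamma>] by simp
      then have pos: "0 \<le> ?\<mu> k" for k using roots_sign[OF root] by (metis not_le)
      then have mu: "?\<mu> \<in> pos_roots K T" using root by (simp add: pos_roots_def)
      have other: "?\<mu> k = \<gamma> k" if "k \<noteq> i" for k using reflect_other[OF that] .
      have "(\<Sum>k\<le>rk T. ?\<mu> k) = ?\<mu> i + (\<Sum>k\<in>{..rk T} - {i}. ?\<mu> k)"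
        using i(1) by (subst sum.remove[of _ i]) auto
      also have "(\<Sum>k\<in>{..rk T} - {i}. ?\<mu> k) = (\<Sum>k\<in>{..rk T} - {i}. \<gamma> k)"
        by (rule sum.cong) (use other in auto)
      also have "?\<mu> i + (\<Sum>k\<in>{..rk T} - {i}. \<gamma> k) = (\<Sum>k\<le>rk T. \<gamma> k) - pair T i \<gamma>"
        using i(1) reflect_self[of T i \<gamma>] sum.remove[of "{..rk T}" i \<gamma>] by simp
      finally have "(\<Sum>k\<le>rk T. ?\<mu> k) < (\<Sum>k\<le>rk T. \<gamma> k)" using i(3) by simp
      moreover have "0 \<le> (\<Sum>k\<le>rk T. ?\<mu> k)" by (rule sum_nonneg) (rule pos)
      ultimately have "nat (\<Sum>k\<le>rk T. ?\<mu> k) < nat (\<Sum>k\<le>rk T. \<gamma> k)" by simp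
      from less.hyps[OF this mu] show ?thesis
      proof
        assume "\<exists>k. 0 < k \<and> ?\<mu> = mul k (null_root T)"
        then obtain k where k: "0 < k" "?\<mu> = mul k (null_root T)" by blast
        have "reflect T i ?\<mu> = mul k (null_root T)"
          unfolding k(2) by (simp only: reflect_linear reflect_null[OF valid i(1)])
        then have "\<gamma> = mul k (null_root T)" by (simp only: reflect_reflect[OF i(1)])
        then show ?thesis using k(1) by (intro disjI1 exI[of _ k] conjI)
      next
        assume "real_in T {i. i \<le> rk T \<and> ?\<mu> i \<noteq> 0} ?\<mu>"
        \<comment> \<open>The node i lies in the support, so reflecting there cannot enlarge it.
          This later confines roots without \<alpha>_0 to the orbit of the finite Weyl
          group.\<close>
        moreover have "{i. i \<le> rk T \<and> ?\<mu> i \<noteq> 0} \<subseteq> {i. i \<le> rk T \<and> \<gamma> i \<noteq> 0}"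
        proof
          fix k assume "k \<in> {i. i \<le> rk T \<and> ?\<mu> i \<noteq> 0}"
          then show "k \<in> {i. i \<le> rk T \<and> \<gamma> i \<noteq> 0}"
            using other[of k] i(2) by (cases "k = i") simp_all
        qed
        ultimately have "real_in T {i. i \<le> rk T \<and> \<gamma> i \<noteq> 0} ?\<mu>" by (rule real_in_mono)
        then have "real_in T {i. i \<le> rk T \<and> \<gamma> i \<noteq> 0} (reflect T i ?\<mu>)"
          by (rule real_in.reflection) (use i in simp)
        then show ?thesis unfolding reflect_reflect[OF i(1)] by (rule disjI2)
      qed
    qed
  next
    case False
    \<comment> \<open>Where \<gamma> has coefficient 0 only off-diagonal entries contribute, and
      these are nonpositive.\<close>
    have "pair T i \<gamma> \<le> 0" if i: "i \<le> rk T" for i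
    proof (cases "0 < \<gamma> i")
      case True then show ?thesis using False i by (metis not_le)
    next
      case zero: False
      have "gcm T i j * \<gamma> j \<le> 0" for j
      proof (cases "j = i")
        case True then show ?thesis using zero \<gamma>(3)[of i] by simp
      next
        case False then show ?thesis using gcm_nonpos[of i j T] \<gamma>(3)[of j] by (simp add: mult_nonpos_nonneg)
      qed
      then show ?thesis unfolding pair_def by (intro sum_nonpos)
    qed
    from pair_nonpos_null[OF valid \<gamma>(1) this] have eq: "\<gamma> = mul (\<gamma> 0) (null_root T)" .
    have "\<gamma> 0 \<noteq> 0"
    proof
      assume "\<gamma> 0 = 0"
      then have "\<gamma> i = 0" for i using fun_cong[OF eq, of i] by simp
      then show False using \<gamma>(4) by (simp add: fun_eq_iff)
    qed
    then show ?thesis using eq \<gamma>(3)[of 0] by (metis order_le_less)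
  qed
qed

end

section \<open>Loop algebras of real roots\<close>

context complex_lie_algebra
begin

context
  fixes E F :: "nat \<Rightarrow> 'a" and h :: 'a
  assumes EF0: "br (E 0) (F 0) = h"
    and hE: "br h (E k) = sc 2 (E k)" and hF: "br h (F k) = sc (- 2) (F k)"
    and EE: "br (E k) (E l) = 0" and FF: "br (F k) (F l) = 0"
    and E_Suc: "br (br (E 0) (F 1)) (E k) = sc 2 (E (Suc k))"
    and F_Suc: "br (br (E 0) (F 1)) (F k) = sc (- 2) (F (Suc k))"
begin

text \<open>The brackets $[E_k, F_{N+1-k}]$, $0 \<le> k \<le> N + 1$, form an arithmetic progression with
  increment $\frac12 [H_1, H_N]$, and the two ends force this increment to vanish.\<close>

lemma loop_EF: "br (E k) (F l) = br (E 0) (F (k + l)) \<and> br (br (E 0) (F 1)) (br (E 0) (F (k + l))) = 0"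
proof -
  define H where "H N = br (E 0) (F N)" for N
  \<comment> \<open>The two claims feed each other: that H_1 commutes with H_N equates the brackets
    at level N + 1.\<close>
  have main: "(\<forall>k l. k + l = N \<longrightarrow> br (E k) (F l) = H N) \<and> (\<forall>M<N. br (H 1) (H M) = 0)" for N
  proof (induction N)
    case 0 then show ?case by (simp add: H_def)
  next
    case (Suc N)
    define X where "X = br (H 1) (H N)"
    define a where "a k = br (E k) (F (Suc N - k))" for k
    have step: "sc 2 (a (Suc k)) = X + sc 2 (a k)" if "k \<le> N" for k
    proof -
      have "X = br (H 1) (br (E k) (F (N - k)))" using Suc that by (simp add: X_def)
      also have "\<dots> = sc 2 (br (E (Suc k)) (F (N - k))) + sc (- 2) (br (E k) (F (Suc (N - k))))"
        using leibniz[of "H 1" "E k" "F (N - k)"] unfolding H_def E_Suc F_Suc br_scale_left br_scale_right .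
      also have "\<dots> = sc 2 (a (Suc k)) - sc 2 (a k)"
        using that by (simp add: a_def Suc_diff_le)
      finally show ?thesis by simp
    qed
    have prog: "sc 2 (a k) = sc 2 (a 0) + sc (of_nat k) X" if "k \<le> Suc N" for k
      using that
    proof (induction k)
      case (Suc k)
      then show ?case using step[of k] by (simp add: scale_left_distrib)
    qed simp
    have HE: "br (H N) (E 0) = sc 2 (E N)"
    proof -
      have "H N = br (E N) (F 0)" using Suc by simp
      then show ?thesis
        using br_br_left[of "E N" "F 0" "E 0"] EE br_anti[of "F 0" "E 0"] EF0 hE[of N] br_anti[of "E N" h] by simp
    qed
    have HF: "br (H N) (F 1) = sc (- 2) (F (Suc N))"
      using br_br_left[of "E 0" "F N" "F 1"] FF br_anti[of "F N" "br (E 0) (F 1)"] F_Suc[of N]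
      by (simp add: H_def)
    \<comment> \<open>Expanding H_1 instead of H_N expresses the same commutator by the terms with
      indices 0 and N; combined with \<open>prog\<close> this reads N X = - X.\<close>
    have ends: "X = sc 2 (a 0) - sc 2 (a N)"
    proof -
      have "X = br (E 0) (br (F 1) (H N)) - br (F 1) (br (E 0) (H N))"
        unfolding X_def H_def[of 1] by (rule br_br_left)
      also have "br (F 1) (H N) = sc 2 (F (Suc N))" using br_anti[of "F 1" "H N"] HF by simp
      also have "br (E 0) (H N) = - sc 2 (E N)" using br_anti[of "E 0" "H N"] HE by simp
      also have "br (F 1) (- sc 2 (E N)) = sc 2 (br (E N) (F 1))"
        using br_anti[of "F 1" "E N"] by (simp add: br_scale_right)
      finally show ?thesis by (simp add: a_def br_scale_right)
    qed
    have "sc (of_nat N) X = sc 2 (a N) - sc 2 (a 0)" using prog[of N] by simp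
    also have "\<dots> = - X" unfolding ends by simp
    finally have "sc (of_nat (Suc N)) X = 0" by (simp add: scale_left_distrib)
    then have X: "X = 0" by (simp del: of_nat_Suc)
    have "br (E k) (F l) = H (Suc N)" if "k + l = Suc N" for k l
    proof -
      have "sc 2 (a k) = sc 2 (a 0)" using prog[of k] that X by simp
      then have "a k = a 0" by simp
      moreover have "l = Suc N - k" using that by simp
      ultimately show ?thesis by (simp add: a_def H_def)
    qed
    then show ?case using Suc X by (auto simp: X_def less_Suc_eq)
  qed
  from main[of "k + l"] main[of "Suc (k + l)"] show ?thesis unfolding H_def by blast
qed

text \<open>H_m commutes with H_1 by \<open>loop_EF\<close>, and H_1 carries F_l to a multiple of
  F_{l+1}, so the formula spreads from l = 0.\<close>

lemma loop_HF: "br (br (E 0) (F m)) (F l) = sc (- 2) (F (m + l))"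
proof (induction l)
  case 0
  have "br (br (E 0) (F m)) (F 0) = - br (F m) h"
    using br_br_left[of "E 0" "F m" "F 0"] FF EF0 by simp
  also have "\<dots> = br h (F m)" using br_anti[of "F m" h] by simp
  finally show ?case using hF by simp
next
  case (Suc l)
  let ?H = "br (E 0) (F m)" and ?H1 = "br (E 0) (F 1)"
  have comm: "br ?H1 ?H = 0" using loop_EF[of 0 m] by simp
  have "br ?H1 (br ?H (F l)) = br (br ?H1 ?H) (F l) + br ?H (br ?H1 (F l))" by (rule leibniz)
  also have "\<dots> = sc (- 2) (br ?H (F (Suc l)))" unfolding comm F_Suc br_scale_right by simp
  finally have "sc (- 2) (br ?H (F (Suc l))) = sc (- 2) (sc (- 2) (F (Suc (m + l))))"
    unfolding Suc br_scale_right F_Suc by simp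
  then have "br ?H (F (Suc l)) = sc (- 2) (F (Suc (m + l)))" by (simp only: scale_cancel_left) simp
  then show ?case by simp
qed

text \<open>\<open>br G (F 0)\<close> is a descending counterpart of H_1: it takes F_{k+1} back to
  -2 F_k, so no F_k after F_1 can vanish. Its bracket with H_1 is 2h' - 2h, which kills all F_k, and
  this lets the induction through.\<close>

lemma loop_nonzero:
  assumes G: "br G (F 1) = h'" "br G (E 0) = 0" "br h G = sc 2 G" and h': "\<And>k. br h' (F k) = sc (- 2) (F k)"
    and F1: "F 1 \<noteq> 0"
  shows "F (Suc k) \<noteq> 0"
proof -
  let ?H = "br G (F 0)" and ?H1 = "br (E 0) (F 1)"
  have "br ?H (E 0) = - br G h"
    using br_br_left[of G "F 0" "E 0"] G(2) br_anti[of "F 0" "E 0"] EF0 by simp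
  then have HE: "br ?H (E 0) = sc 2 G" using br_anti[of G h] G(3) by simp
  have "br ?H (F 1) = - br (F 0) h'" using br_br_left[of G "F 0" "F 1"] FF G(1) by simp
  then have HF1: "br ?H (F 1) = sc (- 2) (F 0)" using br_anti[of "F 0" h'] h'[of 0] by simp
  have HH: "br ?H ?H1 = sc 2 h' - sc 2 h"
    using leibniz[of ?H "E 0" "F 1"] HE HF1 G(1) EF0 by (simp add: br_scale_left br_scale_right)
  have comm: "br (br ?H ?H1) (F k) = 0" for k
    unfolding HH br_diff br_scale_left h' hF by simp
  have HF: "br ?H (F (Suc k)) = sc (- 2) (F k)" for k
  proof (induction k)
    case 0 then show ?case using HF1 by simp
  next
    case (Suc k)
    have "sc (- 2) (br ?H (F (Suc (Suc k)))) = br ?H (br ?H1 (F (Suc k)))"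
      unfolding F_Suc br_scale_right ..
    also have "\<dots> = br ?H1 (br ?H (F (Suc k)))" 
      using leibniz[of ?H ?H1 "F (Suc k)"] unfolding comm add_0_left .
    also have "\<dots> = sc (- 2) (sc (- 2) (F (Suc k)))" unfolding Suc br_scale_right F_Suc ..
    finally show ?case by (simp only: scale_cancel_left) simp
  qed
  show ?thesis
  proof (induction k)
    case (Suc k)
    show ?case
    proof
      assume "F (Suc (Suc k)) = 0"
      then have "sc (- 2) (F (Suc k)) = 0" using HF[of "Suc k"] by simp
      then show False using Suc by simp
    qed
  qed (use F1 in simp)
qed

end

end

context affine
begin

text \<open>Negative roots are positive roots of the dual data.\<close>

lemma root_classification:
  assumes "\<gamma> \<in> roots K T"
  shows "(\<exists>k. \<gamma> = mul k (null_root T)) \<or> real_in T {i. i \<le> rk T \<and> \<gamma> i \<noteq> 0} \<gamma>"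
  using roots_sign[OF assms]
proof
  assume "\<forall>i. 0 \<le> \<gamma> i"
  then have "\<gamma> \<in> pos_roots K T" using assms by (simp add: pos_roots_def)
  then show ?thesis using pos_root_classification by blast
next
  assume neg: "\<forall>i. \<gamma> i \<le> 0"
  have *: "\<gamma> \<in> root_lattice T" "\<gamma> \<noteq> 0" "rs \<gamma> \<noteq> {0}" using assms by (auto simp: roots_def zero_fun_def)
  have "root_space (dual K) T (- \<gamma>) = rs \<gamma>" by (simp add: rs_dual del: uminus_apply)
  then have "- \<gamma> \<in> pos_roots (dual K) T"
    using * neg lattice_simps(3)[of \<gamma>] by (auto simp: pos_roots_def roots_def zero_fun_def fun_eq_iff)
  from affine.pos_root_classification[OF affine_dual this] show ?thesis
  proof
    assume "\<exists>k. 0 < k \<and> - \<gamma> = mul k (null_root T)"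
    then obtain k where k: "- \<gamma> = mul k (null_root T)" by blast
    have "\<gamma> = mul (- k) (null_root T)"
    proof
      fix i show "\<gamma> i = mul (- k) (null_root T) i" using fun_cong[OF k, of i] by simp
    qed
    then show ?thesis by blast
  next
    let ?I = "{i. i \<le> rk T \<and> (- \<gamma>) i \<noteq> 0}"
    assume "real_in T ?I (- \<gamma>)"
    then have "real_in T ?I (- (- \<gamma>))" by (rule real_in_minus) auto
    moreover have "?I = {i. i \<le> rk T \<and> \<gamma> i \<noteq> 0}" by simp
    ultimately have "real_in T {i. i \<le> rk T \<and> \<gamma> i \<noteq> 0} \<gamma>" by (simp only: minus_minus)
    then show ?thesis by (rule disjI2)
  qed
qed

text \<open>The classification leaves an imaginary root only the multiples of the null root, and
  non-divisibility leaves the multiple 1.\<close>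

lemma is_delta_null: assumes "is_delta K T \<delta>" shows "\<delta> = null_root T"
proof -
  have \<delta>: "\<delta> \<in> pos_roots K T" "\<not> real_root T \<delta>"
    and div: "\<And>\<beta> k. \<beta> \<in> root_lattice T \<Longrightarrow> \<delta> = (\<lambda>i. int k * \<beta> i) \<Longrightarrow> k = 1"
    using assms by (auto simp: is_delta_def imag_root_def)
  from pos_root_classification[OF \<delta>(1)] show ?thesis
  proof
    assume "\<exists>k. 0 < k \<and> \<delta> = mul k (null_root T)"
    then obtain k where k: "0 < k" "\<delta> = mul k (null_root T)" by blast
    then have "\<delta> = (\<lambda>i. int (nat k) * null_root T i)" by (simp add: mul_def)
    from div[OF null_root_lattice this] have "k = 1" by simp
    then show ?thesis using k(2) by (simp add: mul_def)
  next
    assume "real_in T {i. i \<le> rk T \<and> \<delta> i \<noteq> 0} \<delta>"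
    then have "real_root T \<delta>" by (rule real_in_real) auto
    then show ?thesis using \<delta>(2) by blast
  qed
qed

lemma finite_root_real_in:
  assumes "\<gamma> \<in> roots K T" "\<gamma> 0 = 0" shows "real_in T {1..rk T} \<gamma>"
  using root_classification[OF assms(1)]
proof
  assume "\<exists>k. \<gamma> = mul k (null_root T)"
  then obtain k where k: "\<gamma> = mul k (null_root T)" by blast
  then have "k = 0" using fun_cong[OF k, of 0] assms(2) by simp
  then have "\<gamma> = 0" using k by (simp add: mul_def zero_fun_def)
  then show ?thesis using assms(1) by (simp add: roots_def zero_fun_def)
next
  assume r: "real_in T {i. i \<le> rk T \<and> \<gamma> i \<noteq> 0} \<gamma>"
  have "{i. i \<le> rk T \<and> \<gamma> i \<noteq> 0} \<subseteq> {1..rk T}"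
  proof
    fix i assume "i \<in> {i. i \<le> rk T \<and> \<gamma> i \<noteq> 0}"
    then show "i \<in> {1..rk T}" using assms(2) by (cases "i = 0") auto
  qed
  with r show ?thesis by (rule real_in_mono)
qed

text \<open>A root is real or a multiple of the null root. Parity excludes the first; a nonzero
  \<mu> without \<alpha>_0 excludes the second. Hence root vectors over one finite root
  commute.\<close>

lemma rs_even_zero:
  assumes "\<mu> \<in> root_lattice T" "\<mu> 0 = 0" "\<mu> \<noteq> 0" "x \<in> rs (mul 2 \<mu> + mul k (null_root T))"
  shows "x = 0"
proof (rule ccontr)
  let ?\<gamma> = "mul 2 \<mu> + mul k (null_root T)"
  assume x: "x \<noteq> 0"
  have not_null: "?\<gamma> \<noteq> mul l (null_root T)" for l
  proof
    assume eq: "?\<gamma> = mul l (null_root T)"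
    have at: "?\<gamma> i = mul l (null_root T) i" for i by (rule fun_cong[OF eq])
    have "k = l" using at[of 0] assms(2) by simp
    then have "\<mu> i = 0" for i using at[of i] by simp
    then show False using assms(3) by (simp add: fun_eq_iff)
  qed
  have "?\<gamma> \<in> root_lattice T" using assms(1) null_root_lattice[of T] by (auto simp: root_lattice_def)
  moreover have "?\<gamma> \<noteq> 0"
  proof
    assume "?\<gamma> = 0"
    then have "?\<gamma> = mul 0 (null_root T)" by (simp only: mul_def) (simp add: zero_fun_def)
    then show False using not_null by blast
  qed
  ultimately have "?\<gamma> \<in> roots K T" using x assms(4) by (auto simp: roots_def zero_fun_def)
  from root_classification[OF this] not_null have "real_in T {i. i \<le> rk T \<and> ?\<gamma> i \<noteq> 0} ?\<gamma>" by blast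
  then have "real_root T ?\<gamma>" by (rule real_in_real) auto
  then show False using real_not_even[OF valid] by blast
qed

lemma real_in_lattice: "real_in T {1..rk T} \<gamma> \<Longrightarrow> \<gamma> \<in> root_lattice T \<and> \<gamma> 0 = 0"
proof (induction rule: real_in.induct)
  case (simple i) then show ?case by (auto simp: root_lattice_def)
next
  case (reflection \<gamma> i)
  then show ?case using reflect_lattice[of i T \<gamma>] reflect_other[of 0 i T \<gamma>] by auto
qed

lemma fin_roots_iff: "\<alpha> \<in> fin_roots K T \<longleftrightarrow> real_in T {1..rk T} \<alpha>"
proof
  assume "\<alpha> \<in> fin_roots K T"
  then have *: "\<alpha> \<in> root_lattice T" "\<alpha> 0 = 0" "\<alpha> \<noteq> 0" "fin_root_space K T \<alpha> \<noteq> {0}"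
    by (auto simp: fin_roots_def zero_fun_def)
  then have "rs \<alpha> \<noteq> {0}" using subspace_0[OF fin_alg_closed(1)] by (auto simp: fin_root_space_def)
  then have "\<alpha> \<in> roots K T" using * by (simp add: roots_def zero_fun_def)
  then show "real_in T {1..rk T} \<alpha>" using *(2) by (rule finite_root_real_in)
next
  assume r: "real_in T {1..rk T} \<alpha>"
  obtain e f h where t: "triple \<alpha> e f h" "e \<in> fin_alg K T" using fin_triple[OF r] by blast
  then have e: "e \<in> fin_root_space K T \<alpha>" "e \<noteq> 0"
    using triple_nonzero by (auto simp: fin_root_space_def triple_def)
  have "\<alpha> \<noteq> 0"
  proof
    assume "\<alpha> = 0"
    then show False using t(1) by (simp add: triple_def rf_zero)
  qed
  then show "\<alpha> \<in> fin_roots K T"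
    using e real_in_lattice[OF r] unfolding fin_roots_def zero_fun_def by blast
qed

text \<open>The simple root conjugate to \<alpha> fixes both the length of \<alpha> and the step of
  its string. On the finite nodes \<open>symm\<close> is 1 or m, and m is attained, so being long
  means m and \<open>dd\<close> is that step.\<close>

lemma fin_root_string:
  assumes "\<alpha> \<in> fin_roots K T"
  shows "real_root T (\<alpha> + mul (k * int (dd K T \<alpha>)) (null_root T))"
    "dd K T \<alpha> = twist T \<and> long_root K T \<alpha> \<or> dd K T \<alpha> = 1 \<and> short_root K T \<alpha>"
proof -
  have str: "\<exists>i\<in>{1..rk T}. form T \<beta> \<beta> = 2 * int (symm T i)
    \<and> (\<forall>k. real_root T (\<beta> + mul (k * int (symm T i)) (null_root T)))" if "\<beta> \<in> fin_roots K T" for \<beta>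
    using string_real[OF valid] that fin_roots_iff by blast
  obtain i where i: "i \<in> {1..rk T}" "form T \<alpha> \<alpha> = 2 * int (symm T i)"
    "\<And>k. real_root T (\<alpha> + mul (k * int (symm T i)) (null_root T))"
    using str[OF assms] by blast
  have bounds: "2 \<le> form T \<beta> \<beta> \<and> form T \<beta> \<beta> \<le> 2 * int (twist T)" if "\<beta> \<in> fin_roots K T" for \<beta>
    using str[OF that] symm_values(1,4)[OF valid] by force
  have unit: "unit_root j \<in> fin_roots K T" "form T (unit_root j) (unit_root j) = 2 * int (symm T j)"
    if "j \<in> {1..rk T}" for j
    using that real_in.simple[of j "{1..rk T}" T] fin_roots_iff by (auto simp: form_unit pair_unit)
  have compare: "sq_length T c \<beta> \<le> sq_length T c \<gamma>"
    if "symmetrizer T c" "form T \<beta> \<beta> \<le> form T \<gamma> \<gamma>" for c \<beta> \<gamma>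
    unfolding sq_length_form(1)[OF valid that(1)]
    by (rule mult_left_mono) (use sq_length_form(2)[OF valid that(1)] that(2) in simp_all)
  obtain j where j: "j \<in> {1..rk T}" "symm T j = twist T" using symm_values(3)[OF valid] by blast
  have long: "long_root K T \<alpha> \<longleftrightarrow> symm T i = twist T"
  proof
    assume l: "long_root K T \<alpha>"
    note c = symmetrizer_symm[OF valid]
    have "sq_length T (\<lambda>i. real (symm T i)) (unit_root j) \<le> sq_length T (\<lambda>i. real (symm T i)) \<alpha>"
      using l c unit(1)[OF j(1)] by (simp add: long_root_def)
    then have "form T (unit_root j) (unit_root j) \<le> form T \<alpha> \<alpha>"
      using symm_pos[of T 0] by (simp add: sq_length_form(1)[OF valid c])
    then have "twist T \<le> symm T i" using unit(2)[OF j(1)] j(2) i(2) by simp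
    then show "symm T i = twist T" using symm_values(1,4)[OF valid] i(1) by fastforce
  next
    assume "symm T i = twist T"
    then show "long_root K T \<alpha>"
      unfolding long_root_def using assms bounds i(2) by (auto intro!: compare)
  qed
  have val: "symm T i = 1 \<or> symm T i = twist T"
    by (rule symm_values(1)[OF valid]) (use i(1) in auto)
  then have dd: "dd K T \<alpha> = symm T i" using long by (auto simp: dd_def)
  show "real_root T (\<alpha> + mul (k * int (dd K T \<alpha>)) (null_root T))" unfolding dd by (rule i(3))
  have "short_root K T \<alpha>" if "symm T i = 1"
    unfolding short_root_def using assms bounds i(2) that by (auto intro!: compare)
  then show "dd K T \<alpha> = twist T \<and> long_root K T \<alpha> \<or> dd K T \<alpha> = 1 \<and> short_root K T \<alpha>"
    using long dd val by auto
qed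

end

section \<open>Submodules as left ideals of the free algebra\<close>

lemma free_algebra_minus:
  assumes "p \<in> carrier (free_algebra L)" "q \<in> carrier (free_algebra L)"
  shows "p \<ominus>\<^bsub>free_algebra L\<^esub> q = p - q"
proof -
  interpret ring "free_algebra L" by (rule free_algebra_ring)
  have "\<ominus>\<^bsub>free_algebra L\<^esub> q = - q"
    by (rule minus_equality) (use assms free_algebra_closed in auto)
  then show ?thesis by (simp add: a_minus_def)
qed

lemma const_0: "const 0 = 0"
  by (simp add: const_def)

lemma const_diff: "const (a - b) = const a - const b"
  by (simp add: const_def single_diff)

locale env_pullback =
  fixes K :: "('a::ab_group_add) km_data" and L :: "'a set" and S :: "'a free_alg set set"
    and N :: "'a free_alg set set set"
  assumes L: "bracket_closed K L" and S: "S \<subseteq> carrier (env K L)"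
    and N: "submodule N (env K L) (cyclic_module (env K L) S)"
begin

abbreviation "C \<equiv> carrier (free_algebra L)"
abbreviation "Z \<equiv> env_ideal K L"

sublocale pb: cyclic_pullback "env K L" S N
  by (intro cyclic_pullback.intro cyclic_pullback_axioms.intro env_ring[OF L] S N)

sublocale Z: ideal Z "free_algebra L" by (rule env_ideal_ideal[OF L])

lemma hom: "env_of K L \<in> ring_hom (free_algebra L) (env K L)" by (rule env_of_hom[OF L])

lemma Z_C: "Z \<subseteq> C" using Z.a_subset by simp

definition pull :: "'a free_alg set" where "pull = {p \<in> C. env_of K L p \<in> pb.J}"

lemma env_of_Z: "p \<in> Z \<Longrightarrow> env_of K L p \<in> pb.J"
proof -
  assume "p \<in> Z"
  then have "env_of K L p = env_of K L 0"
    using Z.a_coset_join2[OF _ Z.a_subgroup] Z.a_coset_join2[OF _ Z.a_subgroup, of 0] Z_C Z.zero_closed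
      free_algebra_closed(1)[of L] Z.additive_subgroup_axioms additive_subgroup.zero_closed[of Z "free_algebra L"]
    by (auto simp: env_of_def)
  also have "\<dots> = \<zero>\<^bsub>env K L\<^esub>"
    using ring_hom_zero[OF hom free_algebra_ring env_ring[OF L]] by simp
  also have "\<dots> \<in> pb.J"
    using pb.J_minus[of "\<zero>\<^bsub>env K L\<^esub>" "\<zero>\<^bsub>env K L\<^esub>"] pb.I_J pb.I_subgroup
    by (meson abelian_subgroup.axioms(1) additive_subgroup.zero_closed subsetD)
  finally show ?thesis .
qed

sublocale left_ideal_mod C Z pull
proof
  have Zdiff: "u - v \<in> Z" if "u \<in> Z" "v \<in> Z" for u v
  proof -
    have "u \<ominus>\<^bsub>free_algebra L\<^esub> v \<in> Z"
      using that Z.a_closed Z.a_inv_closed by (simp add: a_minus_def del: free_algebra_simps)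
    then show ?thesis using free_algebra_minus[of u L v] that Z_C by auto
  qed
  show "u - v \<in> Z" if "u \<in> Z" "v \<in> Z" for u v using Zdiff[OF that] .
  show "0 \<in> Z" using additive_subgroup.zero_closed[OF Z.additive_subgroup_axioms] by simp
  show "u * z \<in> Z" if "u \<in> C" "z \<in> Z" for u z using Z.I_l_closed[OF that(2,1)] by simp
  show "z * u \<in> Z" if "u \<in> C" "z \<in> Z" for u z using Z.I_r_closed[OF that(2,1)] by simp
  show "Z \<subseteq> pull" using env_of_Z Z_C by (auto simp: pull_def)
  show "u - v \<in> pull" if uv: "u \<in> pull" "v \<in> pull" for u v
  proof -
    have c: "u \<in> C" "v \<in> C" using uv by (auto simp: pull_def)
    interpret h: ring_hom_ring "free_algebra L" "env K L" "env_of K L"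
      by (intro ring_hom_ringI2 free_algebra_ring env_ring[OF L] hom)
    have "env_of K L (u - v) = env_of K L u \<ominus>\<^bsub>env K L\<^esub> env_of K L v"
      using free_algebra_minus[OF c] c h.hom_add[of u "\<ominus>\<^bsub>free_algebra L\<^esub> v"] h.hom_a_inv[of v]
      by (simp add: a_minus_def del: free_algebra_simps)
    then show ?thesis
      using pb.J_minus uv free_algebra_closed(6)[OF c] by (auto simp: pull_def)
  qed
  show "u * v \<in> pull" if "u \<in> C" "v \<in> pull" for u v
  proof -
    have v: "v \<in> C" "env_of K L v \<in> pb.J" using that by (auto simp: pull_def)
    have "env_of K L (u * v) = env_of K L u \<otimes>\<^bsub>env K L\<^esub> env_of K L v"
      using ring_hom_mult[OF hom that(1) v(1)] by simp
    then show ?thesis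
      using pb.J_mult[OF env_of_closed[OF L that(1)] v(2)] free_algebra_closed(4)[OF that(1) v(1)]
      by (simp add: pull_def)
  qed
qed (auto intro: free_algebra_closed)

lemma mem_N_pull:
  "p \<in> C \<Longrightarrow> env_of K L p \<odot>\<^bsub>cyclic_module (env K L) S\<^esub> cyclic_generator (env K L) S \<in> N \<longleftrightarrow> p \<in> pull"
  using pb.mem_N_iff[OF env_of_closed[OF L]] by (simp add: pull_def)

lemma relation_pull: "p \<in> C \<Longrightarrow> env_of K L p \<in> S \<Longrightarrow> p \<in> pull"
  using pb.I(2) pb.I_J by (auto simp: pull_def)

lemma const_pull: assumes "c \<noteq> 0" "u \<in> C" shows "const c * u \<in> pull \<longleftrightarrow> u \<in> pull"
proof
  assume "const c * u \<in> pull"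
  then have "const (1 / c) * (const c * u) \<in> pull" by (rule J_left[OF const_closed])
  moreover have "const (1 / c) * const c = (1 :: 'a free_alg)"
    using assms(1) by (simp add: const_simps(1) flip: const_simps(2))
  then have "const (1 / c) * (const c * u) = u" by (simp flip: mult.assoc)
  ultimately show "u \<in> pull" by simp
qed (rule J_left[OF const_closed])

text \<open>\<open>letter\<close> is linear only modulo the enveloping relations. Real root vectors
  are given up to a scalar, and this allows their powers to be compared.\<close>

lemma letter_scale_power:
  assumes "y \<in> L" shows "letter (scale K c y) ^ k - const (c ^ k) * letter y ^ k \<in> Z"
proof (induction k)
  case 0 then show ?case using Z_zero by (simp add: const_simps)
next
  case (Suc k)
  let ?a = "letter (scale K c y)" and ?b = "letter y"
  have a: "?a \<in> C" using L assms by (auto simp: bracket_closed_def intro: letter_closed)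
  have b: "?b \<in> C" using assms by (rule letter_closed)
  have "?a * (?a ^ k - const (c ^ k) * ?b ^ k) + (?a - const c * ?b) * (const (c ^ k) * ?b ^ k) \<in> Z"
    by (intro Z_add Z_left Z_right a Suc env_ideal_relations(2)[OF L assms] C_mult C_power b const_closed)
  moreover have "const c * ?b * (const (c ^ k) * ?b ^ k) = const (c ^ Suc k) * ?b ^ Suc k"
    using const_commute[of "c ^ k" ?b] by (simp add: const_simps mult.assoc[symmetric]) (simp add: mult.assoc)
  ultimately show ?case by (simp add: algebra_simps)
qed

lemma scale_power_pull:
  assumes "y \<in> L" "c \<noteq> 0" "u \<in> C" "v \<in> C"
  shows "u * letter (scale K c y) ^ k * v \<in> pull \<longleftrightarrow> u * letter y ^ k * v \<in> pull"
proof -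
  have y: "letter y \<in> C" using assms(1) by (rule letter_closed)
  have "u * (letter (scale K c y) ^ k - const (c ^ k) * letter y ^ k) * v \<in> pull"
    by (rule subsetD[OF Z_J]) (intro Z_left Z_right assms letter_scale_power)
  then have "u * letter (scale K c y) ^ k * v - const (c ^ k) * (u * letter y ^ k * v) \<in> pull"
    using const_commute[of "c ^ k" u] by (simp add: algebra_simps) (simp add: mult.assoc[symmetric])
  then have "u * letter (scale K c y) ^ k * v \<in> pull \<longleftrightarrow> const (c ^ k) * (u * letter y ^ k * v) \<in> pull"
    by (rule J_cong)
  also have "\<dots> \<longleftrightarrow> u * letter y ^ k * v \<in> pull"
    by (rule const_pull) (use assms y in \<open>auto intro: C_mult C_power\<close>)
  finally show ?thesis .
qed

lemma sl2_left_ideal_letters: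
  assumes e: "e \<in> L" "env_of K L (letter e) \<in> S"
    and f: "\<And>j. f j \<in> L" and h: "\<And>j. lie K e (f j) \<in> L" "\<And>j. env_of K L (letter (lie K e (f j))) \<in> S"
    and hf: "\<And>b c. lie K (lie K e (f c)) (f b) = scale K (- 2) (f (b + Suc c))"
    and ff: "\<And>i j. lie K (f i) (f j) = 0" and scale0: "scale K 0 (f 0) = 0"
  shows "sl2_left_ideal C Z pull (letter e) (\<lambda>j. letter (f j)) (\<lambda>j. letter (lie K e (f j)))"
proof unfold_locales
  show "letter e \<in> C" "\<And>j. letter (f j) \<in> C" "\<And>j. letter (lie K e (f j)) \<in> C"
    using e f h by (auto intro: letter_closed)
  then show "letter e \<in> pull" "\<And>j. letter (lie K e (f j)) \<in> pull"
    using e(2) h(2) by (auto intro: relation_pull)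
  show "letter e * letter (f j) - letter (f j) * letter e - letter (lie K e (f j)) \<in> Z" for j
    by (rule env_ideal_relations(3)[OF L e(1) f])
  have m2: "const (- 2) = (- 2 :: 'a free_alg)"
  proof -
    have "const (0 - of_nat 2) = (0 - of_nat 2 :: 'a free_alg)"
      by (simp only: const_diff const_0 const_simps(3))
    then show ?thesis by simp
  qed
  show "letter (lie K e (f c)) * letter (f b) - letter (f b) * letter (lie K e (f c)) + 2 * letter (f (b + Suc c)) \<in> Z"
    for c b
    using Z_add[OF env_ideal_relations(3)[OF L h(1)[of c] f[of b]] env_ideal_relations(2)[OF L f[of "b + Suc c"], of "- 2"]]
    unfolding hf m2 by simp
  \<comment> \<open>The letter of the zero vector is a nonzero free generator; the scaling relation
    with factor 0 puts it into Z, so a vanishing bracket makes letters commute modulo Z.\<close>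
  have "letter 0 \<in> Z"
    using env_ideal_relations(2)[OF L f[of 0], of 0] unfolding scale0 const_0 by simp
  then show "letter (f i) * letter (f j) - letter (f j) * letter (f i) \<in> Z" for i j
    using Z_add[OF env_ideal_relations(3)[OF L f[of i] f[of j]], of "letter 0"] unfolding ff by simp
  show "u \<in> pull" if "0 < m" "u \<in> C" "of_nat m * u \<in> pull" for m :: nat and u
    using const_pull[of "of_nat m" u] that by (simp add: const_simps)
qed

end

context affine
begin

text \<open>The triple of \<alpha> + d\<delta> gives E_0 and F_0, that of \<alpha> gives F_1. F_0
  has weight - \<alpha> - d\<delta>, below the current algebra; it serves to run the recursion, and
  the family is then shifted so that f_0 has weight - \<alpha>.\<close>

lemma loop_data:
  assumes \<alpha>: "\<alpha> \<in> fin_roots K T" and d: "d = int (dd K T \<alpha>)"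
  obtains e f where "e \<in> rs (\<alpha> + mul d (null_root T))" "e \<noteq> 0"
    "\<And>j. f j \<in> rs (- \<alpha> + mul (int j * d) (null_root T))" "\<And>j. f j \<noteq> 0"
    "\<And>b c. lie K (lie K e (f c)) (f b) = scale K (- 2) (f (b + Suc c))"
    "\<And>i j. lie K (f i) (f j) = 0"
proof -
  let ?n = "null_root T" and ?\<gamma> = "\<alpha> + mul d (null_root T)"
  have r: "real_root T (\<alpha> + mul (k * d) ?n)" for k
    using fin_root_string(1)[OF \<alpha>] unfolding d .
  have "\<alpha> + mul (1 * d) ?n = ?\<gamma>" "\<alpha> + mul (0 * d) ?n = \<alpha>" by (rule ext, simp)+
  then have "real_root T ?\<gamma>" "real_root T \<alpha>" using r[of 1] r[of 0] by (simp_all only:)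
  then obtain E0 F0 h G F1 h' where t: "triple ?\<gamma> E0 F0 h" "triple \<alpha> G F1 h'"
    using real_triple by metis
  have lat: "\<alpha> \<in> root_lattice T" "\<alpha> 0 = 0"
    using real_in_lattice \<alpha> fin_roots_iff by auto
  have "\<alpha> \<noteq> 0" using \<alpha> by (auto simp: fin_roots_def zero_fun_def)
  have zero: "y = 0" if "y \<in> rs \<mu>" "\<mu> = mul 2 \<alpha> + mul k ?n \<or> \<mu> = mul 2 (- \<alpha>) + mul k ?n" for y \<mu> k
  proof -
    have "- \<alpha> \<noteq> 0" using \<open>\<alpha> \<noteq> 0\<close> by (metis minus_minus minus_zero)
    moreover have "- \<alpha> \<in> root_lattice T" "(- \<alpha>) 0 = 0" using lat lattice_simps(3) by auto
    ultimately show ?thesis using that rs_even_zero[OF lat \<open>\<alpha> \<noteq> 0\<close>] rs_even_zero[of "- \<alpha>"] by metis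
  qed
  define H1 where "H1 = lie K E0 F1"
  have H1: "H1 \<in> rs (mul d ?n)"
  proof -
    have "?\<gamma> + - \<alpha> = mul d ?n" by (rule ext) simp
    then show ?thesis using rs_br[of E0 ?\<gamma> F1 "- \<alpha>"] t unfolding triple_def H1_def by (simp only:)
  qed
  \<comment> \<open>The factors make the recursions \<open>E_Suc\<close> and \<open>F_Suc\<close>
    hold by construction.\<close>
  define E where "E k = ((\<lambda>y. scale K (1 / 2) (lie K H1 y)) ^^ k) E0" for k
  define F where "F k = ((\<lambda>y. scale K (- 1 / 2) (lie K H1 y)) ^^ k) F0" for k
  have E_Suc: "lie K H1 (E k) = scale K 2 (E (Suc k))" for k by (simp add: E_def)
  have F_Suc: "lie K H1 (F k) = scale K (- 2) (F (Suc k))" for k by (simp add: F_def)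
  have E_rs: "E k \<in> rs (\<alpha> + mul (int (Suc k) * d) ?n)" for k
  proof (induction k)
    case 0
    have "\<alpha> + mul (int (Suc 0) * d) ?n = ?\<gamma>" by (rule ext) simp
    then show ?case using t(1) by (simp only: E_def funpow_0 triple_def)
  next
    case (Suc k)
    have "mul d ?n + (\<alpha> + mul (int (Suc k) * d) ?n) = \<alpha> + mul (int (Suc (Suc k)) * d) ?n"
      by (rule ext) (simp add: algebra_simps)
    then have "lie K H1 (E k) \<in> rs (\<alpha> + mul (int (Suc (Suc k)) * d) ?n)"
      using rs_br[OF H1 Suc] by (simp only:)
    then have "scale K (1 / 2) (lie K H1 (E k)) \<in> rs (\<alpha> + mul (int (Suc (Suc k)) * d) ?n)"
      by (rule subspace_scale[OF rs_subspace])
    then show ?case by (simp only: E_def funpow.simps o_apply)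
  qed
  have F_rs: "F k \<in> rs (- \<alpha> + mul ((int k - 1) * d) ?n)" for k
  proof (induction k)
    case 0
    have "- \<alpha> + mul ((int 0 - 1) * d) ?n = - ?\<gamma>" by (rule ext) simp
    then show ?case using t(1) by (simp only: F_def funpow_0 triple_def)
  next
    case (Suc k)
    have "mul d ?n + (- \<alpha> + mul ((int k - 1) * d) ?n) = - \<alpha> + mul ((int (Suc k) - 1) * d) ?n"
      by (rule ext) (simp add: algebra_simps)
    then have "lie K H1 (F k) \<in> rs (- \<alpha> + mul ((int (Suc k) - 1) * d) ?n)"
      using rs_br[OF H1 Suc] by (simp only:)
    then have "scale K (- 1 / 2) (lie K H1 (F k)) \<in> rs (- \<alpha> + mul ((int (Suc k) - 1) * d) ?n)"
      by (rule subspace_scale[OF rs_subspace])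
    then show ?case by (simp only: F_def funpow.simps o_apply)
  qed
  have EE: "lie K (E k) (E l) = 0" for k l
  proof (rule zero[OF rs_br[OF E_rs E_rs], OF disjI1])
    show "\<alpha> + mul (int (Suc k) * d) ?n + (\<alpha> + mul (int (Suc l) * d) ?n)
        = mul 2 \<alpha> + mul (int (Suc k) * d + int (Suc l) * d) ?n"
      by (rule ext) (simp add: algebra_simps)
  qed
  have FF: "lie K (F k) (F l) = 0" for k l
  proof (rule zero[OF rs_br[OF F_rs F_rs], OF disjI2])
    show "- \<alpha> + mul ((int k - 1) * d) ?n + (- \<alpha> + mul ((int l - 1) * d) ?n)
        = mul 2 (- \<alpha>) + mul ((int k - 1) * d + (int l - 1) * d) ?n"
      by (rule ext) (simp add: algebra_simps)
  qed
  have h: "h \<in> cartan K" "h' \<in> cartan K" "rf ?n h = 0" "rf ?n h' = 0" "rf \<alpha> h = 2" "rf \<alpha> h' = 2"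
    using t unfolding triple_def rf_add mul_def rf_mult by auto
  have act: "lie K k y = scale K 2 y" "lie K k z = scale K (- 2) z"
    if "k = h \<or> k = h'" "y \<in> rs (\<alpha> + mul l ?n)" "z \<in> rs (- \<alpha> + mul l' ?n)" for k y z l l'
  proof -
    have "rf (\<alpha> + mul l ?n) k = 2" "rf (- \<alpha> + mul l' ?n) k = - 2"
      using that(1) h unfolding rf_add rf_minus mul_def rf_mult by auto
    then show "lie K k y = scale K 2 y" "lie K k z = scale K (- 2) z"
      using rs_mem[OF that(2), of k] rs_mem[OF that(3), of k] that(1) h(1,2) by auto
  qed
  have E00: "E 0 = E0" "F 0 = F0" by (simp_all add: E_def F_def)
  have F0F1: "lie K F0 F1 = 0"
  proof (rule zero[OF _ disjI2])
    show "lie K F0 F1 \<in> rs (- ?\<gamma> + - \<alpha>)" using t by (intro rs_br) (auto simp: triple_def)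
    show "- ?\<gamma> + - \<alpha> = mul 2 (- \<alpha>) + mul (- d) ?n" by (rule ext) simp
  qed
  have F1: "F1 \<in> rs (- \<alpha> + mul 0 ?n)"
  proof -
    have "- \<alpha> + mul 0 ?n = - \<alpha>" by (rule ext) simp
    then show ?thesis using t(2) by (simp only: triple_def)
  qed
  have G: "G \<in> rs (\<alpha> + mul 0 ?n)"
  proof -
    have "\<alpha> + mul 0 ?n = \<alpha>" by (rule ext) simp
    then show ?thesis using t(2) by (simp only: triple_def)
  qed
  have EF: "lie K E0 F0 = h" "lie K G F1 = h'" using t by (auto simp: triple_def)
  \<comment> \<open>This links the two triples: the recursion started at F_0 returns the chosen
    vector F1 of weight - \<alpha>.\<close>
  have "lie K H1 F0 = scale K (- 2) F1"
  proof -
    have "lie K H1 F0 = - lie K F1 h"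
      using br_br_left[of E0 F1 F0] EF(1) F0F1 br_anti[of F1 F0] unfolding H1_def by simp
    also have "\<dots> = lie K h F1" using br_anti[of F1 h] by simp
    also have "\<dots> = scale K (- 2) F1" by (rule act(2)[OF _ G F1]) simp
    finally show ?thesis .
  qed
  then have F_1: "F 1 = F1" using F_Suc[of 0] E00 by simp
  have GE: "lie K G (E 0) = 0"
  proof (rule zero[OF rs_br[OF G E_rs], OF disjI1])
    show "\<alpha> + mul 0 ?n + (\<alpha> + mul (int (Suc 0) * d) ?n) = mul 2 \<alpha> + mul d ?n"
      by (rule ext) simp
  qed
  have loop_assms: "lie K (E 0) (F 0) = h" "\<And>k. lie K h (E k) = scale K 2 (E k)"
    "\<And>k. lie K h (F k) = scale K (- 2) (F k)"
    "\<And>k. lie K (lie K (E 0) (F 1)) (E k) = scale K 2 (E (Suc k))"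
    "\<And>k. lie K (lie K (E 0) (F 1)) (F k) = scale K (- 2) (F (Suc k))"
    using EF(1) act[OF disjI1[OF refl] E_rs F_rs] E_Suc F_Suc unfolding E00 F_1 H1_def by blast+
  note HF = loop_HF[OF loop_assms(1-3) EE FF loop_assms(4,5)]
  have "F 1 \<noteq> 0" using triple_nonzero[OF t(2)] F_1 by simp
  then have nz: "F (Suc k) \<noteq> 0" for k
    by (intro loop_nonzero[OF loop_assms(1-3) EE FF loop_assms(4,5), of G h'])
      (use EF(2) F_1 GE act[OF disjI1[OF refl] G F_rs] act[OF disjI2[OF refl] G F_rs] in auto)
  show thesis
  proof (rule that[of E0 "\<lambda>j. F (Suc j)"])
    show "E0 \<in> rs ?\<gamma>" "E0 \<noteq> 0" using t(1) triple_nonzero[OF t(1)] by (auto simp: triple_def)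
    show "F (Suc j) \<in> rs (- \<alpha> + mul (int j * d) ?n)" for j using F_rs[of "Suc j"] by simp
    show "lie K (lie K E0 (F (Suc c))) (F (Suc b)) = scale K (- 2) (F (Suc (b + Suc c)))" for b c
      using HF[of "Suc c" "Suc b"] unfolding E00 by (simp add: add.commute)
  qed (rule nz FF)+
qed

end

section \<open>The current algebra\<close>

lemma root_shift_eq: "root_shift \<alpha> k \<delta> = \<alpha> + mul (int k) \<delta>"
  by (rule ext) (simp add: root_shift_def)

locale affine_vectors = affine K T for K :: "('a::ab_group_add) km_data" and T +
  fixes x :: "root \<Rightarrow> 'a"
  assumes vectors: "real_root_vectors K T x"
begin

abbreviation "L \<equiv> current_algebra K T"

lemma rs_multiple:
  assumes "real_root T \<gamma>" "y \<in> rs \<gamma>" "y \<noteq> 0" "z \<in> rs \<gamma>" shows "\<exists>c. z = scale K c y"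
proof -
  have "rs \<gamma> = span {x \<gamma>}" using vectors assms(1) by (simp add: real_root_vectors_def)
  then obtain a b where ab: "y = scale K a (x \<gamma>)" "z = scale K b (x \<gamma>)"
    using assms(2,4) by (auto simp: span_singleton)
  then have "a \<noteq> 0" using assms(3) by auto
  then have "z = scale K (b / a) y" using ab by simp
  then show ?thesis ..
qed

lemma vector_multiple:
  assumes "real_root T \<gamma>" "y \<in> rs \<gamma>" "y \<noteq> 0" shows "\<exists>c. c \<noteq> 0 \<and> x \<gamma> = scale K c y"
proof -
  have sp: "rs \<gamma> = span {x \<gamma>}" using vectors assms(1) by (simp add: real_root_vectors_def)
  then have "x \<gamma> \<in> rs \<gamma>" using span_base[of "x \<gamma>" "{x \<gamma>}"] by simp
  from rs_multiple[OF assms this] obtain c where c: "x \<gamma> = scale K c y" ..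
  have "c \<noteq> 0"
  proof
    assume "c = 0"
    then have "rs \<gamma> = {0}" using sp c by (auto simp: span_singleton)
    then show False using assms(2,3) by blast
  qed
  with c show ?thesis by blast
qed

lemma L_subspace: "subspace L"
  by (simp add: current_algebra_def)

lemma L_cartan: "fin_cartan K T \<subseteq> L"
  unfolding current_algebra_def by (rule subset_trans[OF _ span_superset]) auto

lemma fin_cartan_cartan: "fin_cartan K T \<subseteq> cartan K"
  unfolding fin_cartan_def by (rule span_minimal[OF _ cartan_subspace]) (use coroot_cartan in auto)

lemma L_pos:
  assumes "y \<in> rs \<mu>" "\<mu> \<in> root_lattice T" "\<And>i. 0 \<le> \<mu> i" "\<mu> \<noteq> 0" shows "y \<in> L"
proof (cases "y = 0")
  case True then show ?thesis using subspace_0[OF L_subspace] by simp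
next
  case False
  then have "rs \<mu> \<noteq> {0}" using assms(1) by blast
  then have "\<mu> \<in> pos_roots K T" using assms by (simp add: pos_roots_def roots_def zero_fun_def)
  then show ?thesis unfolding current_algebra_def using assms(1) by (intro span_base) blast
qed

lemma L_neg:
  assumes "y \<in> rs \<mu>" "y \<in> fin_alg K T" "\<mu> \<in> root_lattice T" "\<mu> 0 = 0" "\<And>i. \<mu> i \<le> 0" "\<mu> \<noteq> 0"
  shows "y \<in> L"
proof (cases "y = 0")
  case True then show ?thesis using subspace_0[OF L_subspace] by simp
next
  case False
  then have y: "y \<in> fin_root_space K T \<mu>" "fin_root_space K T \<mu> \<noteq> {0}"
    using assms(1,2) by (auto simp: fin_root_space_def)
  then have "\<mu> \<in> fin_neg_roots K T"
    using assms by (simp add: fin_neg_roots_def fin_roots_def zero_fun_def)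
  then show ?thesis unfolding current_algebra_def using y(1) by (intro span_base) blast
qed

text \<open>Roots have a sign, so one with nonnegative coefficient at node 0 is positive or else a
  finite negative root.\<close>

lemma L_sign:
  assumes y: "y \<in> rs \<mu>" "\<mu> \<in> root_lattice T" "\<mu> \<noteq> 0" and "0 \<le> \<mu> 0"
    and fin: "\<mu> 0 = 0 \<Longrightarrow> y \<in> fin_alg K T"
  shows "y \<in> L"
proof (cases "y = 0")
  case True then show ?thesis using subspace_0[OF L_subspace] by simp
next
  case False
  then have "rs \<mu> \<noteq> {0}" using y(1) by blast
  then have "\<mu> \<in> roots K T" using y by (simp add: roots_def zero_fun_def)
  from roots_sign[OF this] show ?thesis
  proof
    assume "\<forall>i. 0 \<le> \<mu> i" then show ?thesis using L_pos[OF y(1,2) _ y(3)] by blast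
  next
    assume neg: "\<forall>i. \<mu> i \<le> 0"
    then have "\<mu> 0 = 0" using assms(4) by (meson order_antisym)
    then show ?thesis using L_neg[OF y(1) fin y(2) _ _ y(3)] neg by blast
  qed
qed

lemma L_imag: "y \<in> rs \<mu> \<Longrightarrow> \<mu> \<in> root_lattice T \<Longrightarrow> 0 < \<mu> 0 \<Longrightarrow> y \<in> L"
  by (rule L_sign) auto

lemma fin_root_props:
  assumes "\<alpha> \<in> fin_roots K T"
  shows "\<alpha> \<in> root_lattice T" "\<alpha> 0 = 0" "\<alpha> \<noteq> 0" "real_root T \<alpha>" "- \<alpha> \<in> fin_roots K T"
proof -
  show "\<alpha> \<in> root_lattice T" "\<alpha> 0 = 0" "\<alpha> \<noteq> 0" using assms by (auto simp: fin_roots_def zero_fun_def)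
  have r: "real_in T {1..rk T} \<alpha>" using assms fin_roots_iff by blast
  then show "real_root T \<alpha>" by (rule real_in_real) auto
  have "real_in T {1..rk T} (- \<alpha>)" using r by (rule real_in_minus) auto
  then show "- \<alpha> \<in> fin_roots K T" using fin_roots_iff by blast
qed

lemma rs_fin_alg: assumes "\<alpha> \<in> fin_roots K T" shows "rs \<alpha> \<subseteq> fin_alg K T"
proof
  fix z assume z: "z \<in> rs \<alpha>"
  obtain e f h where t: "triple \<alpha> e f h" "e \<in> fin_alg K T"
    using fin_triple assms fin_roots_iff by blast
  then obtain c where "z = scale K c e"
    using rs_multiple[OF fin_root_props(4)[OF assms] _ _ z] triple_nonzero by (metis triple_def)
  then show "z \<in> fin_alg K T" using subspace_scale[OF fin_alg_closed(1) t(2)] by simp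
qed

text \<open>Real root spaces are lines, so the bracket is a multiple of the one in a triple inside
  the finite subalgebra.\<close>

lemma rs_opposite:
  assumes "\<alpha> \<in> fin_roots K T" "y \<in> rs \<alpha>" "z \<in> rs (- \<alpha>)" shows "lie K y z \<in> fin_cartan K T"
proof -
  obtain e f h where t: "triple \<alpha> e f h" "h \<in> fin_cartan K T"
    using fin_triple assms fin_roots_iff by blast
  have ef: "e \<in> rs \<alpha>" "e \<noteq> 0" "f \<in> rs (- \<alpha>)" "f \<noteq> 0" "lie K e f = h"
    using t(1) triple_nonzero by (auto simp: triple_def)
  obtain a where a: "y = scale K a e" using rs_multiple[OF fin_root_props(4)[OF assms(1)] ef(1,2) assms(2)] ..
  obtain b where b: "z = scale K b f"
    using rs_multiple[OF real_minus[OF fin_root_props(4)[OF assms(1)]] ef(3,4) assms(3)] ..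
  show ?thesis unfolding a b br_scale_left br_scale_right ef(5)
    by (intro subspace_scale[OF fin_cartan_subspace] t(2))
qed

lemma neg_vector_L: "\<alpha> \<in> fin_pos_roots K T \<Longrightarrow> y \<in> rs (- \<alpha>) \<Longrightarrow> y \<in> L"
proof -
  assume \<alpha>: "\<alpha> \<in> fin_pos_roots K T" and y: "y \<in> rs (- \<alpha>)"
  then have f: "\<alpha> \<in> fin_roots K T" "\<And>i. 0 \<le> \<alpha> i" by (auto simp: fin_pos_roots_def)
  note m = fin_root_props[OF fin_root_props(5)[OF f(1)]]
  show "y \<in> L"
    by (rule L_neg[OF y subsetD[OF rs_fin_alg[OF fin_root_props(5)[OF f(1)]] y] m(1,2) _ m(3)]) (use f(2) in simp)
qed

lemma weight_br_L: "h \<in> fin_cartan K T \<Longrightarrow> y \<in> rs \<mu> \<Longrightarrow> y \<in> L \<Longrightarrow> lie K h y \<in> L \<and> lie K y h \<in> L"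
proof -
  assume h: "h \<in> fin_cartan K T" and y: "y \<in> rs \<mu>" "y \<in> L"
  have "h \<in> cartan K" using h fin_cartan_cartan by blast
  then show "lie K h y \<in> L \<and> lie K y h \<in> L"
    using rs_mem[OF y(1)] rs_mem_right[OF y(1)] subspace_scale[OF L_subspace y(2)]
    by (simp del: scale_minus_left)
qed

lemma L_bracket_closed: "bracket_closed K L"
proof -
  let ?A = "fin_cartan K T" and ?B = "\<Union>\<gamma>\<in>pos_roots K T. rs \<gamma>"
    and ?C = "\<Union>\<alpha>\<in>fin_neg_roots K T. fin_root_space K T \<alpha>"
  let ?G = "?A \<union> ?B \<union> ?C"
  have L: "L = span ?G" by (simp add: current_algebra_def)
  have GL: "?G \<subseteq> L" unfolding L by (rule span_superset)
  have BC: "lie K y z \<in> L \<and> lie K z y \<in> L"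
    if "\<gamma> \<in> pos_roots K T" "y \<in> rs \<gamma>" "\<mu> \<in> fin_neg_roots K T" "z \<in> fin_root_space K T \<mu>" for y z \<gamma> \<mu>
  proof -
    note \<gamma> = pos_roots_props[OF that(1)]
    have \<mu>: "\<mu> \<in> fin_roots K T" "\<And>i. \<mu> i \<le> 0" using that(3) by (auto simp: fin_neg_roots_def)
    note m = fin_root_props[OF \<mu>(1)]
    have z: "z \<in> rs \<mu>" "z \<in> fin_alg K T" using that(4) by (auto simp: fin_root_space_def)
    have "lie K y z \<in> L"
    \<comment> \<open>In weight 0 it is not enough to land in the Cartan subalgebra of K; the
      bracket must lie in its finite part.\<close>
    proof (cases "\<gamma> + \<mu> = 0")
      case True
      then have "\<gamma> = - \<mu>" by (rule eq_neg_iff_add_eq_0[THEN iffD2])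
      then have "\<gamma> \<in> fin_roots K T" "\<mu> = - \<gamma>" using m(5) by (auto simp only: minus_minus)
      then have "lie K y z \<in> fin_cartan K T" using rs_opposite[OF _ that(2)] z(1) by (simp only:)
      then show ?thesis using L_cartan by blast
    next
      case False
      have "\<gamma> + \<mu> \<in> root_lattice T" by (rule lattice_simps(2)[OF \<gamma>(1) m(1)])
      moreover have "lie K y z \<in> fin_alg K T" if "(\<gamma> + \<mu>) 0 = 0"
      proof -
        have "\<gamma> 0 = 0" using that m(2) by simp
        then have "\<gamma> \<in> fin_roots K T" using finite_root_real_in[OF \<gamma>(2)] fin_roots_iff by blast
        then show ?thesis using rs_fin_alg \<open>y \<in> rs \<gamma>\<close> z(2) fin_alg_closed(2) by blast
      qed
      ultimately show ?thesis
        by (intro L_sign[OF rs_br[OF that(2) z(1)] _ False]) (use \<gamma>(3)[of 0] m(2) in simp_all)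
    qed
    then show ?thesis using br_anti[of z y] subspace_neg[OF L_subspace] by simp
  qed
  have gen: "lie K y z \<in> L" if y: "y \<in> ?G" and z: "z \<in> ?G" for y z
  proof -
    have weight: "\<exists>\<mu>. w \<in> rs \<mu>" if "w \<in> ?B \<or> w \<in> ?C" for w
      using that by (auto simp: fin_root_space_def)
    define A B C where ABC: "A = ?A" "B = ?B" "C = ?C"
    have "y \<in> A \<or> y \<in> B \<or> y \<in> C" "z \<in> A \<or> z \<in> B \<or> z \<in> C"
      using y z unfolding ABC by (simp_all only: Un_iff disj_assoc)
    then consider "y \<in> A" "z \<in> A" | "y \<in> A" "z \<in> B \<or> z \<in> C" | "z \<in> A" "y \<in> B \<or> y \<in> C"
      | "y \<in> B" "z \<in> B" | "y \<in> B" "z \<in> C" | "y \<in> C" "z \<in> B" | "y \<in> C" "z \<in> C"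
      by argo
    then show ?thesis
    proof cases
      case 1
      then have "lie K y z = 0" using cartan_br fin_cartan_cartan unfolding ABC by blast
      then show ?thesis using subspace_0[OF L_subspace] by simp
    next
      case 2
      then obtain \<mu> where "z \<in> rs \<mu>" using weight unfolding ABC by metis
      then show ?thesis using weight_br_L[of y z \<mu>] 2(1) subsetD[OF GL z] unfolding ABC by simp
    next
      case 3
      then obtain \<mu> where "y \<in> rs \<mu>" using weight unfolding ABC by metis
      then show ?thesis using weight_br_L[of z y \<mu>] 3(1) subsetD[OF GL y] unfolding ABC by simp
    next
      case 4
      then obtain \<gamma> \<mu> where g: "\<gamma> \<in> pos_roots K T" "\<mu> \<in> pos_roots K T" "y \<in> rs \<gamma>" "z \<in> rs \<mu>"
        unfolding ABC by blast
      note p = pos_roots_props[OF g(1)] and q = pos_roots_props[OF g(2)]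
      have "\<gamma> + \<mu> \<noteq> 0"
      proof
        assume sum: "\<gamma> + \<mu> = 0"
        have "\<gamma> i = 0" for i using fun_cong[OF sum, of i] p(3)[of i] q(3)[of i] by simp
        then show False using p(4) by (simp add: fun_eq_iff)
      qed
      then show ?thesis
        by (intro L_pos[OF rs_br[OF g(3,4)] lattice_simps(2)[OF p(1) q(1)]]) (use p(3) q(3) in simp_all)
    next
      case 5
      then obtain \<gamma> \<mu> where "\<gamma> \<in> pos_roots K T" "y \<in> rs \<gamma>" "\<mu> \<in> fin_neg_roots K T" "z \<in> fin_root_space K T \<mu>"
        unfolding ABC by blast
      from BC[OF this] show ?thesis ..
    next
      case 6
      then obtain \<gamma> \<mu> where "\<gamma> \<in> pos_roots K T" "z \<in> rs \<gamma>" "\<mu> \<in> fin_neg_roots K T" "y \<in> fin_root_space K T \<mu>"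
        unfolding ABC by blast
      from BC[OF this] show ?thesis ..
    next
      case 7
      then obtain \<gamma> \<mu> where g: "\<gamma> \<in> fin_neg_roots K T" "\<mu> \<in> fin_neg_roots K T"
        "y \<in> rs \<gamma>" "z \<in> rs \<mu>" "y \<in> fin_alg K T" "z \<in> fin_alg K T"
        unfolding ABC by (auto simp: fin_root_space_def)
      have s: "\<And>i. \<gamma> i \<le> 0" "\<And>i. \<mu> i \<le> 0" "\<gamma> \<in> fin_roots K T" "\<mu> \<in> fin_roots K T"
        using g by (auto simp: fin_neg_roots_def)
      note p = fin_root_props[OF s(3)] and q = fin_root_props[OF s(4)]
      have "\<gamma> + \<mu> \<noteq> 0"
      proof
        assume sum: "\<gamma> + \<mu> = 0"
        have "\<gamma> i = 0" for i using fun_cong[OF sum, of i] s(1)[of i] s(2)[of i] by simp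
        then show False using p(3) by (simp add: fun_eq_iff)
      qed
      then show ?thesis
        by (intro L_neg[OF rs_br[OF g(3,4)] fin_alg_closed(2)[OF g(5,6)] lattice_simps(2)[OF p(1) q(1)]])
          (use s p(2) q(2) in \<open>simp_all add: add_nonpos_nonpos\<close>)
    qed
  qed
  have one: "lie K y z \<in> L" if "y \<in> ?G" "z \<in> L" for y z
    using span_ad_closed[of ?G y ?G z] gen[OF that(1)] that(2) unfolding L by blast
  have "lie K y z \<in> L" if y: "y \<in> L" and z: "z \<in> L" for y z
  proof -
    have "lie K z w \<in> L" if "w \<in> ?G" for w
      using one[OF that z] br_anti[of z w] subspace_neg[OF L_subspace] by simp
    then have "lie K z y \<in> L" using span_ad_closed[of ?G z ?G y] y unfolding L by blast
    then show ?thesis using br_anti[of y z] subspace_neg[OF L_subspace] by simp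
  qed
  then show ?thesis
    unfolding bracket_closed_def using subspace_add[OF L_subspace] subspace_scale[OF L_subspace] by blast
qed

lemma n_plus_L: "current_n_plus K T (null_root T) \<subseteq> L"
  unfolding current_n_plus_def
proof (rule span_minimal[OF UN_least L_subspace])
  fix \<gamma> assume "\<gamma> \<in> fin_pos_roots K T
        \<union> {root_shift \<alpha> k (null_root T) | \<alpha> k. \<alpha> \<in> fin_pos_roots K T \<and> short_root K T \<alpha> \<and> 1 \<le> k}
        \<union> {root_shift \<alpha> (twist T * k) (null_root T) | \<alpha> k. \<alpha> \<in> fin_pos_roots K T \<and> long_root K T \<alpha> \<and> 1 \<le> k}"
  then consider "\<gamma> \<in> fin_pos_roots K T"
    | \<alpha> k where "\<gamma> = root_shift \<alpha> k (null_root T)" "\<alpha> \<in> fin_pos_roots K T" "1 \<le> k"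
    | \<alpha> k where "\<gamma> = root_shift \<alpha> (twist T * k) (null_root T)" "\<alpha> \<in> fin_pos_roots K T" "1 \<le> k"
    by blast
  then show "rs \<gamma> \<subseteq> L"
  proof cases
    case 1
    then have "\<gamma> \<in> fin_roots K T" "\<And>i. 0 \<le> \<gamma> i" by (auto simp: fin_pos_roots_def)
    then show ?thesis using L_pos fin_root_props(1,3) by blast
  next
    case 2
    then have "\<alpha> \<in> fin_roots K T" by (simp add: fin_pos_roots_def)
    note p = fin_root_props[OF this]
    have "\<gamma> \<in> root_lattice T" "0 < \<gamma> 0"
      using p(1,2) null_root_lattice[of T] 2 by (auto simp: root_lattice_def root_shift_def)
    then show ?thesis using L_imag by blast
  next
    case 3
    then have "\<alpha> \<in> fin_roots K T" by (simp add: fin_pos_roots_def)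
    note p = fin_root_props[OF this]
    have "\<gamma> \<in> root_lattice T" "0 < \<gamma> 0"
      using p(1,2) null_root_lattice[of T] 3 symm_values(4)[OF valid]
      by (auto simp: root_lattice_def root_shift_def)
    then show ?thesis using L_imag by blast
  qed
qed

lemma h_plus_L: "current_h_plus K T (null_root T) \<subseteq> L"
  unfolding current_h_plus_def
proof (rule span_minimal[OF UN_least L_subspace])
  fix k :: nat assume "k \<in> {1..}"
  then have "(\<lambda>i. int k * null_root T i) \<in> root_lattice T" "0 < int k * null_root T 0"
    using null_root_lattice[of T] by (auto simp: root_lattice_def)
  then show "rs (\<lambda>i. int k * null_root T i) \<subseteq> L" using L_imag by blast
qed

lemma weyl_relations_closed:
  "local_weyl_relations K T (null_root T) x \<Lambda> \<subseteq> carrier (env_Cg K T)"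
proof -
  note env = env_of_closed[OF L_bracket_closed]
  have elt: "elt_Cg K T y \<in> carrier (env_Cg K T)" if "y \<in> L" for y
    unfolding elt_Cg_def by (intro env letter_closed that)
  have const: "env_of K L (letter h - const (\<Lambda> h)) \<in> carrier (env_Cg K T)" if "h \<in> fin_cartan K T" for h
    by (intro env free_algebra_closed letter_closed const_closed) (use that L_cartan in blast)
  interpret R: ring "env_Cg K T" by (rule env_ring[OF L_bracket_closed])
  have pow: "elt_Cg K T (x (- \<alpha>)) [^]\<^bsub>env_Cg K T\<^esub> (k::nat) \<in> carrier (env_Cg K T)"
    if "\<alpha> \<in> fin_pos_roots K T" for \<alpha> k
  proof -
    have r: "real_root T (- \<alpha>)"
      using that fin_root_props(4,5) by (auto simp: fin_pos_roots_def)
    then have "x (- \<alpha>) \<in> rs (- \<alpha>)"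
      using vectors span_base[of "x (- \<alpha>)" "{x (- \<alpha>)}"] unfolding real_root_vectors_def by blast
    then show ?thesis using R.nat_pow_closed[OF elt[OF neg_vector_L[OF that]]] by blast
  qed
  show ?thesis
    unfolding local_weyl_relations_def using elt const pow n_plus_L h_plus_L by blast
qed

text \<open>Instance of \<open>hook_relations_iff\<close>. With e of weight \<alpha> + d\<delta> and
  f_j of weight - \<alpha> + jd\<delta>, the bracket [e, f_j] has weight (j + 1)d\<delta>, so the
  relations of the local Weyl module put e and all these brackets into the left ideal.\<close>

lemma relations_iff:
  assumes N: "submodule N (env_Cg K T) (W_loc K T (null_root T) x \<Lambda>)"
    and \<alpha>: "\<alpha> \<in> fin_pos_roots K T" and p: "rectangular p \<or> special p"
    and sum: "of_nat (sum_list p) = \<Lambda> (coroot K T \<alpha>)"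
  shows "(\<forall>s r. 1 \<le> s \<and> 1 \<le> r \<and> (\<exists>k\<ge>1. s + r \<ge> 1 + r * k + sum_list (drop k p)) \<longrightarrow>
       (elt_Cg K T (x (root_shift \<alpha> (dd K T \<alpha>) (null_root T))) [^]\<^bsub>env_Cg K T\<^esub> s
         \<otimes>\<^bsub>env_Cg K T\<^esub> elt_Cg K T (x (- \<alpha>)) [^]\<^bsub>env_Cg K T\<^esub> (s + r))
        \<odot>\<^bsub>W_loc K T (null_root T) x \<Lambda>\<^esub> w_gen K T (null_root T) x \<Lambda> \<in> N)
    \<longleftrightarrow> elt_Cg K T (x (root_shift (- \<alpha>) (dd K T \<alpha> * length p) (null_root T)))
          \<odot>\<^bsub>W_loc K T (null_root T) x \<Lambda>\<^esub> w_gen K T (null_root T) x \<Lambda> \<in> N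
      \<and> (special p \<longrightarrow> (elt_Cg K T (x (root_shift (- \<alpha>) (dd K T \<alpha> * (length p - 1)) (null_root T)))
            [^]\<^bsub>env_Cg K T\<^esub> (last p + 1))
          \<odot>\<^bsub>W_loc K T (null_root T) x \<Lambda>\<^esub> w_gen K T (null_root T) x \<Lambda> \<in> N)"
proof -
  let ?n = "null_root T" and ?S = "local_weyl_relations K T (null_root T) x \<Lambda>"
  define d where "d = dd K T \<alpha>"
  have fin: "\<alpha> \<in> fin_roots K T" "\<And>i. 0 \<le> \<alpha> i" using \<alpha> by (auto simp: fin_pos_roots_def)
  note props = fin_root_props[OF fin(1)]
  have dpos: "1 \<le> d" using fin_root_string(2)[OF fin(1)] symm_values(4)[OF valid] by (auto simp: d_def)
  obtain e f where e: "e \<in> rs (\<alpha> + mul (int d) ?n)" "e \<noteq> 0"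
    and f: "\<And>j. f j \<in> rs (- \<alpha> + mul (int j * int d) ?n)" "\<And>j. f j \<noteq> 0"
    and hf: "\<And>b c. lie K (lie K e (f c)) (f b) = scale K (- 2) (f (b + Suc c))"
    and ff: "\<And>i j. lie K (f i) (f j) = 0"
    by (rule loop_data[OF fin(1), of "int d"]) (auto simp: d_def)
  have se: "root_shift \<alpha> d ?n = \<alpha> + mul (int d) ?n" by (rule root_shift_eq)
  have sf: "root_shift (- \<alpha>) (d * j) ?n = - \<alpha> + mul (int j * int d) ?n" for j
    unfolding root_shift_eq by (simp add: mult.commute)
  have s0: "root_shift (- \<alpha>) (d * 0) ?n = - \<alpha>" by (rule ext) (simp add: root_shift_def)
  have re: "real_root T (root_shift \<alpha> d ?n)"
  proof -
    have "root_shift \<alpha> d ?n = \<alpha> + mul (1 * int d) ?n" unfolding se by simp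
    then show ?thesis using fin_root_string(1)[OF fin(1), of 1] unfolding d_def by (simp only:)
  qed
  have rf': "real_root T (root_shift (- \<alpha>) (d * j) ?n)" for j
  proof -
    have "root_shift (- \<alpha>) (d * j) ?n = - (\<alpha> + mul (- int j * int d) ?n)"
      by (rule ext) (simp add: root_shift_def)
    then show ?thesis
      using real_minus[OF fin_root_string(1)[OF fin(1), of "- int j"]] unfolding d_def by (simp only:)
  qed
  obtain a where a: "a \<noteq> 0" "x (root_shift \<alpha> d ?n) = scale K a e"
    using vector_multiple[OF re _ e(2)] e(1) unfolding se by blast
  have "\<exists>b. b \<noteq> 0 \<and> x (root_shift (- \<alpha>) (d * j) ?n) = scale K b (f j)" for j
    using vector_multiple[OF rf' _ f(2)] f(1) unfolding sf by blast
  then obtain b where b: "\<And>j. b j \<noteq> 0" "\<And>j. x (root_shift (- \<alpha>) (d * j) ?n) = scale K (b j) (f j)"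
    by metis
  have b0: "x (- \<alpha>) = scale K (b 0) (f 0)" using b(2)[of 0] unfolding s0 .
  interpret P: env_pullback K L ?S N
    by (rule env_pullback.intro[OF L_bracket_closed weyl_relations_closed N[unfolded W_loc_def]])
  have eL: "e \<in> current_n_plus K T ?n"
  proof -
    have "rs (root_shift \<alpha> d ?n) \<subseteq> current_n_plus K T ?n"
    proof -
      have "root_shift \<alpha> d ?n \<in> {root_shift \<alpha> k ?n | \<alpha> k. \<alpha> \<in> fin_pos_roots K T \<and> short_root K T \<alpha> \<and> 1 \<le> k}
        \<union> {root_shift \<alpha> (twist T * k) ?n | \<alpha> k. \<alpha> \<in> fin_pos_roots K T \<and> long_root K T \<alpha> \<and> 1 \<le> k}"
        using fin_root_string(2)[OF fin(1)]
      proof (elim disjE conjE)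
        assume "dd K T \<alpha> = twist T" "long_root K T \<alpha>"
        moreover from this have "root_shift \<alpha> d ?n = root_shift \<alpha> (twist T * 1) ?n" by (simp add: d_def)
        ultimately show ?thesis using \<alpha> by blast
      next
        assume "dd K T \<alpha> = 1" "short_root K T \<alpha>"
        then show ?thesis using \<alpha> unfolding d_def by auto
      qed
      then show ?thesis
        unfolding current_n_plus_def by (intro subset_trans[OF _ span_superset]) blast
    qed
    then show ?thesis using e(1) unfolding se by blast
  qed
  have hH: "lie K e (f j) \<in> current_h_plus K T ?n" for j
  proof -
    have "\<alpha> + mul (int d) ?n + (- \<alpha> + mul (int j * int d) ?n) = (\<lambda>i. int ((j + 1) * d) * ?n i)"
      by (rule ext) (simp add: algebra_simps)
    then have "lie K e (f j) \<in> rs (\<lambda>i. int ((j + 1) * d) * ?n i)"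
      using rs_br[OF e(1) f(1)[of j]] by (simp only:)
    moreover have "(j + 1) * d \<in> {1..}" using dpos by simp
    ultimately show ?thesis unfolding current_h_plus_def by (intro span_base) blast
  qed
  have fL: "f j \<in> L" for j
  proof (cases "j = 0")
    case True
    have "- \<alpha> + mul (int 0 * int d) ?n = - \<alpha>" by (rule ext) simp
    then show ?thesis using neg_vector_L[OF \<alpha>] f(1)[of 0] True by (simp only:)
  next
    case False
    have "- \<alpha> + mul (int j * int d) ?n \<in> root_lattice T" "0 < (- \<alpha> + mul (int j * int d) ?n) 0"
      using props(1,2) null_root_lattice[of T] False dpos by (auto simp: root_lattice_def)
    then show ?thesis using L_imag[OF f(1)] by blast
  qed
  have eS: "env_of K L (letter e) \<in> ?S" and hS: "env_of K L (letter (lie K e (f j))) \<in> ?S" for j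
    using eL hH[of j] unfolding local_weyl_relations_def elt_Cg_def[symmetric] by blast+
  have eL': "e \<in> L" using eL n_plus_L by blast
  interpret Q: sl2_left_ideal P.C P.Z P.pull "letter e" "\<lambda>j. letter (f j)" "\<lambda>j. letter (lie K e (f j))"
    by (rule P.sl2_left_ideal_letters[OF eL' eS fL _ hS hf ff])
      (use hH h_plus_L in \<open>auto simp: scale_zero_left\<close>)
  have lC: "letter (scale K c y) \<in> P.C" if "y \<in> L" for c y
    using subspace_scale[OF L_subspace that] by (rule letter_closed)
  note pw = env_of_power[OF L_bracket_closed]
  have X: "elt_Cg K T (x (root_shift \<alpha> d ?n)) [^]\<^bsub>env_Cg K T\<^esub> s \<otimes>\<^bsub>env_Cg K T\<^esub> elt_Cg K T (x (- \<alpha>)) [^]\<^bsub>env_Cg K T\<^esub> t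
      = env_of K L (letter (scale K a e) ^ s * letter (scale K (b 0) (f 0)) ^ t)" for s t :: nat
    unfolding elt_Cg_def a(2) b0
    using ring_hom_mult[OF P.hom P.C_power[OF lC[OF eL'], of a s] P.C_power[OF lC[OF fL], of "b 0" 0 t]]
    by (simp add: pw lC eL' fL)
  have Y: "elt_Cg K T (x (root_shift (- \<alpha>) (d * j) ?n)) [^]\<^bsub>env_Cg K T\<^esub> t
      = env_of K L (letter (scale K (b j) (f j)) ^ t)" for j t
    unfolding elt_Cg_def b(2) by (simp add: pw lC fL)
  have Y1: "elt_Cg K T (x (root_shift (- \<alpha>) (d * j) ?n)) = env_of K L (letter (scale K (b j) (f j)) ^ 1)" for j
    unfolding elt_Cg_def b(2) by simp
  have sc_e: "letter (scale K a e) ^ s * v \<in> P.pull \<longleftrightarrow> letter e ^ s * v \<in> P.pull" if "v \<in> P.C" for s v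
    using P.scale_power_pull[OF eL' a(1) P.C_one that, of s] by simp
  have sc_f: "u * letter (scale K (b j) (f j)) ^ t \<in> P.pull \<longleftrightarrow> u * letter (f j) ^ t \<in> P.pull" if "u \<in> P.C" for u j t
    using P.scale_power_pull[OF fL[of j] b(1)[of j] that P.C_one, of t] by simp
  have mem: "env_of K L q \<odot>\<^bsub>W_loc K T ?n x \<Lambda>\<^esub> w_gen K T ?n x \<Lambda> \<in> N \<longleftrightarrow> q \<in> P.pull" if "q \<in> P.C" for q
    using P.mem_N_pull[OF that] unfolding W_loc_def w_gen_def .
  have V: "(elt_Cg K T (x (root_shift \<alpha> d ?n)) [^]\<^bsub>env_Cg K T\<^esub> s
         \<otimes>\<^bsub>env_Cg K T\<^esub> elt_Cg K T (x (- \<alpha>)) [^]\<^bsub>env_Cg K T\<^esub> t)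
        \<odot>\<^bsub>W_loc K T ?n x \<Lambda>\<^esub> w_gen K T ?n x \<Lambda> \<in> N \<longleftrightarrow> letter e ^ s * letter (f 0) ^ t \<in> P.pull" for s t :: nat
  proof -
    have "letter e ^ s \<in> P.C" by (intro P.C_power letter_closed eL')
    then show ?thesis
      unfolding X using sc_f[of "letter e ^ s" 0 t] sc_e[of "letter (scale K (b 0) (f 0)) ^ t" s]
        mem[of "letter (scale K a e) ^ s * letter (scale K (b 0) (f 0)) ^ t"]
      by (simp add: P.C_mult P.C_power lC eL' fL)
  qed
  have B: "env_of K L (letter (scale K (b j) (f j)) ^ t) \<odot>\<^bsub>W_loc K T ?n x \<Lambda>\<^esub> w_gen K T ?n x \<Lambda> \<in> N
      \<longleftrightarrow> letter (f j) ^ t \<in> P.pull" for j t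
    using mem[OF P.C_power[OF lC[OF fL]]] sc_f[OF P.C_one, of j t] by simp
  \<comment> \<open>Compatibility of the partition makes \<open>sum_list p + 1\<close> the exponent
    in \<open>local_weyl_relations\<close>.\<close>
  have top: "letter (f 0) ^ (sum_list p + 1) \<in> P.pull"
  proof -
    have "elt_Cg K T (x (- \<alpha>)) [^]\<^bsub>env_Cg K T\<^esub> (sum_list p + 1) \<in> ?S"
      unfolding local_weyl_relations_def using \<alpha> sum by blast
    then have "env_of K L (letter (scale K (b 0) (f 0)) ^ (sum_list p + 1)) \<in> ?S"
      using Y[of 0 "sum_list p + 1"] unfolding s0 by (simp only:)
    from P.relation_pull[OF P.C_power[OF lC[OF fL]] this]
    show ?thesis using sc_f[OF P.C_one, of 0 "sum_list p + 1"] by simp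
  qed
  show ?thesis
    unfolding d_def[symmetric] V Y B using Q.hook_relations_iff[OF top p]
    unfolding Y1 B by simp
qed

end

lemma relation_sets_subset_iff:
  "{F a s r | a s r. a \<in> A \<and> 1 \<le> (s::nat) \<and> 1 \<le> (r::nat) \<and> Q a s r} \<subseteq> N
     \<longleftrightarrow> (\<forall>a\<in>A. \<forall>s r. 1 \<le> s \<and> 1 \<le> r \<and> Q a s r \<longrightarrow> F a s r \<in> N)"
  "{G a | a. a \<in> A} \<union> {H a | a. a \<in> A \<and> S a} \<subseteq> N \<longleftrightarrow> (\<forall>a\<in>A. G a \<in> N \<and> (S a \<longrightarrow> H a \<in> N))"
  by blast+

theorem theorem4:
  fixes K :: "('a::ab_group_add) km_data"
    and T :: twisted_type
    and \<delta> :: root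
    and x :: "root \<Rightarrow> 'a"
    and \<Lambda> :: "'a \<Rightarrow> complex"
    and \<xi> :: "root \<Rightarrow> nat list"
  assumes "twisted_affine T K"
    and "is_delta K T \<delta>"
    and "real_root_vectors K T x"
    and "dominant_integral K T \<Lambda>"
    and "compatible K T \<Lambda> \<xi>"
    and "\<forall>\<alpha>\<in>fin_pos_roots K T. rectangular (\<xi> \<alpha>) \<or> special (\<xi> \<alpha>)"
  shows "module_isomorphic (env_Cg K T)
    (V_module K T \<delta> x \<Lambda> \<xi>)
    (W_loc_quotient K T \<delta> x \<Lambda>
      ({elt_Cg K T (x (root_shift (- \<alpha>) (dd K T \<alpha> * length (\<xi> \<alpha>)) \<delta>))
          \<odot>\<^bsub>W_loc K T \<delta> x \<Lambda>\<^esub> w_gen K T \<delta> x \<Lambda> | \<alpha>. \<alpha> \<in> fin_pos_roots K T}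
       \<union> {(elt_Cg K T (x (root_shift (- \<alpha>) (dd K T \<alpha> * (length (\<xi> \<alpha>) - 1)) \<delta>))
            [^]\<^bsub>env_Cg K T\<^esub> (last (\<xi> \<alpha>) + 1))
          \<odot>\<^bsub>W_loc K T \<delta> x \<Lambda>\<^esub> w_gen K T \<delta> x \<Lambda> | \<alpha>.
          \<alpha> \<in> fin_pos_roots K T \<and> special (\<xi> \<alpha>)}))"
    (is "module_isomorphic _ _ (W_loc_quotient _ _ _ _ _ ?B)")
proof -
  interpret affine_vectors K T x
    by (intro affine_vectors.intro affine_vectors_axioms.intro twisted_affine_affine assms)
  have \<delta>: "\<delta> = null_root T" by (rule is_delta_null[OF assms(2)])
  have "V_relations K T \<delta> x \<Lambda> \<xi> \<subseteq> N \<longleftrightarrow> ?B \<subseteq> N"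
    if N: "submodule N (env_Cg K T) (W_loc K T \<delta> x \<Lambda>)" for N
  proof -
    note iff = relations_iff[OF N[unfolded \<delta>], folded \<delta>]
    have *: "of_nat (sum_list (\<xi> \<alpha>)) = \<Lambda> (coroot K T \<alpha>)" "rectangular (\<xi> \<alpha>) \<or> special (\<xi> \<alpha>)"
      if "\<alpha> \<in> fin_pos_roots K T" for \<alpha>
      using assms(5,6) that by (auto simp: compatible_def)
    have "V_relations K T \<delta> x \<Lambda> \<xi> \<subseteq> N \<longleftrightarrow> (\<forall>\<alpha>\<in>fin_pos_roots K T.
       \<forall>s r. 1 \<le> s \<and> 1 \<le> r \<and> (\<exists>k\<ge>1. s + r \<ge> 1 + r * k + sum_list (drop k (\<xi> \<alpha>))) \<longrightarrow>
       (elt_Cg K T (x (root_shift \<alpha> (dd K T \<alpha>) \<delta>)) [^]\<^bsub>env_Cg K T\<^esub> s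
         \<otimes>\<^bsub>env_Cg K T\<^esub> elt_Cg K T (x (- \<alpha>)) [^]\<^bsub>env_Cg K T\<^esub> (s + r))
        \<odot>\<^bsub>W_loc K T \<delta> x \<Lambda>\<^esub> w_gen K T \<delta> x \<Lambda> \<in> N)"
      unfolding V_relations_def by (rule relation_sets_subset_iff)
    also have "\<dots> \<longleftrightarrow> ?B \<subseteq> N"
      unfolding relation_sets_subset_iff(2) by (rule ball_cong[OF refl iff[OF _ *(2) *(1)]])
    finally show ?thesis .
  qed
  then have "submodule_gen (env_Cg K T) (W_loc K T \<delta> x \<Lambda>) (V_relations K T \<delta> x \<Lambda> \<xi>)
      = submodule_gen (env_Cg K T) (W_loc K T \<delta> x \<Lambda>) ?B"
    by (rule submodule_gen_cong)
  \<comment> \<open>The two quotients are literally equal, so the identity is the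
    isomorphism.\<close>
  then have "V_module K T \<delta> x \<Lambda> \<xi> = W_loc_quotient K T \<delta> x \<Lambda> ?B"
    unfolding V_module_def W_loc_quotient_def by (simp only:)
  then show ?thesis using module_isomorphic_refl by (simp only:)
qed

end
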